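(* Let $r,n\ge 1$ be integers and $W=G(r,n)$. There exist non-negative integers $c_\mu$, indexed by the partitions $\mu$ of integers $d$ with $$0\le d\le 2rn-r-n$$ having at most $n$ parts, such that the $c_\mu$ depend only on $r$ and $n$ (in particular not on $\ell$), and for every integer $\ell\ge 1$ the $\mathbb{N}^\ell$-graded Hilbert series of the co-quasi-invariant space $\mathcal{Q}_W^{(\ell)}=\mathbb{Q}[X]/J_W$ in $\ell$ sets of $n$ variables is $$\mathcal{Q}_W^{(\ell)}(q_1,\dots,q_\ell)=\sum_\mu c_\mu\, s_\mu(q_1,\dots,q_\ell),$$ the sum being over all partitions $\mu$ of integers $d$ with $0\le d\le 2rn-r-n$ having at most $n$ parts, where $s_\mu$ denotes the Schur function.
   Context: Let $X=(x_{ij})$ be an $\ell\times n$ matrix of independent variables, and $\mathcal{R}_n^{(\ell)}=\mathbb{Q}[X]$. For an $\ell\times k$ matrix $A=(a_{ij})$ of non-negative integers and an $\ell\times k$ matrix $Y=(y_{ij})$ of variables, $Y^A:=\prod_{i,j}y_{ij}^{a_{ij}}$. The polynomial ring is $\mathbb{N}^\ell$-graded by giving $X^A$ the degree $\sum_j A_j\in\mathbb{N}^\ell$, where $A_j$ are the columns of $A$ (so each $x_{ij}$ has degree the $i$-th unit vector). An $r$-composition-matrix is an $\ell\times k$ matrix of non-negative integers, $1\le k\le n$, all of whose column sums are non-zero and congruent to $0$ mod $r$. For such $A$, the monomial quasi-invariant is $M_A:=\sum_{Y\subseteq X}Y^A$, where $Y$ runs over all $\ell\times k$ matrices obtained by selecting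 $k$ columns of $X$, kept in the order in which they appear in $X$. The constant-term-free (diagonal) quasi-invariant polynomials for $W=G(r,n)$ are the linear combinations of the $M_A$, for $A$ running over $r$-composition-matrices. $J_W$ is the ideal of $\mathbb{Q}[X]$ generated by them; it is homogeneous for the $\mathbb{N}^\ell$-grading. The co-quasi-invariant space is $\mathcal{Q}_W^{(\ell)}:=\mathbb{Q}[X]/J_W$, and its Hilbert series is $\mathcal{Q}_W^{(\ell)}(q_1,\dots,q_\ell):=\sum_{d\in\mathbb{N}^\ell}q_1^{d_1}\cdots q_\ell^{d_\ell}\dim(\mathcal{Q}_{W,d})$, where $\mathcal{Q}_{W,d}$ is the homogeneous component of degree $d$. As usual, $s_\mu(q_1,\dots,q_\ell)=0$ if $\mu$ has more than $\ell$ parts. *)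

theory Defs
  imports "HOL-Library.Poly_Mapping" "HOL-Algebra.QuotRing" "HOL-Algebra.Embedded_Algebras"
begin

text \<open>
  A polynomial over \<open>'a\<close> with variables from \<open>'v\<close> is an element of \<open>('v \<Rightarrow>\<^sub>0 nat) \<Rightarrow>\<^sub>0 'a\<close>,
  i.e. a finitely supported map from exponent vectors to coefficients.
  Rows and columns are numbered from 0.
\<close>

definition pvar :: "'v \<Rightarrow> ('v \<Rightarrow>\<^sub>0 nat) \<Rightarrow>\<^sub>0 'a::zero_neq_one" where
  "pvar v = Poly_Mapping.single (Poly_Mapping.single v 1) 1"

definition pconst :: "'a \<Rightarrow> ('v \<Rightarrow>\<^sub>0 nat) \<Rightarrow>\<^sub>0 'a::zero" where
  "pconst a = Poly_Mapping.single 0 a"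

type_synonym mpoly = "((nat \<times> nat) \<Rightarrow>\<^sub>0 nat) \<Rightarrow>\<^sub>0 rat"

text \<open>This is \<open>\<rat>[X]\<close> for the \<open>l \<times> n\<close> matrix \<open>X\<close> of variables \<open>x\<^sub>i\<^sub>j = pvar (i, j)\<close>\<close>

definition poly_ring :: "nat \<Rightarrow> nat \<Rightarrow> mpoly ring" where
  "poly_ring l n =
    \<lparr>carrier = {p. \<forall>m \<in> Poly_Mapping.keys p. Poly_Mapping.keys m \<subseteq> {..<l} \<times> {..<n}},
     mult = (*), one = 1, zero = 0, add = (+)\<rparr>"

text \<open>
  A matrix of non-negative integers is a function of which only the entries \<open>A i j\<close> with
  \<open>i < l\<close>, \<open>j < k\<close> are relevant.
\<close>

definition composition_matrix :: "nat \<Rightarrow> nat \<Rightarrow> nat \<Rightarrow> nat \<Rightarrow> (nat \<Rightarrow> nat \<Rightarrow> nat) \<Rightarrow> bool" where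
  "composition_matrix r n l k A \<longleftrightarrow>
    1 \<le> k \<and> k \<le> n \<and> (\<forall>j<k. (\<Sum>i<l. A i j) \<noteq> 0 \<and> r dvd (\<Sum>i<l. A i j))"

definition column_selections :: "nat \<Rightarrow> nat \<Rightarrow> (nat \<Rightarrow> nat) set" where
  "column_selections n k = {f \<in> {..<k} \<rightarrow>\<^sub>E {..<n}. strict_mono_on {..<k} f}"

definition monomial_quasi_invariant :: "nat \<Rightarrow> nat \<Rightarrow> nat \<Rightarrow> (nat \<Rightarrow> nat \<Rightarrow> nat) \<Rightarrow> mpoly" where
  "monomial_quasi_invariant n l k A =
    (\<Sum>f \<in> column_selections n k. \<Prod>i<l. \<Prod>j<k. pvar (i, f j) ^ A i j)"

definition monomial_quasi_invariants :: "nat \<Rightarrow> nat \<Rightarrow> nat \<Rightarrow> mpoly set" where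
  "monomial_quasi_invariants r n l =
    {monomial_quasi_invariant n l k A | k A. composition_matrix r n l k A}"

definition quasi_invariants :: "nat \<Rightarrow> nat \<Rightarrow> nat \<Rightarrow> mpoly set" where
  "quasi_invariants r n l =
    {(\<Sum>p\<in>F. pconst (a p) * p) | F a. finite F \<and> F \<subseteq> monomial_quasi_invariants r n l}"

definition J_W :: "nat \<Rightarrow> nat \<Rightarrow> nat \<Rightarrow> mpoly set" where
  "J_W r n l = Idl\<^bsub>poly_ring l n\<^esub> (quasi_invariants r n l)"

definition co_quasi_invariants :: "nat \<Rightarrow> nat \<Rightarrow> nat \<Rightarrow> mpoly set ring" where
  "co_quasi_invariants r n l = poly_ring l n Quot J_W r n l"

definition homogeneous_polys :: "nat \<Rightarrow> nat \<Rightarrow> (nat \<Rightarrow>\<^sub>0 nat) \<Rightarrow> mpoly set" where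
  "homogeneous_polys n l d =
    {p \<in> carrier (poly_ring l n).
      \<forall>m \<in> Poly_Mapping.keys p. \<forall>i.
        (\<Sum>j<n. Poly_Mapping.lookup m (i, j)) = Poly_Mapping.lookup d i}"

definition proj_image :: "nat \<Rightarrow> nat \<Rightarrow> nat \<Rightarrow> mpoly set \<Rightarrow> mpoly set set" where
  "proj_image r n l V = (\<lambda>p. J_W r n l +>\<^bsub>poly_ring l n\<^esub> p) ` V"

text \<open>
  A formal power series in \<open>q\<^sub>0, q\<^sub>1, \<dots>\<close> is given by its coefficient function on exponent vectors.
  The homogeneous component of degree \<open>d\<close> of the quotient is the image of that of \<open>\<rat>[X]\<close>.
  Dimensions over \<open>\<rat>\<close> are dimensions over the image of the constants, as
  \<^const>\<open>ring.dim\<close> requires the field to be contained in the ring. Degrees \<open>d\<close> not supported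
  in \<open>{..<l}\<close> have component \<open>{0}\<close>, so only \<open>q\<^sub>0, \<dots>, q\<^sub>l\<^sub>-\<^sub>1\<close> occur.
\<close>

definition hilbert_series :: "nat \<Rightarrow> nat \<Rightarrow> nat \<Rightarrow> (nat \<Rightarrow>\<^sub>0 nat) \<Rightarrow> int" where
  "hilbert_series r n l d =
    int (ring.dim (co_quasi_invariants r n l)
      (proj_image r n l (range pconst)) (proj_image r n l (homogeneous_polys n l d)))"

definition is_partition :: "nat list \<Rightarrow> bool" where
  "is_partition \<mu> \<longleftrightarrow> sorted_wrt (\<ge>) \<mu> \<and> 0 \<notin> set \<mu>"

definition young_diagram :: "nat list \<Rightarrow> (nat \<times> nat) set" where
  "young_diagram \<mu> = {(a, b). a < length \<mu> \<and> b < \<mu> ! a}"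

definition semistandard_tableaux :: "nat \<Rightarrow> nat list \<Rightarrow> (nat \<times> nat \<Rightarrow> nat) set" where
  "semistandard_tableaux l \<mu> =
    {T \<in> young_diagram \<mu> \<rightarrow>\<^sub>E {..<l}.
      (\<forall>a b. (a, Suc b) \<in> young_diagram \<mu> \<longrightarrow> T (a, b) \<le> T (a, Suc b)) \<and>
      (\<forall>a b. (Suc a, b) \<in> young_diagram \<mu> \<longrightarrow> T (a, b) < T (Suc a, b))}"

text \<open>
  \<open>s\<^sub>\<mu>(q\<^sub>0, \<dots>, q\<^sub>l\<^sub>-\<^sub>1)\<close>. It vanishes for \<open>length \<mu> > l\<close>, as there are no tableaux then.
\<close>

definition schur :: "nat \<Rightarrow> nat list \<Rightarrow> (nat \<Rightarrow>\<^sub>0 nat) \<Rightarrow>\<^sub>0 int" where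
  "schur l \<mu> = (\<Sum>T \<in> semistandard_tableaux l \<mu>. \<Prod>x \<in> young_diagram \<mu>. pvar (T x))"

end

theory Submission
  imports Defs "Jordan_Normal_Form.Determinant" "HOL-Library.Product_Lexorder"
begin

text \<open>
  The polarizations \<open>E\<^sub>a\<^sub>b = \<Sum>\<^sub>j x\<^sub>a\<^sub>j \<partial>/\<partial>x\<^sub>b\<^sub>j\<close> define an action of \<open>gl\<^sub>l\<close> on \<open>\<rat>[X]\<close> that preserves the ideal \<open>J\<close>.
  Multiplied by the Vandermonde product, the character of an eigenspace of the Casimir operator becomes
  an eigenfunction of the Laplacian in logarithmic coordinates. Hence the coefficient of
  \<open>q\<^sup>\<lambda>\<^sup>+\<^sup>\<delta>\<close> in the product with a full character is the dimension of the space of highest weight vectors of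
  weight \<open>\<lambda>\<close>. For \<open>\<rat>[X]/J\<close> this gives the coefficient of \<open>s\<^sub>\<lambda>\<close>, a difference of the dimensions
  for \<open>\<rat>[X]\<close> and for \<open>J\<close>, which is not negative and does not depend on \<open>l\<close>.

  A highest weight vector whose weight involves row \<open>n + 1\<close> would have to be annihilated by the generic
  \<open>n \<times> n\<close> matrix, so at most \<open>n\<close> parts occur. For the bound on the degree, monomials are
  rewritten modulo \<open>J\<close> to lexicographically smaller ones, with the recursion of Gessel's fundamental
  quasisymmetric functions applied to words of column monomials of degree \<open>r\<close>: at least \<open>n\<close> such letters are
  available as soon as the degree exceeds \<open>r (n - 1) + n (r - 1)\<close>.
\<close>

section \<open>Alternants and Schur polynomials\<close>

text \<open>The argument rests on the commutation relations, on transpositions of rows, and on the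
  equality of the traces of \<open>E a b\<close> after \<open>E b a\<close> and of
  \<open>E b a\<close> after \<open>E a b\<close> on neighbouring weight spaces. The obstacle is
  that a Casimir value does not determine a dominant weight. Two dominant weights that are
  comparable in the dominance order and have the same value do coincide, and raising operators only
  move upward in this order, so comparisons along it are enough. All this is done for an abstract
  family of weight spaces and applied to \<rat>[X] and to J separately; the quotient enters only
  through a difference of dimensions. Rows are unbounded in the operators and weight spaces. The
  number \<open>l\<close> only cuts off the Casimir sum and the support of weights, which is why the
  multiplicities cannot depend on it. The expansion itself is an identity of antisymmetric
  polynomials, decided by the coefficients at strictly decreasing exponents; the Vandermonde product
  is cancelled afterwards.\<close>

abbreviation (input) lk :: "('a \<Rightarrow>\<^sub>0 'b::zero) \<Rightarrow> 'a \<Rightarrow> 'b" where "lk \<equiv> Poly_Mapping.lookup"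
abbreviation (input) sgl :: "'a \<Rightarrow> 'b \<Rightarrow> 'a \<Rightarrow>\<^sub>0 'b::zero" where "sgl \<equiv> Poly_Mapping.single"

type_synonym 'a qpoly = "(nat \<Rightarrow>\<^sub>0 nat) \<Rightarrow>\<^sub>0 'a"

text \<open>The numerator in the bialternant formula for Schur polynomials. Variables index rows and
  exponents index columns, so column operations act on the exponents.\<close>

definition alternant :: "nat \<Rightarrow> (nat \<Rightarrow> nat) \<Rightarrow> 'a::comm_ring_1 qpoly" where
  "alternant l k = det (mat l l (\<lambda>(i, j). pvar i ^ k j))"

lemma alternant_cong:
  assumes "\<And>j. j < l \<Longrightarrow> k j = k' j"
  shows "alternant l k = alternant l k'"
  unfolding alternant_def by (intro arg_cong[where f = det] eq_matI) (auto simp: assms)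

text \<open>In the Leibniz formula each product of column sums distributes over all choices
  \<open>t\<close>. As \<open>t\<close> is indexed by columns, the product over rows is first
  rewritten over columns by means of the inverse permutation.\<close>

lemma det_mat_sum_columns:
  fixes f :: "nat \<Rightarrow> nat \<Rightarrow> 'b \<Rightarrow> 'a::comm_ring_1"
  assumes "\<And>j. j < n \<Longrightarrow> finite (S j)"
  shows "det (mat n n (\<lambda>(i, j). \<Sum>t\<in>S j. f i j t)) =
    (\<Sum>t\<in>Pi\<^sub>E {..<n} S. det (mat n n (\<lambda>(i, j). f i j (t j))))"
proof -
  have "(\<Prod>i = 0..<n. \<Sum>t\<in>S (p i). f i (p i) t) = (\<Sum>t\<in>Pi\<^sub>E {..<n} S. \<Prod>i = 0..<n. f i (p i) (t (p i)))"
    if p: "p permutes {0..<n}" for p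
  proof -
    have inv: "Hilbert_Choice.inv p permutes {0..<n}" using p by (rule permutes_inv)
    have a: "(\<Prod>i = 0..<n. g i (p i)) = (\<Prod>j\<in>{..<n}. g (Hilbert_Choice.inv p j) j)" for g :: "nat \<Rightarrow> nat \<Rightarrow> 'a"
      using prod.permute[OF inv, of "\<lambda>i. g i (p i)"] permutes_inverses[OF p]
      by (simp add: o_def lessThan_atLeast0)
    have "(\<Prod>i = 0..<n. \<Sum>t\<in>S (p i). f i (p i) t) = (\<Prod>j\<in>{..<n}. \<Sum>t\<in>S j. f (Hilbert_Choice.inv p j) j t)"
      by (rule a)
    also have "\<dots> = (\<Sum>t\<in>Pi\<^sub>E {..<n} S. \<Prod>j\<in>{..<n}. f (Hilbert_Choice.inv p j) j (t j))"
      by (rule prod_sum_PiE) (use assms in auto)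
    also have "\<dots> = (\<Sum>t\<in>Pi\<^sub>E {..<n} S. \<Prod>i = 0..<n. f i (p i) (t (p i)))"
      by (simp add: a[of "\<lambda>i j. f i j (t j)" for t])
    finally show ?thesis .
  qed
  then have "det (mat n n (\<lambda>(i, j). \<Sum>t\<in>S j. f i j t)) =
    (\<Sum>p | p permutes {0..<n}. of_int (sign p) * (\<Sum>t\<in>Pi\<^sub>E {..<n} S. \<Prod>i = 0..<n. f i (p i) (t (p i))))"
    unfolding det_def by (auto intro!: sum.cong prod.cong dest: permutes_in_image simp: atLeast0LessThan)
  also have "\<dots> = (\<Sum>t\<in>Pi\<^sub>E {..<n} S. det (mat n n (\<lambda>(i, j). f i j (t j))))"
    unfolding det_def sum_distrib_left
    by (subst sum.swap) (auto intro!: sum.cong prod.cong dest: permutes_in_image simp: atLeast0LessThan)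
  finally show ?thesis .
qed

lemma det_mat_scale:
  fixes a b :: "nat \<Rightarrow> 'a::comm_ring_1"
  shows "det (mat n n (\<lambda>(i, j). a i * b j * f i j)) =
    (\<Prod>i<n. a i) * (\<Prod>j<n. b j) * det (mat n n (\<lambda>(i, j). f i j))"
proof -
  have "(\<Prod>i = 0..<n. a i * b (p i) * f i (p i)) = (\<Prod>i<n. a i) * (\<Prod>j<n. b j) * (\<Prod>i = 0..<n. f i (p i))"
    if p: "p permutes {0..<n}" for p
    using prod.permute[OF p, of b] by (simp add: prod.distrib o_def lessThan_atLeast0)
  then show ?thesis unfolding det_def
    by (auto simp: sum_distrib_left mult_ac intro!: sum.cong dest: permutes_in_image)
qed

text \<open>A truncated geometric sum: only the powers between two consecutive exponents survive,
  and these become the interlacing ranges of the branching rule.\<close>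

lemma power_diff_telescope:
  fixes x y :: "'a::comm_ring_1"
  assumes "m \<le> k"
  shows "x ^ k - x ^ m * y ^ (k - m) = (x - y) * (\<Sum>t = m..<k. x ^ t * y ^ (k - 1 - t))"
  using assms
proof (induction rule: dec_induct)
  case base then show ?case by simp
next
  case (step k)
  have "y ^ (k - t) = y * y ^ (k - 1 - t)" if "t < k" for t
    using that power_Suc[of y "k - 1 - t"] by (simp add: Suc_diff_Suc del: power_Suc)
  then have "(\<Sum>t = m..<k. x ^ t * y ^ (k - t)) = y * (\<Sum>t = m..<k. x ^ t * y ^ (k - 1 - t))"
    by (simp add: sum_distrib_left mult.left_commute)
  then have "(\<Sum>t = m..<Suc k. x ^ t * y ^ (Suc k - 1 - t)) = y * (\<Sum>t = m..<k. x ^ t * y ^ (k - 1 - t)) + x ^ k"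
    using step by simp
  moreover have "x ^ Suc k - x ^ m * y ^ (Suc k - m) = (x - y) * x ^ k + y * (x ^ k - x ^ m * y ^ (k - m))"
    using step by (simp add: Suc_diff_le algebra_simps)
  ultimately show ?case by (simp only: step.IH) (simp only: algebra_simps)
qed

text \<open>
  Subtracting from each column a multiple of the next one annihilates the last row up to its last
  entry, and the factor \<open>x\<^sub>i - x\<^sub>l\<close> splits off from each of the other rows.
\<close>

lemma alternant_Suc:
  assumes mono: "\<And>j. j < l \<Longrightarrow> k (Suc j) \<le> k j"
  shows "(alternant (Suc l) k :: 'a::comm_ring_1 qpoly) = (\<Prod>i<l. pvar i - pvar l) *
    (\<Sum>t\<in>Pi\<^sub>E {..<l} (\<lambda>j. {k (Suc j)..<k j}). alternant l t * pvar l ^ (k l + (\<Sum>j<l. k j - 1 - t j)))"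
proof -
  define q :: "nat \<Rightarrow> 'a qpoly" where "q = pvar"
  define A where "A = mat (Suc l) (Suc l) (\<lambda>(i, j). q i ^ k j)"
  \<comment> \<open>Right multiplication by this unit lower bidiagonal matrix subtracts from every
    column a multiple of its original right neighbour, all at once, and leaves the determinant
    unchanged.\<close>
  define L where "L = mat (Suc l) (Suc l) (\<lambda>(i, j).
    if i = j then 1 else if i = Suc j then - (q l ^ (k j - k (Suc j))) else 0)"
  define B where "B = A * L"
  have car: "A \<in> carrier_mat (Suc l) (Suc l)" "L \<in> carrier_mat (Suc l) (Suc l)" "B \<in> carrier_mat (Suc l) (Suc l)"
    by (auto simp: A_def L_def B_def)
  have "det L = prod_list (diag_mat L)"
    by (rule det_lower_triangular[OF _ car(2)]) (auto simp: L_def)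
  also have "diag_mat L = replicate (Suc l) 1"
    by (auto simp: diag_mat_def L_def list_eq_iff_nth_eq simp del: upt_Suc replicate_Suc)
  finally have detL: "det L = 1" by simp
  have Bij: "B $$ (i, j) = q i ^ k j - (if j < l then q i ^ k (Suc j) * q l ^ (k j - k (Suc j)) else 0)"
    if "i \<le> l" "j \<le> l" for i j
  proof -
    have "B $$ (i, j) = (\<Sum>s\<in>{0..<Suc l}. A $$ (i, s) * L $$ (s, j))"
      using that car by (simp add: B_def scalar_prod_def)
    also have "\<dots> = (\<Sum>s\<in>{0..<Suc l}. (if s = j then q i ^ k j else 0) -
        (if s = Suc j then q i ^ k (Suc j) * q l ^ (k j - k (Suc j)) else 0))"
      using that by (intro sum.cong) (auto simp: A_def L_def)
    finally show ?thesis using that by (simp add: sum_subtractf)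
  qed
  have last: "B $$ (l, j) = 0" if "j < l" for j
    using that mono by (simp add: Bij flip: power_add)
  have "alternant (Suc l) k = det A" by (simp add: alternant_def A_def q_def)
  also have "\<dots> = det B" using det_mult[OF car(1,2)] detL by (simp add: B_def)
  also have "\<dots> = (\<Sum>j<Suc l. B $$ (l, j) * cofactor B l j)"
    by (rule laplace_expansion_row[OF car(3)]) simp
  also have "\<dots> = B $$ (l, l) * cofactor B l l" using last by simp
  also have "\<dots> = q l ^ k l * det (mat_delete B l l)" by (simp add: Bij cofactor_def)
  also have "mat_delete B l l =
      mat l l (\<lambda>(i, j). (q i - q l) * 1 * (\<Sum>t\<in>{k (Suc j)..<k j}. q i ^ t * q l ^ (k j - 1 - t)))"
    using car(3) mono by (auto simp: mat_delete_def Bij power_diff_telescope simp del: index_mult_mat)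
  also have "det \<dots> = (\<Prod>i<l. q i - q l) * (\<Sum>t\<in>Pi\<^sub>E {..<l} (\<lambda>j. {k (Suc j)..<k j}).
      det (mat l l (\<lambda>(i, j). q i ^ t j * q l ^ (k j - 1 - t j))))"
    by (subst det_mat_scale) (simp add: det_mat_sum_columns)
  also have "(\<Sum>t\<in>Pi\<^sub>E {..<l} (\<lambda>j. {k (Suc j)..<k j}).
      det (mat l l (\<lambda>(i, j). q i ^ t j * q l ^ (k j - 1 - t j)))) =
    (\<Sum>t\<in>Pi\<^sub>E {..<l} (\<lambda>j. {k (Suc j)..<k j}). alternant l t * q l ^ (\<Sum>j<l. k j - 1 - t j))"
  proof (intro sum.cong refl)
    fix t
    show "det (mat l l (\<lambda>(i, j). q i ^ t j * q l ^ (k j - 1 - t j))) =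
      alternant l t * q l ^ (\<Sum>j<l. k j - 1 - t j)"
      using det_mat_scale[of l "\<lambda>_. 1" "\<lambda>j. q l ^ (k j - 1 - t j)" "\<lambda>i j. q i ^ t j"]
      by (simp add: alternant_def q_def power_sum mult.commute)
  qed
  finally show ?thesis by (simp add: q_def power_add sum_distrib_left mult_ac)
qed

definition staircase :: "nat \<Rightarrow> nat \<Rightarrow> nat" where "staircase l j = l - 1 - j"

definition vandermonde :: "nat \<Rightarrow> 'a::comm_ring_1 qpoly" where
  "vandermonde l = (\<Prod>j<l. \<Prod>i<j. pvar i - pvar j)"

text \<open>Adding the staircase turns the half-open ranges between consecutive exponents into the
  weak interlacing \<open>m (Suc j) \<le> t j \<le> m j\<close>. This is the branching rule of Schur
  polynomials on the level of numerators.\<close>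

lemma alternant_add_staircase:
  assumes mono: "\<And>j. j < l \<Longrightarrow> m (Suc j) \<le> m j"
  shows "(alternant (Suc l) (\<lambda>j. m j + staircase (Suc l) j) :: 'a::comm_ring_1 qpoly) = (\<Prod>i<l. pvar i - pvar l) *
    (\<Sum>t\<in>Pi\<^sub>E {..<l} (\<lambda>j. {m (Suc j)..m j}).
       alternant l (\<lambda>j. t j + staircase l j) * pvar l ^ (m l + (\<Sum>j<l. m j - t j)))"
proof -
  let ?S = "Pi\<^sub>E {..<l} (\<lambda>j. {m (Suc j)..m j})"
  let ?S' = "Pi\<^sub>E {..<l} (\<lambda>j. {m (Suc j) + staircase (Suc l) (Suc j)..<m j + staircase (Suc l) j})"
  have 1: "alternant (Suc l) (\<lambda>j. m j + staircase (Suc l) j) = (\<Prod>i<l. pvar i - pvar l) *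
    (\<Sum>t\<in>?S'. (alternant l t :: 'a qpoly) *
       pvar l ^ ((m l + staircase (Suc l) l) + (\<Sum>j<l. (m j + staircase (Suc l) j) - 1 - t j)))"
  proof (rule alternant_Suc)
    fix j assume "j < l"
    moreover have "staircase (Suc l) (Suc j) \<le> staircase (Suc l) j" by (simp add: staircase_def)
    ultimately show "m (Suc j) + staircase (Suc l) (Suc j) \<le> m j + staircase (Suc l) j"
      using mono add_mono by blast
  qed
  have "(\<Sum>t\<in>?S'. (alternant l t :: 'a qpoly) *
       pvar l ^ ((m l + staircase (Suc l) l) + (\<Sum>j<l. (m j + staircase (Suc l) j) - 1 - t j))) =
     (\<Sum>t\<in>?S. alternant l (\<lambda>j. t j + staircase l j) * pvar l ^ (m l + (\<Sum>j<l. m j - t j)))"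
  proof (rule sum.reindex_bij_witness[where j = "\<lambda>t. restrict (\<lambda>j. t j - staircase l j) {..<l}"
        and i = "\<lambda>t. restrict (\<lambda>j. t j + staircase l j) {..<l}"])
    fix t assume t: "t \<in> ?S'"
    have b: "m (Suc j) + staircase l j \<le> t j" "t j < m j + staircase (Suc l) j" if j: "j < l" for j
      using PiE_mem[OF t, of j] j by (auto simp: staircase_def)
    show "restrict (\<lambda>j. restrict (\<lambda>j. t j - staircase l j) {..<l} j + staircase l j) {..<l} = t"
    proof
      fix x
      show "restrict (\<lambda>j. restrict (\<lambda>j. t j - staircase l j) {..<l} j + staircase l j) {..<l} x = t x"
        using b[of x] PiE_arb[OF t, of x] by (cases "x < l") auto
    qed
    show "restrict (\<lambda>j. t j - staircase l j) {..<l} \<in> ?S"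
    proof (rule restrict_PiE_iff[THEN iffD2], rule ballI)
      fix j assume j: "j \<in> {..<l}"
      have "staircase (Suc l) j = Suc (staircase l j)" using j by (simp add: staircase_def)
      with b[of j] j show "t j - staircase l j \<in> {m (Suc j)..m j}"
        unfolding atLeastAtMost_iff lessThan_iff by arith
    qed
    have "alternant l (\<lambda>j. restrict (\<lambda>j. t j - staircase l j) {..<l} j + staircase l j) = (alternant l t :: 'a qpoly)"
      using add_leD2[OF b(1)] by (intro alternant_cong) simp
    moreover
    have "m j - restrict (\<lambda>j. t j - staircase l j) {..<l} j = m j + staircase (Suc l) j - 1 - t j" if "j < l" for j
      using b[of j] that by (simp add: staircase_def)
    then have "(\<Sum>j<l. m j - restrict (\<lambda>j. t j - staircase l j) {..<l} j) =
        (\<Sum>j<l. m j + staircase (Suc l) j - 1 - t j)"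
      by (intro sum.cong) auto
    moreover have "staircase (Suc l) l = 0" by (simp add: staircase_def)
    ultimately show "alternant l (\<lambda>j. restrict (\<lambda>j. t j - staircase l j) {..<l} j + staircase l j) *
        pvar l ^ (m l + (\<Sum>j<l. m j - restrict (\<lambda>j. t j - staircase l j) {..<l} j)) =
       (alternant l t :: 'a qpoly) * pvar l ^ ((m l + staircase (Suc l) l) + (\<Sum>j<l. m j + staircase (Suc l) j - 1 - t j))"
      by (simp only: add_0_right)
  next
    fix t assume t: "t \<in> ?S"
    then have b: "m (Suc j) \<le> t j" "t j \<le> m j" if "j < l" for j
      using that by (auto simp: PiE_iff)
    show "restrict (\<lambda>j. restrict (\<lambda>j. t j + staircase l j) {..<l} j - staircase l j) {..<l} = t"
    proof
      fix x
      show "restrict (\<lambda>j. restrict (\<lambda>j. t j + staircase l j) {..<l} j - staircase l j) {..<l} x = t x"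
        using PiE_arb[OF t, of x] by (cases "x < l") auto
    qed
    show "restrict (\<lambda>j. t j + staircase l j) {..<l} \<in> ?S'"
    proof (rule restrict_PiE_iff[THEN iffD2], rule ballI)
      fix j assume j: "j \<in> {..<l}"
      have "staircase (Suc l) j = Suc (staircase l j)" "staircase (Suc l) (Suc j) = staircase l j" using j by (simp_all add: staircase_def)
      with b[of j] j show "t j + staircase l j \<in> {m (Suc j) + staircase (Suc l) (Suc j)..<m j + staircase (Suc l) j}" by simp
    qed
  qed
  with 1 show ?thesis by simp
qed

text \<open>For \<open>m = 0\<close> interlacing leaves only \<open>t = 0\<close>, and the single
  surviving term is the recursion of the Vandermonde product.\<close>

lemma alternant_staircase: "alternant l (staircase l) = (vandermonde l :: 'a::comm_ring_1 qpoly)"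
proof (induction l)
  case 0 then show ?case by (simp add: alternant_def vandermonde_def)
next
  case (Suc l)
  have "(alternant (Suc l) (staircase (Suc l)) :: 'a qpoly) = (\<Prod>i<l. pvar i - pvar l) *
    (\<Sum>t\<in>Pi\<^sub>E {..<l} (\<lambda>j. {0}). alternant l (\<lambda>j. t j + staircase l j) * pvar l ^ (0 + (\<Sum>j<l. 0 - t j)))"
    using alternant_add_staircase[of l "\<lambda>_. 0"] by simp
  also have "(\<Sum>t\<in>Pi\<^sub>E {..<l} (\<lambda>j. {0}). (alternant l (\<lambda>j. t j + staircase l j) :: 'a qpoly) * pvar l ^ (0 + (\<Sum>j<l. 0 - t j))) =
    alternant l (\<lambda>j. (\<lambda>_\<in>{..<l}. 0) j + staircase l j)"
    using PiE_singleton[of "\<lambda>_\<in>{..<l}. 0 :: nat" "{..<l}"] by (simp cong: PiE_cong)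
  also have "\<dots> = alternant l (staircase l)"
    by (rule alternant_cong) auto
  finally show ?case by (simp add: Suc vandermonde_def mult.commute)
qed

section \<open>Semistandard tableaux and their branching rule\<close>

definition diagram :: "(nat \<Rightarrow> nat) \<Rightarrow> nat \<Rightarrow> (nat \<times> nat) set" where
  "diagram m l = {(a, b). a < l \<and> b < m a}"

definition ssyt :: "nat \<Rightarrow> (nat \<Rightarrow> nat) \<Rightarrow> (nat \<times> nat \<Rightarrow> nat) set" where
  "ssyt l m = {T \<in> diagram m l \<rightarrow>\<^sub>E {..<l}.
      (\<forall>a b. (a, Suc b) \<in> diagram m l \<longrightarrow> T (a, b) \<le> T (a, Suc b)) \<and>
      (\<forall>a b. (Suc a, b) \<in> diagram m l \<longrightarrow> T (a, b) < T (Suc a, b))}"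

definition schurf :: "nat \<Rightarrow> (nat \<Rightarrow> nat) \<Rightarrow> 'a::comm_ring_1 qpoly" where
  "schurf l m = (\<Sum>T\<in>ssyt l m. \<Prod>x\<in>diagram m l. pvar (T x))"

lemma diagram_Sigma: "diagram m l = Sigma {..<l} (\<lambda>a. {..<m a})"
  by (auto simp: diagram_def)

lemma finite_diagram [simp]: "finite (diagram m l)"
  by (simp add: diagram_Sigma)

lemma finite_ssyt [simp]: "finite (ssyt l m)"
  unfolding ssyt_def by (rule finite_subset[of _ "diagram m l \<rightarrow>\<^sub>E {..<l}"]) (auto intro: finite_PiE)

text \<open>Meant for the rows of a tableau: weak increase makes the cells with entry below
  \<open>l\<close> an initial segment, which is determined by its size.\<close>

lemma card_down_closed:
  fixes P :: "nat \<Rightarrow> bool"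
  assumes "\<And>b. Suc b < M \<Longrightarrow> P (Suc b) \<Longrightarrow> P b"
  shows "{b. b < M \<and> P b} = {..<card {b. b < M \<and> P b}}"
proof -
  define S where "S = {b. b < M \<and> P b}"
  have dn: "b \<in> S" if "Suc b \<in> S" for b using that assms by (auto simp: S_def)
  have dn': "b \<in> S" if "c \<in> S" "b \<le> c" for b c
    using that(2,1) by (induction c rule: dec_induct) (auto dest: dn)
  have fin: "finite S" by (auto simp: S_def)
  have "S = {..<card S}"
  proof (cases "S = {}")
    case False
    have "S = {..Max S}" using dn'[OF Max_in[OF fin False]] Max_ge[OF fin] by blast
    then show ?thesis by (metis card_atMost lessThan_Suc_atMost)
  qed simp
  then show ?thesis by (simp add: S_def)
qed

lemma ssytD:
  assumes "T \<in> ssyt l m"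
  shows "a < l \<Longrightarrow> b < m a \<Longrightarrow> T (a, b) < l"
    and "a < l \<Longrightarrow> Suc b < m a \<Longrightarrow> T (a, b) \<le> T (a, Suc b)"
    and "Suc a < l \<Longrightarrow> b < m (Suc a) \<Longrightarrow> T (a, b) < T (Suc a, b)"
    and "\<not> (a < l \<and> b < m a) \<Longrightarrow> T (a, b) = undefined"
  using assms by (auto simp: ssyt_def diagram_def PiE_iff extensional_def)

text \<open>Entries increase strictly down a column, and decreasing row lengths leave no gap above a
  cell. In particular the last of \<open>Suc l\<close> rows can contain only the entry
  \<open>l\<close>.\<close>

lemma ssyt_ge_row:
  assumes "T \<in> ssyt l m" "\<And>a. Suc a < l \<Longrightarrow> m (Suc a) \<le> m a" "a < l" "b < m a"
  shows "a \<le> T (a, b)"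
  using assms(3,4)
proof (induction a)
  case (Suc a)
  then have "a \<le> T (a, b)" using assms(2)[of a] by force
  also have "\<dots> < T (Suc a, b)" using ssytD(3)[OF assms(1)] Suc.prems by blast
  finally show ?case by simp
qed simp

text \<open>The cells with the largest entry \<open>l\<close> form a horizontal strip. Removing them
  leaves a tableau whose row lengths \<open>v\<close> interlace with \<open>m\<close>, and the
  exponent of \<open>pvar l\<close> counts the removed cells.\<close>

lemma schurf_Suc:
  assumes mono: "\<And>a. a < l \<Longrightarrow> m (Suc a) \<le> m a"
  shows "(schurf (Suc l) m :: 'a::comm_ring_1 qpoly) =
    (\<Sum>v\<in>Pi\<^sub>E {..<l} (\<lambda>j. {m (Suc j)..m j}). schurf l v * pvar l ^ (m l + (\<Sum>j<l. m j - v j)))"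
proof -
  let ?V = "Pi\<^sub>E {..<l} (\<lambda>j. {m (Suc j)..m j})"
  \<comment> \<open>\<open>phi\<close> removes the cells with entry \<open>l\<close> and records the
    remaining row lengths; \<open>psi\<close> fills the complement of the smaller shape with
    \<open>l\<close>.\<close>
  define phi where "phi T = (let v = restrict (\<lambda>a. card {b. b < m a \<and> T (a, b) < l}) {..<l}
    in (v, restrict T (diagram v l)))" for T :: "nat \<times> nat \<Rightarrow> nat"
  define psi where "psi = (\<lambda>(v, T'). restrict (\<lambda>(a, b). if a < l \<and> b < v a then T' (a, b) else l) (diagram m (Suc l)))"
    for v :: "nat \<Rightarrow> nat" and T' :: "nat \<times> nat \<Rightarrow> nat"
  have V: "m (Suc j) \<le> v j" "v j \<le> m j" if "v \<in> ?V" "j < l" for v j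
    using PiE_mem[OF that(1), of j] that(2) by auto
  have "(\<Sum>v\<in>?V. schurf l v * pvar l ^ (m l + (\<Sum>j<l. m j - v j))) =
    (\<Sum>v\<in>?V. \<Sum>T'\<in>ssyt l v. (\<Prod>x\<in>diagram v l. pvar (T' x)) * (pvar l :: 'a qpoly) ^ (m l + (\<Sum>j<l. m j - v j)))"
    by (simp add: schurf_def sum_distrib_right)
  also have "\<dots> = (\<Sum>(v, T')\<in>Sigma ?V (ssyt l). (\<Prod>x\<in>diagram v l. pvar (T' x)) * pvar l ^ (m l + (\<Sum>j<l. m j - v j)))"
    by (rule sum.Sigma) (auto intro: finite_PiE)
  also have "\<dots> = schurf (Suc l) m"
    unfolding schurf_def
  proof (rule sum.reindex_bij_witness[where j = psi and i = phi])
    fix T assume T: "T \<in> ssyt (Suc l) m"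
    define v where "v = restrict (\<lambda>a. card {b. b < m a \<and> T (a, b) < l}) {..<l}"
    have phi: "phi T = (v, restrict T (diagram v l))" by (simp add: phi_def v_def Let_def)
    have iff: "T (a, b) < l \<longleftrightarrow> b < v a" if "a < l" "b < m a" for a b
    proof -
      have "T (a, b) \<le> T (a, Suc b)" if "Suc b < m a" for b
        using ssytD(2)[OF T] that \<open>a < l\<close> by simp
      then have "{b. b < m a \<and> T (a, b) < l} = {..<card {b. b < m a \<and> T (a, b) < l}}"
        by (intro card_down_closed) (rule le_less_trans)
      then have "{b. b < m a \<and> T (a, b) < l} = {..<v a}"
        using that(1) by (simp add: v_def)
      with that show ?thesis by auto
    qed
    have vle: "v a \<le> m a" if "a < l" for a
      using card_mono[of "{..<m a}" "{b. b < m a \<and> T (a, b) < l}"] that by (auto simp: v_def)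
    have lev: "m (Suc a) \<le> v a" if "a < l" for a
    proof (cases "m (Suc a)")
      \<comment> \<open>The entry above the last cell of row \<open>Suc a\<close> is strictly
        smaller, so that cell is not removed.\<close>
      case (Suc b)
      have "T (a, b) < T (Suc a, b)" "T (Suc a, b) < Suc l"
        using ssytD(1,3)[OF T] that Suc by auto
      then have "b < v a" using iff[of a b] that Suc mono[of a] by simp
      then show ?thesis using Suc by simp
    qed simp
    have last: "T (l, b) = l" if "b < m l" for b
      using ssyt_ge_row[OF T _ _ that] ssytD(1)[OF T _ that] mono by fastforce
    have vV: "v \<in> ?V" using vle lev by (auto simp: v_def PiE_iff)
    have "restrict T (diagram v l) \<in> ssyt l v"
    proof -
      have 1: "a < l" "b < m a" "T (a, b) < l" if "(a, b) \<in> diagram v l" for a b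
        using that vle[of a] iff[of a b] by (auto simp: diagram_def)
      have 2: "(a, b) \<in> diagram v l" if "(a, Suc b) \<in> diagram v l" for a b
        using that by (auto simp: diagram_def)
      have 3: "(a, b) \<in> diagram v l" if "(Suc a, b) \<in> diagram v l" for a b
        using that vle[of "Suc a"] lev[of a] by (auto simp: diagram_def)
      show ?thesis
        unfolding ssyt_def
      proof (intro CollectI conjI allI impI)
        show "restrict T (diagram v l) \<in> diagram v l \<rightarrow>\<^sub>E {..<l}"
          unfolding restrict_PiE_iff using 1(3) by auto
      next
        fix a b assume h: "(a, Suc b) \<in> diagram v l"
        have "T (a, b) \<le> T (a, Suc b)" using ssytD(2)[OF T, of a b] 1[OF h] by simp
        then show "restrict T (diagram v l) (a, b) \<le> restrict T (diagram v l) (a, Suc b)"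
          by (simp only: restrict_apply' h 2[OF h])
      next
        fix a b assume h: "(Suc a, b) \<in> diagram v l"
        have "T (a, b) < T (Suc a, b)" using ssytD(3)[OF T, of a b] 1[OF h] by simp
        then show "restrict T (diagram v l) (a, b) < restrict T (diagram v l) (Suc a, b)"
          by (simp only: restrict_apply' h 3[OF h])
      qed
    qed
    with vV show "phi T \<in> Sigma ?V (ssyt l)" by (simp add: phi)
    have "T x = psi (phi T) x" for x
    proof (cases x)
      case (Pair a b)
      consider "\<not> (a < Suc l \<and> b < m a)" | "a < l" "b < v a" "b < m a" | "a < l" "\<not> b < v a" "b < m a" | "a = l" "b < m a"
        using less_Suc_eq by blast
      then show ?thesis
      proof cases
        case 3
        then have "T (a, b) = l" using iff[of a b] ssytD(1)[OF T, of a b] by simp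
        then show ?thesis using 3 by (simp add: Pair phi psi_def diagram_def)
      qed (use ssytD(4)[OF T] last in \<open>auto simp: Pair phi psi_def diagram_def less_Suc_eq\<close>)
    qed
    then show "psi (phi T) = T" by auto
  next
    fix w assume "w \<in> Sigma ?V (ssyt l)"
    then obtain v T' where w: "w = (v, T')" and v: "v \<in> ?V" and T': "T' \<in> ssyt l v" by auto
    have psi: "psi w (a, b) = (if a < l \<and> b < v a then T' (a, b) else l)" if "a < Suc l" "b < m a" for a b
      using that by (simp add: psi_def w diagram_def)
    show "psi w \<in> ssyt (Suc l) m"
      unfolding ssyt_def
    proof (intro CollectI conjI allI impI)
      show "psi w \<in> diagram m (Suc l) \<rightarrow>\<^sub>E {..<Suc l}"
        using ssytD(1)[OF T'] by (fastforce simp: psi_def w diagram_def)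
    next
      fix a b assume "(a, Suc b) \<in> diagram m (Suc l)"
      then show "psi w (a, b) \<le> psi w (a, Suc b)"
        using ssytD(1)[OF T', of a b] ssytD(2)[OF T', of a b] by (auto simp: psi diagram_def)
    next
      fix a b assume "(Suc a, b) \<in> diagram m (Suc l)"
      then have *: "a < l" "b < m (Suc a)" "b < m a" "b < v a"
        using mono[of a] V(1)[OF v, of a] by (auto simp: diagram_def)
      then show "psi w (a, b) < psi w (Suc a, b)"
        using ssytD(1)[OF T', of a b] ssytD(3)[OF T', of a b] by (auto simp: psi)
    qed
    have "card {b. b < m a \<and> psi w (a, b) < l} = v a" if "a < l" for a
    proof -
      have "{b. b < m a \<and> psi w (a, b) < l} = {..<v a}"
        using V(2)[OF v that] that ssytD(1)[OF T'] by (auto simp: psi split: if_splits)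
      then show ?thesis by simp
    qed
    then have 1: "restrict (\<lambda>a. card {b. b < m a \<and> psi w (a, b) < l}) {..<l} = v"
      using PiE_arb[OF v] by (auto simp: restrict_def)
    have "restrict (psi w) (diagram v l) x = T' x" for x
    proof (cases x)
      case (Pair a b)
      then show ?thesis
        using ssytD(4)[OF T', of a b] V(2)[OF v, of a] psi[of a b] by (auto simp: diagram_def)
    qed
    then have "restrict (psi w) (diagram v l) = T'" by blast
    then show "phi (psi w) = w" by (simp add: phi_def Let_def 1) (simp add: w)
    have sub: "diagram v l \<subseteq> diagram m (Suc l)"
      using V(2)[OF v] by (fastforce simp: diagram_def)
    have "card (diagram m (Suc l)) = m l + (\<Sum>j<l. m j)" "card (diagram v l) = (\<Sum>j<l. v j)"
      by (simp_all add: diagram_Sigma)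
    moreover have "(\<Sum>j<l. m j) = (\<Sum>j<l. v j) + (\<Sum>j<l. m j - v j)"
      unfolding sum.distrib[symmetric] using V(2)[OF v] by (intro sum.cong) auto
    ultimately have crd: "card (diagram m (Suc l) - diagram v l) = m l + (\<Sum>j<l. m j - v j)"
      using card_Diff_subset[OF _ sub] by simp
    have "(\<Prod>x\<in>diagram m (Suc l). (pvar (psi w x) :: 'a qpoly)) =
        (\<Prod>x\<in>diagram m (Suc l) - diagram v l. pvar (psi w x)) * (\<Prod>x\<in>diagram v l. pvar (psi w x))"
      by (rule prod.subset_diff[OF sub]) simp
    also have "(\<Prod>x\<in>diagram m (Suc l) - diagram v l. (pvar (psi w x) :: 'a qpoly)) =
        (\<Prod>x\<in>diagram m (Suc l) - diagram v l. pvar l)"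
      by (intro prod.cong refl arg_cong[where f = pvar]) (auto simp: diagram_def psi split: if_splits)
    also have "(\<Prod>x\<in>diagram v l. (pvar (psi w x) :: 'a qpoly)) = (\<Prod>x\<in>diagram v l. pvar (T' x))"
      using sub psi by (intro prod.cong refl arg_cong[where f = pvar]) (fastforce simp: diagram_def)
    finally show "(\<Prod>x\<in>diagram m (Suc l). pvar (psi w x)) =
      (case w of (v, T') \<Rightarrow> (\<Prod>x\<in>diagram v l. pvar (T' x)) * (pvar l :: 'a qpoly) ^ (m l + (\<Sum>j<l. m j - v j)))"
      by (simp add: w crd mult.commute)
  qed
  finally show ?thesis by simp
qed

text \<open>Both sides satisfy the same recursion in \<open>l\<close>: a sum over shapes interlacing
  with \<open>m\<close>, weighted by the same powers of the last variable. The extra factors on the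
  left are those by which the Vandermonde product grows.\<close>

lemma alternant_eq_vandermonde_schurf:
  assumes "\<And>a. Suc a < l \<Longrightarrow> m (Suc a) \<le> m a"
  shows "(alternant l (\<lambda>j. m j + staircase l j) :: 'a::comm_ring_1 qpoly) = vandermonde l * schurf l m"
  using assms
proof (induction l arbitrary: m)
  case 0
  have "ssyt 0 m = {\<lambda>_. undefined}" "diagram m 0 = {}" by (auto simp: ssyt_def diagram_def)
  then show ?case by (simp add: alternant_def vandermonde_def schurf_def)
next
  case (Suc l)
  have mono: "m (Suc j) \<le> m j" if "j < l" for j using Suc.prems that by simp
  let ?V = "Pi\<^sub>E {..<l} (\<lambda>j. {m (Suc j)..m j})"
  have "(alternant l (\<lambda>j. v j + staircase l j) :: 'a qpoly) = vandermonde l * schurf l v" if v: "v \<in> ?V" for v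
  proof (rule Suc.IH)
    fix a assume "Suc a < l"
    then show "v (Suc a) \<le> v a"
      using PiE_mem[OF v, of a] PiE_mem[OF v, of "Suc a"] by simp
  qed
  then show ?case
    by (simp add: alternant_add_staircase[of l m, OF mono] schurf_Suc[of l m, OF mono] vandermonde_def sum_distrib_left mult_ac cong: sum.cong)
qed

section \<open>The Laplacian on exponents and the Vandermonde product\<close>

lemma pm_expand: "p = (\<Sum>m\<in>Poly_Mapping.keys p. sgl m (lk p m))"
  by (rule poly_mapping_eqI) (simp add: lookup_sum lookup_single when_def in_keys_iff)

lemma pm_induct [case_names single add]:
  assumes "\<And>m c. P (sgl m c)" and "\<And>p q. P p \<Longrightarrow> P q \<Longrightarrow> P (p + q)"
  shows "P (p :: 'a \<Rightarrow>\<^sub>0 'b::comm_monoid_add)"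
proof -
  have "P 0" using assms(1)[of undefined 0] by simp
  have "P (\<Sum>m\<in>M. sgl m (lk p m))" if "finite M" for M
    using that by (induction M rule: finite_induct) (auto intro: assms \<open>P 0\<close>)
  then show ?thesis using pm_expand[of p] by (metis finite_keys)
qed

lemma pvar_power: "(pvar v :: ('v \<Rightarrow>\<^sub>0 nat) \<Rightarrow>\<^sub>0 'a::comm_semiring_1) ^ k = sgl (sgl v k) 1"
  by (induction k) (simp_all add: pvar_def mult_single single_add[symmetric])

lemma of_int_times_sgl: "of_int z * sgl v (c::'a::comm_ring_1) = sgl (v :: 'v \<Rightarrow>\<^sub>0 nat) (of_int z * c)"
  by (subst single_of_int[symmetric]) (simp add: mult_single del: single_of_int)

lemma of_nat_times_sgl: "of_nat z * sgl v (c::'a::comm_semiring_1) = sgl (v :: 'v \<Rightarrow>\<^sub>0 nat) (of_nat z * c)"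
  by (subst single_of_nat[symmetric]) (simp add: mult_single del: single_of_nat)

lemma prod_sgl_one: "(\<Prod>i\<in>I. sgl (f i) (1::'a::comm_semiring_1)) = sgl (\<Sum>i\<in>I. f i) 1"
  by (induction I rule: infinite_finite_induct) (simp_all add: mult_single)

lemma lookup_sgl_times_add:
  "lk (sgl m (c::'a::comm_semiring_1) * p) (m + d) = c * lk p (d :: 'v \<Rightarrow>\<^sub>0 nat)"
proof (induction p rule: pm_induct)
  case (single n a)
  show ?case by (auto simp: mult_single lookup_single when_def)
qed (simp_all add: distrib_left lookup_add)

lemma lookup_sgl_times_eq_0:
  fixes m n :: "'v \<Rightarrow>\<^sub>0 nat"
  assumes "lk n i < lk m i"
  shows "lk (sgl m (c::'a::comm_semiring_1) * p) n = 0"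
proof (induction p rule: pm_induct)
  case (single k a)
  have "m + k \<noteq> n" using assms by (auto simp: lookup_add)
  then show ?case by (simp add: mult_single lookup_single_not_eq)
qed (simp_all add: distrib_left lookup_add)

text \<open>The Euler operator: \<open>q_a\<close> times the derivative by
  \<open>q_a\<close>.\<close>

definition theta :: "nat \<Rightarrow> 'a::comm_ring_1 qpoly \<Rightarrow> 'a qpoly" where
  "theta a p = Poly_Mapping.mapp (\<lambda>d c. of_nat (lk d a) * c) p"

lemma lookup_theta: "lk (theta a p) d = of_nat (lk d a) * lk p d"
  by (simp add: theta_def lookup_mapp when_def in_keys_iff)

lemma theta_single: "theta a (sgl m c) = sgl m (of_nat (lk m a) * c)"
  by (rule poly_mapping_eqI) (simp add: lookup_theta lookup_single when_def)

lemma theta_add: "theta a (p + q) = theta a p + theta a q"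
  by (rule poly_mapping_eqI) (simp add: lookup_theta lookup_add algebra_simps)

lemma theta_diff: "theta a (p - q) = theta a p - theta a q"
  by (rule poly_mapping_eqI) (simp add: lookup_theta lookup_minus algebra_simps)

lemma theta_0 [simp]: "theta a 0 = 0"
  by (rule poly_mapping_eqI) (simp add: lookup_theta)

lemma theta_1 [simp]: "theta a 1 = 0"
  by (rule poly_mapping_eqI) (simp add: lookup_theta lookup_one when_def)

lemma theta_mult: "theta a (p * q) = theta a p * q + p * theta a q"
proof (induction p rule: pm_induct)
  case (single m c)
  show ?case
  proof (induction q rule: pm_induct)
    case (single n d)
    show ?case by (simp add: theta_single mult_single lookup_add single_add[symmetric] algebra_simps)
  qed (simp add: theta_add algebra_simps)
qed (simp add: theta_add algebra_simps)

lemma theta_pvar: "theta a (pvar i) = (if i = a then pvar i else 0)"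
  by (simp add: pvar_def theta_single lookup_single when_def)

lemma theta_prod:
  "finite D \<Longrightarrow> theta a (\<Prod>x\<in>D. f x) = (\<Sum>x\<in>D. theta a (f x) * (\<Prod>y\<in>D - {x}. f y))"
proof (induction D rule: finite_induct)
  case (insert x D)
  have "(\<Sum>z\<in>D. theta a (f z) * (\<Prod>y\<in>insert x D - {z}. f y)) =
    (\<Sum>z\<in>D. f x * (theta a (f z) * (\<Prod>y\<in>D - {z}. f y)))"
  proof (intro sum.cong refl)
    fix z assume z: "z \<in> D"
    then have "insert x D - {z} = insert x (D - {z})" using insert.hyps by auto
    then show "theta a (f z) * (\<Prod>y\<in>insert x D - {z}. f y) = f x * (theta a (f z) * (\<Prod>y\<in>D - {z}. f y))"
      using insert.hyps by (simp add: mult_ac)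
  qed
  moreover have "insert x D - {x} = D" using insert.hyps by auto
  ultimately show ?case using insert by (simp add: theta_mult sum_distrib_left add.commute)
qed simp

definition row_pairs :: "nat \<Rightarrow> (nat \<times> nat) set" where
  "row_pairs l = {(i, j). i < j \<and> j < l}"

lemma finite_row_pairs [simp]: "finite (row_pairs l)"
  by (rule finite_subset[of _ "{..<l} \<times> {..<l}"]) (auto simp: row_pairs_def)

lemma vandermonde_row_pairs: "vandermonde l = (\<Prod>(i, j)\<in>row_pairs l. pvar i - pvar j :: 'a::comm_ring_1 qpoly)"
proof -
  have "vandermonde l = (\<Prod>(j, i)\<in>Sigma {..<l} (\<lambda>j. {..<j}). pvar i - pvar j :: 'a qpoly)"
    unfolding vandermonde_def by (rule prod.Sigma) auto
  also have "\<dots> = (\<Prod>(i, j)\<in>row_pairs l. pvar i - pvar j)"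
    by (rule prod.reindex_bij_witness[where i = prod.swap and j = prod.swap]) (auto simp: row_pairs_def)
  finally show ?thesis .
qed

lemma sum_off_diagonal:
  fixes f :: "nat \<Rightarrow> nat \<Rightarrow> 'a::comm_monoid_add"
  shows "(\<Sum>a<l. \<Sum>b\<in>{..<l} - {a}. f a b) = (\<Sum>(i, j)\<in>row_pairs l. f i j + f j i)"
proof -
  have "(\<Sum>a<l. \<Sum>b\<in>{..<l} - {a}. f a b) = (\<Sum>(a, b)\<in>Sigma {..<l} (\<lambda>a. {..<l} - {a}). f a b)"
    by (rule sum.Sigma) auto
  also have "Sigma {..<l} (\<lambda>a. {..<l} - {a}) = row_pairs l \<union> prod.swap ` row_pairs l"
    by (force simp: row_pairs_def image_iff)
  also have "(\<Sum>(a, b)\<in>\<dots>. f a b) = (\<Sum>(a, b)\<in>row_pairs l. f a b) + (\<Sum>(a, b)\<in>prod.swap ` row_pairs l. f a b)"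
    by (rule sum.union_disjoint) (simp, simp, auto simp: row_pairs_def)
  also have "(\<Sum>(a, b)\<in>prod.swap ` row_pairs l. f a b) = (\<Sum>(i, j)\<in>row_pairs l. f j i)"
    by (subst sum.reindex) (auto simp: case_prod_unfold)
  finally show ?thesis by (simp add: sum.distrib case_prod_unfold)
qed

lemma theta_vandermonde:
  "theta a (vandermonde l) = (\<Sum>(i, j)\<in>row_pairs l. ((if i = a then pvar i else 0) - (if j = a then pvar j else 0)) *
     (\<Prod>(i', j')\<in>row_pairs l - {(i, j)}. pvar i' - pvar j' :: 'a::comm_ring_1 qpoly))"
  unfolding vandermonde_row_pairs
  by (subst theta_prod) (auto simp: theta_diff theta_pvar intro!: sum.cong)

definition weight_vec :: "nat \<Rightarrow> (nat \<Rightarrow> nat) \<Rightarrow> nat \<Rightarrow>\<^sub>0 nat" where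
  "weight_vec l f = (\<Sum>i<l. sgl i (f i))"

lemma lookup_weight_vec: "lk (weight_vec l f) i = (if i < l then f i else 0)"
  by (simp add: weight_vec_def lookup_sum lookup_single when_def)

lemma alternant_expand:
  "alternant l k = (\<Sum>p | p permutes {..<l}. sgl (weight_vec l (k \<circ> p)) (of_int (sign p) :: 'a::comm_ring_1))"
proof -
  have *: "(\<Prod>i = 0..<l. mat l l (\<lambda>(i, j). (pvar i :: 'a qpoly) ^ k j) $$ (i, p i)) = sgl (weight_vec l (k \<circ> p)) 1"
    if p: "p permutes {0..<l}" for p
  proof -
    have "(\<Prod>i = 0..<l. mat l l (\<lambda>(i, j). (pvar i :: 'a qpoly) ^ k j) $$ (i, p i)) = (\<Prod>i<l. pvar i ^ k (p i))"
    proof (rule prod.cong)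
      fix i assume "i \<in> {..<l}"
      then have "i < l" "p i < l" using permutes_in_image[OF p, of i] by simp_all
      then show "mat l l (\<lambda>(i, j). (pvar i :: 'a qpoly) ^ k j) $$ (i, p i) = pvar i ^ k (p i)" by simp
    qed auto
    then show ?thesis by (simp add: pvar_power prod_sgl_one weight_vec_def)
  qed
  have "alternant l k = (\<Sum>p | p permutes {0..<l}. of_int (sign p) *
      (\<Prod>i = 0..<l. mat l l (\<lambda>(i, j). (pvar i :: 'a qpoly) ^ k j) $$ (i, p i)))"
    by (simp add: alternant_def det_def)
  also have "\<dots> = (\<Sum>p | p permutes {0..<l}. sgl (weight_vec l (k \<circ> p)) (of_int (sign p) :: 'a))"
    by (intro sum.cong refl) (simp only: * mem_Collect_eq of_int_times_sgl mult_1_right)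
  finally show ?thesis by (simp only: atLeast0LessThan)
qed

lemma theta_sum: "theta a (sum f A) = (\<Sum>x\<in>A. theta a (f x))"
  by (induction A rule: infinite_finite_induct) (simp_all add: theta_add)

text \<open>The Laplacian in the coordinates \<open>log q_a\<close>. A monomial with exponent
  \<open>d\<close> is an eigenvector, with the sum of the squares of the entries of \<open>d\<close>
  as eigenvalue.\<close>

definition laplace :: "nat \<Rightarrow> 'a::comm_ring_1 qpoly \<Rightarrow> 'a qpoly" where
  "laplace l p = (\<Sum>a<l. theta a (theta a p))"

text \<open>All monomials of the alternant have a permuted staircase as exponent, hence the same sum
  of squares.\<close>

lemma laplace_vandermonde:
  "laplace l (vandermonde l) = of_nat (\<Sum>a<l. staircase l a ^ 2) * (vandermonde l :: 'a::comm_ring_1 qpoly)"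
proof -
  have *: "(\<Sum>a<l. of_nat (lk (weight_vec l (staircase l \<circ> p)) a) * (of_nat (lk (weight_vec l (staircase l \<circ> p)) a) * c)) =
      of_nat (\<Sum>a<l. staircase l a ^ 2) * (c :: 'a)" if p: "p permutes {..<l}" for p c
  proof -
    have "(\<Sum>a<l. of_nat (lk (weight_vec l (staircase l \<circ> p)) a) * (of_nat (lk (weight_vec l (staircase l \<circ> p)) a) * c)) =
      of_nat (\<Sum>a<l. (staircase l (p a)) ^ 2) * c"
      by (simp add: lookup_weight_vec sum_distrib_right power2_eq_square mult.assoc)
    also have "(\<Sum>a<l. (staircase l (p a)) ^ 2) = (\<Sum>a<l. staircase l a ^ 2)"
      using sum.permute[OF p, of "\<lambda>a. staircase l a ^ 2"] by (simp add: o_def)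
    finally show ?thesis .
  qed
  have sgl_sum: "(\<Sum>a\<in>A. sgl d (f a)) = sgl d (\<Sum>a\<in>A. f a :: 'a)" for A and f :: "nat \<Rightarrow> 'a" and d :: "nat \<Rightarrow>\<^sub>0 nat"
    by (induction A rule: infinite_finite_induct) (simp_all add: single_add)
  have "laplace l (vandermonde l) = (\<Sum>p | p permutes {..<l}. \<Sum>a<l. theta a (theta a (sgl (weight_vec l (staircase l \<circ> p)) (of_int (sign p) :: 'a))))"
    unfolding alternant_staircase[symmetric] alternant_expand laplace_def theta_sum by (rule sum.swap)
  also have "\<dots> = (\<Sum>p | p permutes {..<l}. of_nat (\<Sum>a<l. staircase l a ^ 2) * sgl (weight_vec l (staircase l \<circ> p)) (of_int (sign p) :: 'a))"
    by (intro sum.cong refl) (simp only: theta_single sgl_sum of_nat_times_sgl * mem_Collect_eq)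
  also have "\<dots> = of_nat (\<Sum>a<l. staircase l a ^ 2) * vandermonde l"
    unfolding alternant_staircase[symmetric] alternant_expand sum_distrib_left ..
  finally show ?thesis .
qed

text \<open>
  The radial part of the Casimir operator: after multiplication by the Vandermonde product it becomes
  the Laplacian in logarithmic coordinates.
\<close>

lemma laplace_vandermonde_mult:
  fixes X :: "'a::comm_ring_1 qpoly" and T :: "nat \<Rightarrow> nat \<Rightarrow> 'a qpoly"
  assumes T: "\<And>a b. a < l \<Longrightarrow> b < l \<Longrightarrow> a \<noteq> b \<Longrightarrow>
      (pvar a - pvar b) * T a b = pvar a * (theta a X - theta b X)"
    and casimir_value: "laplace l X + (\<Sum>a<l. \<Sum>b\<in>{..<l} - {a}. T a b) = c * X"
    and deg: "(\<Sum>a<l. theta a X) = N * X"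
  shows "laplace l (vandermonde l * X) = (c + of_nat (l - 1) * N + of_nat (\<Sum>a<l. staircase l a ^ 2)) * (vandermonde l * X)"
proof -
  let ?D = "row_pairs l"
  \<comment> \<open>The Vandermonde product with one factor left out takes the place of a division
    by \<open>pvar i - pvar j\<close>.\<close>
  define Q where "Q = (\<lambda>(i, j). \<Prod>(i', j')\<in>?D - {(i, j)}. pvar i' - pvar j' :: 'a qpoly)"
  have vQ: "vandermonde l = (pvar i - pvar j) * Q (i, j)" if "(i, j) \<in> ?D" for i j
    unfolding vandermonde_row_pairs Q_def
    using prod.remove[OF finite_row_pairs that, of "\<lambda>(i, j). pvar i - pvar j :: 'a qpoly"] by simp
  \<comment> \<open>The two terms of a pair combine to (q_i + q_j)/(q_i - q_j) times the difference
    of the Euler derivatives, and the Vandermonde product clears the denominator.\<close>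
  have TT: "vandermonde l * (T i j + T j i) = Q (i, j) * (pvar i + pvar j) * (theta i X - theta j X)"
    if "(i, j) \<in> ?D" for i j
  proof -
    have ij: "i < l" "j < l" "i \<noteq> j" using that by (auto simp: row_pairs_def)
    have "(pvar i - pvar j) * (T i j + T j i) = (pvar i - pvar j) * T i j - (pvar j - pvar i) * T j i"
      by (simp add: algebra_simps)
    also have "\<dots> = (pvar i + pvar j) * (theta i X - theta j X)"
      using ij by (simp add: T) (simp add: algebra_simps)
    finally show ?thesis by (simp add: vQ[OF that] mult_ac)
  qed
  have sT: "(\<Sum>a<l. \<Sum>b\<in>{..<l} - {a}. T a b) = (\<Sum>(i, j)\<in>?D. T i j + T j i)"
    by (rule sum_off_diagonal)
  have s1: "vandermonde l * laplace l X = c * (vandermonde l * X) - (\<Sum>(i, j)\<in>?D. Q (i, j) * (pvar i + pvar j) * (theta i X - theta j X))"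
  proof -
    have "laplace l X = c * X - (\<Sum>(i, j)\<in>?D. T i j + T j i)" using casimir_value sT by (simp add: algebra_simps)
    then have "vandermonde l * laplace l X = c * (vandermonde l * X) - vandermonde l * (\<Sum>(i, j)\<in>?D. T i j + T j i)"
      by (simp only: right_diff_distrib mult.left_commute)
    also have "vandermonde l * (\<Sum>(i, j)\<in>?D. T i j + T j i) = (\<Sum>(i, j)\<in>?D. Q (i, j) * (pvar i + pvar j) * (theta i X - theta j X))"
      unfolding sum_distrib_left by (intro sum.cong) (auto simp: TT)
    finally show ?thesis .
  qed
  have "(\<Sum>a<l. theta a (vandermonde l) * theta a X) =
    (\<Sum>a<l. \<Sum>(i, j)\<in>?D. Q (i, j) * ((if i = a then pvar i else 0) - (if j = a then pvar j else 0)) * theta a X)"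
    unfolding theta_vandermonde sum_distrib_right by (intro sum.cong refl) (auto simp: Q_def mult_ac)
  also have "\<dots> = (\<Sum>(i, j)\<in>?D. \<Sum>a<l. Q (i, j) * ((if i = a then pvar i else 0) - (if j = a then pvar j else 0)) * theta a X)"
    by (subst sum.swap) (simp add: case_prod_unfold)
  also have "\<dots> = (\<Sum>(i, j)\<in>?D. Q (i, j) * (pvar i * theta i X - pvar j * theta j X))"
  proof (intro sum.cong refl, clarify)
    fix i j assume "(i, j) \<in> ?D"
    then have ij: "i < l" "j < l" by (auto simp: row_pairs_def)
    have "(\<Sum>a<l. Q (i, j) * ((if i = a then pvar i else 0) - (if j = a then pvar j else 0)) * theta a X) =
      (\<Sum>a<l. if i = a then Q (i, j) * pvar i * theta i X else 0) - (\<Sum>a<l. if j = a then Q (i, j) * pvar j * theta j X else 0)"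
      unfolding sum_subtractf[symmetric] by (intro sum.cong refl) (auto simp: algebra_simps)
    then show "(\<Sum>a<l. Q (i, j) * ((if i = a then pvar i else 0) - (if j = a then pvar j else 0)) * theta a X) =
       Q (i, j) * (pvar i * theta i X - pvar j * theta j X)"
      using ij by (simp add: algebra_simps)
  qed
  finally have "2 * (\<Sum>a<l. theta a (vandermonde l) * theta a X) =
     (\<Sum>(i, j)\<in>?D. 2 * (Q (i, j) * (pvar i * theta i X - pvar j * theta j X)))"
    by (simp only: sum_distrib_left) (intro sum.cong refl, auto)
  \<comment> \<open>Uses 2(xu - yv) = (x + y)(u - v) + (x - y)(u + v). The first part cancels the
    off-diagonal terms of the Casimir operator, the second reduces to the degree.\<close>
  also have "\<dots> = (\<Sum>(i, j)\<in>?D. Q (i, j) * (pvar i + pvar j) * (theta i X - theta j X) + vandermonde l * (theta i X + theta j X))"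
    by (intro sum.cong refl) (auto simp: vQ algebra_simps)
  also have "\<dots> = (\<Sum>(i, j)\<in>?D. Q (i, j) * (pvar i + pvar j) * (theta i X - theta j X)) + vandermonde l * (\<Sum>(i, j)\<in>?D. theta i X + theta j X)"
    by (simp add: case_prod_unfold sum.distrib sum_distrib_left distrib_left)
  finally have s2: "2 * (\<Sum>a<l. theta a (vandermonde l) * theta a X) =
     (\<Sum>(i, j)\<in>?D. Q (i, j) * (pvar i + pvar j) * (theta i X - theta j X)) + vandermonde l * (\<Sum>(i, j)\<in>?D. theta i X + theta j X)" .
  have "(\<Sum>(i, j)\<in>?D. theta i X + theta j X) = (\<Sum>a<l. \<Sum>b\<in>{..<l} - {a}. theta a X)"
    using sum_off_diagonal[of "\<lambda>a b. theta a X" l] by simp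
  also have "\<dots> = of_nat (l - 1) * (N * X)"
    using deg by (cases l) (simp_all add: sum_distrib_left[symmetric])
  finally have s3: "(\<Sum>(i, j)\<in>?D. theta i X + theta j X) = of_nat (l - 1) * (N * X)" .
  have "laplace l (vandermonde l * X) = laplace l (vandermonde l) * X + 2 * (\<Sum>a<l. theta a (vandermonde l) * theta a X) + vandermonde l * laplace l X"
    unfolding laplace_def sum_distrib_left sum_distrib_right sum.distrib[symmetric]
    by (intro sum.cong refl) (simp add: theta_mult theta_add algebra_simps)
  then show ?thesis unfolding s1 s2 s3 laplace_vandermonde by (simp add: algebra_simps)
qed

section \<open>Traces and the dominance order\<close>

locale trace_space = vector_space
begin

lemma finite_if_subset_span:
  assumes "independent B" "B \<subseteq> span F" "finite F"
  shows "finite B"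
  using independent_span_bound[OF assms(3,1,2)] by simp

text \<open>Bases of the summands are disjoint because the sum is direct, and their union is a basis
  of \<open>V\<close>.\<close>

lemma dim_direct_sum:
  assumes S: "finite S" and fin: "\<And>c. c \<in> S \<Longrightarrow> \<exists>F. finite F \<and> Y c \<subseteq> span F"
    and sub: "\<And>c. c \<in> S \<Longrightarrow> subspace (Y c)"
    and V: "\<And>v. v \<in> V \<Longrightarrow> \<exists>w. (\<forall>c\<in>S. w c \<in> Y c) \<and> v = (\<Sum>c\<in>S. w c)"
    and YV: "\<And>c. c \<in> S \<Longrightarrow> Y c \<subseteq> V"
    and ind: "\<And>w c. (\<And>c. c \<in> S \<Longrightarrow> w c \<in> Y c) \<Longrightarrow> (\<Sum>c\<in>S. w c) = 0 \<Longrightarrow> c \<in> S \<Longrightarrow> w c = 0"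
  shows "dim V = (\<Sum>c\<in>S. dim (Y c))"
proof -
  have "\<exists>B. B \<subseteq> Y c \<and> independent B \<and> Y c \<subseteq> span B \<and> card B = dim (Y c)" for c
    by (rule basis_exists[of "Y c"]) blast
  then obtain B where B: "\<And>c. B c \<subseteq> Y c" "\<And>c. independent (B c)" "\<And>c. Y c \<subseteq> span (B c)" "\<And>c. card (B c) = dim (Y c)"
    by metis
  have finB: "finite (B c)" if "c \<in> S" for c
    using fin[OF that] finite_if_subset_span[OF B(2)] B(1) by (meson subset_trans)
  have disj: "B c \<inter> B c' = {}" if c: "c \<in> S" "c' \<in> S" "c \<noteq> c'" for c c'
  proof (rule ccontr)
    assume "B c \<inter> B c' \<noteq> {}"
    then obtain x where x: "x \<in> B c" "x \<in> B c'" by blast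
    \<comment> \<open>A vector common to two bases would give a nontrivial relation: itself in one
      summand, its negative in the other.\<close>
    define w where "w d = (if d = c then x else if d = c' then - x else 0)" for d
    have "x \<in> Y c" "x \<in> Y c'" using x B(1) by blast+
    then have "w d \<in> Y d" if "d \<in> S" for d
      using sub[OF that] by (auto simp: w_def intro: subspace_neg subspace_0)
    moreover have "(\<Sum>d\<in>S. w d) = 0"
    proof -
      have "(\<Sum>d\<in>S. w d) = (\<Sum>d\<in>S. if d = c then x else 0) + (\<Sum>d\<in>S. if d = c' then - x else 0)"
        unfolding sum.distrib[symmetric] using c by (intro sum.cong) (auto simp: w_def)
      then show ?thesis using c S by simp
    qed
    ultimately have "w c = 0" using ind c by blast
    then have "x = 0" by (simp add: w_def)
    then show False using x B(2)[of c] dependent_zero by blast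
  qed
  have indU: "independent (\<Union>c\<in>S. B c)"
  proof (rule independent_if_scalars_zero)
    show "finite (\<Union>c\<in>S. B c)" using S finB by blast
    fix f x assume sum0: "(\<Sum>x\<in>(\<Union>c\<in>S. B c). f x *s x) = 0" and "x \<in> (\<Union>c\<in>S. B c)"
    then obtain c where c: "c \<in> S" "x \<in> B c" by blast
    have "(\<Sum>c\<in>S. \<Sum>x\<in>B c. f x *s x) = 0"
      using sum0 sum.UNION_disjoint[OF S, of B "\<lambda>x. f x *s x"] finB disj by simp
    moreover have "(\<Sum>x\<in>B c. f x *s x) \<in> Y c" if "c \<in> S" for c
      using B(1)[of c] sub[OF that] by (intro subspace_sum subspace_scale) auto
    ultimately have "(\<Sum>x\<in>B c. f x *s x) = 0" using ind[of "\<lambda>c. \<Sum>x\<in>B c. f x *s x"] c(1) by blast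
    then show "f x = 0"
      using B(2)[of c] finB[OF c(1)] c(2) unfolding dependent_finite[OF finB[OF c(1)]] by blast
  qed
  have "dim V = card (\<Union>c\<in>S. B c)"
  proof (rule dim_unique[OF _ _ indU refl])
    show "(\<Union>c\<in>S. B c) \<subseteq> V" using B(1) YV by blast
    show "V \<subseteq> span (\<Union>c\<in>S. B c)"
    proof
      fix v assume "v \<in> V"
      then obtain w where w: "\<And>c. c \<in> S \<Longrightarrow> w c \<in> Y c" "v = (\<Sum>c\<in>S. w c)" using V by blast
      show "v \<in> span (\<Union>c\<in>S. B c)" unfolding w(2)
        using w(1) B(3) span_mono[of "B c" "\<Union>c\<in>S. B c" for c] by (intro span_sum) blast
    qed
  qed
  also have "\<dots> = (\<Sum>c\<in>S. card (B c))"
    by (rule card_UN_disjoint) (use S finB disj in auto)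
  finally show ?thesis by (simp add: B(4))
qed

definition some_basis :: "'b set \<Rightarrow> 'b set" where
  "some_basis V = (SOME B. B \<subseteq> V \<and> independent B \<and> V \<subseteq> span B)"

lemma some_basis:
  "some_basis V \<subseteq> V" "independent (some_basis V)" "V \<subseteq> span (some_basis V)" "card (some_basis V) = dim V"
proof -
  have "\<exists>B. B \<subseteq> V \<and> independent B \<and> V \<subseteq> span B"
    by (rule maximal_independent_subset[of V]) blast
  then have "some_basis V \<subseteq> V \<and> independent (some_basis V) \<and> V \<subseteq> span (some_basis V)"
    unfolding some_basis_def by (rule someI_ex)
  then show "some_basis V \<subseteq> V" "independent (some_basis V)" "V \<subseteq> span (some_basis V)" by auto
  then show "card (some_basis V) = dim V" using basis_card_eq_dim by blast
qed

definition trace_on :: "'b set \<Rightarrow> ('b \<Rightarrow> 'b) \<Rightarrow> 'a" where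
  "trace_on V f = (\<Sum>b\<in>some_basis V. representation (some_basis V) (f b) b)"

definition fin_spanned :: "'b set \<Rightarrow> bool" where
  "fin_spanned V \<longleftrightarrow> (\<exists>F. finite F \<and> V \<subseteq> span F)"

lemma finite_some_basis: "fin_spanned V \<Longrightarrow> finite (some_basis V)"
  unfolding fin_spanned_def
  using finite_if_subset_span some_basis(1,2) by (meson subset_trans)

lemma dim_mono_fin:
  assumes "V \<subseteq> W" "fin_spanned W"
  shows "dim V \<le> dim W"
proof -
  obtain B where B: "some_basis V \<subseteq> B" "B \<subseteq> W" "independent B" "W \<subseteq> span B"
    using maximal_independent_subset_extend[of "some_basis V" W] some_basis(1,2) assms(1) by (metis subset_trans)
  have "finite B" using finite_if_subset_span[OF B(3)] B(2) assms(2) unfolding fin_spanned_def by (meson subset_trans)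
  then have "card (some_basis V) \<le> card B" using B(1) by (rule card_mono)
  then show ?thesis using basis_card_eq_dim[OF B(2,4,3)] some_basis(4) by simp
qed

lemma trace_on_cong: "(\<And>v. v \<in> V \<Longrightarrow> f v = g v) \<Longrightarrow> trace_on V f = trace_on V g"
  unfolding trace_on_def using subsetD[OF some_basis(1)] by (intro sum.cong refl) simp

lemma trace_on_add:
  assumes "\<And>v. v \<in> V \<Longrightarrow> f v \<in> V" "\<And>v. v \<in> V \<Longrightarrow> g v \<in> V"
  shows "trace_on V (\<lambda>v. f v + g v) = trace_on V f + trace_on V g"
  unfolding trace_on_def sum.distrib[symmetric]
  using assms some_basis[of V] by (intro sum.cong refl) (subst representation_add, auto)

lemma trace_on_sum:
  assumes "\<And>i v. i \<in> I \<Longrightarrow> v \<in> V \<Longrightarrow> f i v \<in> V"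
  shows "trace_on V (\<lambda>v. \<Sum>i\<in>I. f i v) = (\<Sum>i\<in>I. trace_on V (f i))"
proof -
  have "trace_on V (\<lambda>v. \<Sum>i\<in>I. f i v) = (\<Sum>b\<in>some_basis V. \<Sum>i\<in>I. representation (some_basis V) (f i b) b)"
    unfolding trace_on_def
  proof (intro sum.cong refl)
    fix b assume "b \<in> some_basis V"
    then have "f i b \<in> span (some_basis V)" if "i \<in> I" for i
      using assms[OF that] some_basis(1,3)[of V] by blast
    then show "representation (some_basis V) (\<Sum>i\<in>I. f i b) b = (\<Sum>i\<in>I. representation (some_basis V) (f i b) b)"
      by (simp add: representation_sum some_basis(2))
  qed
  also have "\<dots> = (\<Sum>i\<in>I. trace_on V (f i))" unfolding trace_on_def by (rule sum.swap)
  finally show ?thesis .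
qed

lemma trace_on_scale: "trace_on V (\<lambda>v. c *s v) = c * of_nat (dim V)"
proof -
  have "trace_on V (\<lambda>v. c *s v) = (\<Sum>b\<in>some_basis V. c)"
    unfolding trace_on_def using some_basis[of V]
    by (intro sum.cong refl) (subst representation_scale, auto simp: representation_basis span_base)
  then show ?thesis by (simp add: some_basis(4) mult.commute)
qed

text \<open>Both traces are the same double sum of products of matrix entries. Letting
  \<open>V\<close> and \<open>W\<close> differ serves to compare the two weight spaces between which
  \<open>E a b\<close> and \<open>E b a\<close> go back and forth.\<close>

lemma trace_on_commute:
  assumes fin: "fin_spanned V" "fin_spanned W"
    and f: "module_hom scale scale f" "\<And>v. v \<in> V \<Longrightarrow> f v \<in> W"
    and g: "module_hom scale scale g" "\<And>v. v \<in> W \<Longrightarrow> g v \<in> V"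
  shows "trace_on V (\<lambda>v. g (f v)) = trace_on W (\<lambda>v. f (g v))"
proof -
  have half: "trace_on V (\<lambda>v. g (f v)) =
     (\<Sum>b\<in>some_basis V. \<Sum>c\<in>some_basis W. representation (some_basis W) (f b) c * representation (some_basis V) (g c) b)"
    if fin: "fin_spanned V" "fin_spanned W"
    and f: "module_hom scale scale f" "\<And>v. v \<in> V \<Longrightarrow> f v \<in> W"
    and g: "module_hom scale scale g" "\<And>v. v \<in> W \<Longrightarrow> g v \<in> V" for V W f g
    unfolding trace_on_def
  proof (intro sum.cong refl)
    fix b assume b: "b \<in> some_basis V"
    let ?r = "representation (some_basis W) (f b)"
    interpret g: module_hom scale scale g by (rule g(1))
    have fb: "f b \<in> span (some_basis W)" using f(2) b some_basis by blast
    have gc: "g c \<in> span (some_basis V)" if "c \<in> some_basis W" for c using g(2) that some_basis by blast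
    have "g (f b) = g (\<Sum>c\<in>some_basis W. ?r c *s c)"
      using sum_representation_eq[OF some_basis(2) fb finite_some_basis[OF fin(2)] order_refl] by simp
    also have "\<dots> = (\<Sum>c\<in>some_basis W. ?r c *s g c)" by (simp add: g.sum g.scale)
    finally show "representation (some_basis V) (g (f b)) b = (\<Sum>c\<in>some_basis W. ?r c * representation (some_basis V) (g c) b)"
      using gc some_basis(2)[of V] by (simp add: representation_sum representation_scale span_scale)
  qed
  have "trace_on V (\<lambda>v. g (f v)) =
     (\<Sum>b\<in>some_basis V. \<Sum>c\<in>some_basis W. representation (some_basis V) (g c) b * representation (some_basis W) (f b) c)"
    using half[of V W f g] assms by (simp add: mult.commute)
  also have "\<dots> = (\<Sum>c\<in>some_basis W. \<Sum>b\<in>some_basis V. representation (some_basis V) (g c) b * representation (some_basis W) (f b) c)"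
    by (rule sum.swap)
  also have "\<dots> = trace_on W (\<lambda>v. f (g v))"
    using half[of W V g f] assms by simp
  finally show ?thesis .
qed

end

section \<open>Weights, the dominance order and Casimir values\<close>

definition dom_le :: "(nat \<Rightarrow>\<^sub>0 nat) \<Rightarrow> (nat \<Rightarrow>\<^sub>0 nat) \<Rightarrow> bool" where
  "dom_le d k \<longleftrightarrow> (\<forall>m. (\<Sum>i<m. lk d i) \<le> (\<Sum>i<m. lk k i))"

definition dominant :: "nat \<Rightarrow> (nat \<Rightarrow>\<^sub>0 nat) \<Rightarrow> bool" where
  "dominant l d \<longleftrightarrow> (\<forall>i. Suc i < l \<longrightarrow> lk d (Suc i) \<le> lk d i)"

definition weights :: "nat \<Rightarrow> nat \<Rightarrow> (nat \<Rightarrow>\<^sub>0 nat) set" where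
  "weights l N = {d. Poly_Mapping.keys d \<subseteq> {..<l} \<and> (\<Sum>i<l. lk d i) = N}"

definition swap_wt :: "nat \<Rightarrow> nat \<Rightarrow> (nat \<Rightarrow>\<^sub>0 nat) \<Rightarrow> nat \<Rightarrow>\<^sub>0 nat" where
  "swap_wt p q d = Poly_Mapping.map_key (Transposition.transpose p q) d"

lemma lookup_swap_wt: "lk (swap_wt p q d) i = lk d (Transposition.transpose p q i)"
  unfolding swap_wt_def by (simp add: map_key.rep_eq inj_transpose)

text \<open>The eigenvalue (d, d + 2 rho) of the quadratic Casimir operator of gl on a highest
  weight vector of weight \<open>d\<close>, where the entry of 2 rho at \<open>a\<close> is l - 1 -
  2a.\<close>

definition casimir_value :: "nat \<Rightarrow> (nat \<Rightarrow>\<^sub>0 nat) \<Rightarrow> int" where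
  "casimir_value l d = (\<Sum>a<l. int (lk d a) ^ 2 + (int l - 1 - 2 * int a) * int (lk d a))"

lemma weights_zero_outside: "d \<in> weights l N \<Longrightarrow> l \<le> i \<Longrightarrow> lk d i = 0"
  by (auto simp: weights_def in_keys_iff subset_iff)

lemma finite_weights [simp]: "finite (weights l N)"
proof -
  have inj: "inj_on (\<lambda>d. restrict (lk d) {..<l}) (weights l N)"
  proof (rule inj_onI)
    fix d k assume dk: "d \<in> weights l N" "k \<in> weights l N"
      and eq: "restrict (lk d) {..<l} = restrict (lk k) {..<l}"
    show "d = k"
    proof (rule poly_mapping_eqI)
      fix i show "lk d i = lk k i"
        using fun_cong[OF eq, of i] weights_zero_outside[OF dk(1), of i] weights_zero_outside[OF dk(2), of i]
        by (cases "i < l") auto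
    qed
  qed
  have "lk d i \<le> N" if "d \<in> weights l N" "i < l" for d i
    using that member_le_sum[of i "{..<l}" "lk d"] by (auto simp: weights_def)
  then have "(\<lambda>d. restrict (lk d) {..<l}) ` weights l N \<subseteq> {..<l} \<rightarrow>\<^sub>E {..N}"
    by (auto simp: restrict_PiE_iff split: if_splits)
  then show ?thesis using inj by (meson finite_PiE finite_atMost finite_lessThan finite_subset inj_on_finite)
qed

lemma dom_le_refl: "dom_le d d" by (simp add: dom_le_def)

lemma dom_le_trans: "dom_le d k \<Longrightarrow> dom_le k m \<Longrightarrow> dom_le d m"
  unfolding dom_le_def using le_trans by blast

lemma sum_diff_of_partial_sums:
  fixes d k :: "nat \<Rightarrow> nat"
  assumes "\<And>m. (\<Sum>i<m. d i) = (\<Sum>i<m. k i)"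
  shows "d i = k i"
  using assms[of i] assms[of "Suc i"] by simp

lemma dom_le_antisym:
  assumes "dom_le d k" "dom_le k d"
  shows "d = k"
proof (rule poly_mapping_eqI)
  fix i
  have "(\<Sum>i<m. lk d i) = (\<Sum>i<m. lk k i)" for m
    using assms unfolding dom_le_def by (intro antisym) blast+
  then show "lk d i = lk k i" by (rule sum_diff_of_partial_sums)
qed

lemma dom_le_raise:
  assumes "a < b"
  shows "dom_le (d + sgl b 1) (d + sgl a 1)"
  unfolding dom_le_def
proof
  fix m
  have "(\<Sum>i<m. lk (d + sgl c 1) i) = (\<Sum>i<m. lk d i) + (if c < m then 1 else 0)" for c
    by (simp add: lookup_add sum.distrib lookup_single when_def)
  then show "(\<Sum>i<m. lk (d + sgl b 1) i) \<le> (\<Sum>i<m. lk (d + sgl a 1) i)" using assms by simp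
qed

lemma raise_neq:
  assumes "a \<noteq> b"
  shows "d + sgl b (1::nat) \<noteq> d + sgl a 1"
proof
  assume "d + sgl b 1 = d + sgl a 1"
  then have "lk (d + sgl b 1) a = lk (d + sgl a 1) a" by simp
  then show False using assms by (simp add: lookup_add lookup_single)
qed

lemma abel_summation:
  fixes x g :: "nat \<Rightarrow> int"
  shows "(\<Sum>a<Suc m. x a * g a) = (\<Sum>a<Suc m. x a) * g m + (\<Sum>j<m. (\<Sum>a<Suc j. x a) * (g j - g (Suc j)))"
proof (induction m)
  case (Suc m)
  have "(\<Sum>a<Suc (Suc m). x a * g a) = (\<Sum>a<Suc m. x a) * g m + (\<Sum>j<m. (\<Sum>a<Suc j. x a) * (g j - g (Suc j))) + x (Suc m) * g (Suc m)"
    using Suc by simp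
  also have "\<dots> = ((\<Sum>a<Suc m. x a) + x (Suc m)) * g (Suc m) +
      ((\<Sum>j<m. (\<Sum>a<Suc j. x a) * (g j - g (Suc j))) + (\<Sum>a<Suc m. x a) * (g m - g (Suc m)))"
    by (simp only: algebra_simps)
  finally show ?case by simp
qed simp

text \<open>The difference of the two values is the pairing of k - d with k + d + 2 rho. Summation
  by parts makes it a sum of nonnegative partial sums times the gaps of a strictly decreasing
  sequence, so it vanishes only if all partial sums do.\<close>

lemma casimir_value_inj_dominant:
  assumes d: "d \<in> weights l N" "dominant l d" and k: "k \<in> weights l N" "dominant l k"
    and le: "dom_le d k" and eq: "casimir_value l k = casimir_value l d"
  shows "k = d"
proof (cases l)
  case 0
  then show ?thesis using d k by (auto simp: weights_def)
next
  case (Suc m)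
  define x where "x a = int (lk k a) - int (lk d a)" for a
  define g where "g a = int (lk k a) + int (lk d a) + int l - 1 - 2 * int a" for a
  define S where "S j = (\<Sum>a<Suc j. x a)" for j
  have S0: "S j \<ge> 0" for j
    using le[unfolded dom_le_def, rule_format, of "Suc j"] unfolding S_def x_def sum_subtractf
    by (simp flip: of_nat_sum)
  have Sm: "S m = 0"
    using d(1) k(1) Suc unfolding S_def x_def sum_subtractf weights_def by (simp flip: of_nat_sum)
  have "casimir_value l k - casimir_value l d = (\<Sum>a<Suc m. x a * g a)"
    unfolding casimir_value_def Suc[symmetric] sum_subtractf[symmetric] x_def g_def
    by (intro sum.cong refl) (simp add: power2_eq_square algebra_simps)
  also have "\<dots> = (\<Sum>j<m. S j * (g j - g (Suc j)))"
    using Sm unfolding abel_summation S_def by simp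
  finally have z: "(\<Sum>j<m. S j * (g j - g (Suc j))) = 0" using eq by simp
  \<comment> \<open>The summand \<open>- 2 * int a\<close> makes every gap at least 2, even between
    equal parts.\<close>
  have gg: "g j - g (Suc j) > 0" if "j < m" for j
    using d(2) k(2) that Suc unfolding dominant_def g_def by force
  then have "\<forall>j\<in>{..<m}. S j * (g j - g (Suc j)) = 0"
    using z S0 less_imp_le[OF gg] by (subst (asm) sum_nonneg_eq_0_iff) (auto intro!: mult_nonneg_nonneg)
  then have "S j = 0" if "j < m" for j using gg that by fastforce
  then have Sz: "S j = 0" if "j \<le> m" for j using Sm that by (cases "j = m") auto
  have "x j = 0" if "j \<le> m" for j
    using Sz[of j] Sz[of "j - 1"] that by (cases j) (auto simp: S_def)
  then show ?thesis using weights_zero_outside[OF d(1)] weights_zero_outside[OF k(1)] Suc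
    by (intro poly_mapping_eqI) (metis (no_types, opaque_lifting) x_def less_Suc_eq_le not_less eq_iff_diff_eq_0 of_nat_eq_iff)
qed

section \<open>Casimir eigenspaces\<close>

lemma wt_split: "lk d b \<noteq> 0 \<Longrightarrow> \<exists>d0. d = d0 + sgl b (1::nat)"
proof
  assume "lk d b \<noteq> 0"
  then show "d = (d - sgl b 1) + sgl b (1::nat)"
    by (intro poly_mapping_eqI) (auto simp: lookup_add lookup_minus lookup_single when_def)
qed

text \<open>The index \<open>a\<close> is the smaller member of l - 1 - a pairs and the larger
  member of \<open>a\<close> pairs; the difference is the entry of 2 rho.\<close>

lemma sum_row_pairs_diff:
  "(\<Sum>a<l. \<Sum>b<l. if a < b then int (f a) - int (f b) else 0) = (\<Sum>a<l. (int l - 1 - 2 * int a) * int (f a))"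
proof (induction l)
  case (Suc l)
  have "(\<Sum>a<Suc l. \<Sum>b<Suc l. if a < b then int (f a) - int (f b) else 0) =
    (\<Sum>a<l. (\<Sum>b<l. if a < b then int (f a) - int (f b) else 0) + (int (f a) - int (f l)))"
    by simp
  also have "\<dots> = (\<Sum>a<l. (int l - 1 - 2 * int a) * int (f a)) + ((\<Sum>a<l. int (f a)) - int l * int (f l))"
    by (simp add: sum.distrib Suc sum_subtractf)
  also have "\<dots> = (\<Sum>a<Suc l. (int (Suc l) - 1 - 2 * int a) * int (f a))"
    by (simp add: sum.distrib[symmetric] algebra_simps)
  finally show ?case .
qed simp

text \<open>Candidates for the Casimir eigenvalues on the weight space of \<open>d\<close>: the
  values at dominant weights above \<open>d\<close>. The set is defined on weights alone and shrinks
  when the weight is raised.\<close>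

definition spec :: "nat \<Rightarrow> nat \<Rightarrow> (nat \<Rightarrow>\<^sub>0 nat) \<Rightarrow> int set" where
  "spec l N d = casimir_value l ` {k \<in> weights l N. dominant l k \<and> dom_le d k}"

lemma finite_spec [simp]: "finite (spec l N d)"
  by (simp add: spec_def)

lemma spec_mono: "dom_le d k \<Longrightarrow> spec l N k \<subseteq> spec l N d"
  unfolding spec_def using dom_le_trans by blast

text \<open>A numerical rank for the dominance order. It grows strictly and is bounded by
  \<open>l * N\<close>, which allows inductions that move upward.\<close>

definition height :: "nat \<Rightarrow> (nat \<Rightarrow>\<^sub>0 nat) \<Rightarrow> nat" where
  "height l d = (\<Sum>m<l. \<Sum>i<m. lk d i)"

lemma height_mono: "dom_le d k \<Longrightarrow> height l d \<le> height l k"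
  unfolding height_def dom_le_def by (rule sum_mono) auto

lemma height_bound: "d \<in> weights l N \<Longrightarrow> height l d \<le> l * N"
proof -
  assume d: "d \<in> weights l N"
  have "(\<Sum>i<m. lk d i) \<le> N" if "m < l" for m
    using d that sum_mono2[of "{..<l}" "{..<m}" "lk d"] by (auto simp: weights_def)
  then show ?thesis unfolding height_def using sum_bounded_above[of "{..<l}" "\<lambda>m. \<Sum>i<m. lk d i" N] by simp
qed

lemma height_strict:
  assumes "dom_le d k" "d \<noteq> k" "d \<in> weights l N" "k \<in> weights l N"
  shows "height l d < height l k"
proof (rule ccontr)
  assume "\<not> ?thesis"
  then have eq: "(\<Sum>m<l. \<Sum>i<m. lk d i) = (\<Sum>m<l. \<Sum>i<m. lk k i)"
    using height_mono[OF assms(1), of l] by (simp add: height_def)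
  have "(\<Sum>i<m. lk d i) = (\<Sum>i<m. lk k i)" for m
  proof (cases "m < l")
    case True
    then show ?thesis using sum_mono_inv[OF eq] assms(1) by (simp add: dom_le_def)
  next
    case False
    then have "(\<Sum>i<m. lk e i) = (\<Sum>i<l. lk e i)" if "e \<in> weights l N" for e
      using weights_zero_outside[OF that] by (intro sum.mono_neutral_right) auto
    then show ?thesis using assms(3,4) by (simp add: weights_def)
  qed
  then have "lk d i = lk k i" for i by (rule sum_diff_of_partial_sums)
  then have "d = k" by (rule poly_mapping_eqI)
  with assms(2) show False by simp
qed

lemma weights_raise:
  assumes "a < l" "b < l"
  shows "d + sgl b 1 \<in> weights l N \<Longrightarrow> d + sgl a 1 \<in> weights l N"
proof -
  have "(\<Sum>i<l. lk (d + sgl c 1) i) = (\<Sum>i<l. lk d i) + 1" if "c < l" for c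
    using that by (simp add: lookup_add sum.distrib lookup_single when_def)
  moreover have "Poly_Mapping.keys (d + sgl c (1::nat)) = Poly_Mapping.keys d \<union> {c}" for c
    by (auto simp: in_keys_iff lookup_add lookup_single when_def split: if_splits)
  ultimately show "d + sgl b 1 \<in> weights l N \<Longrightarrow> d + sgl a 1 \<in> weights l N"
    using assms by (auto simp: weights_def)
qed

text \<open>Exchanging an ascent at \<open>i\<close> changes only the partial sum of length
  \<open>Suc i\<close>, and increases it.\<close>

lemma swap_wt_dom:
  assumes d: "d \<in> weights l N" and i: "Suc i < l" "lk d i < lk d (Suc i)"
  shows "dom_le d (swap_wt i (Suc i) d)" "swap_wt i (Suc i) d \<in> weights l N" "swap_wt i (Suc i) d \<noteq> d"
proof -
  let ?s = "Transposition.transpose i (Suc i)"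
  have sums: "(\<Sum>j<m. lk (swap_wt i (Suc i) d) j) = (\<Sum>j<m. lk d j) + (if m = Suc i then lk d (Suc i) - lk d i else 0)" for m
  proof -
    consider "m \<le> i" | "m = Suc i" | "Suc (Suc i) \<le> m" by linarith
    then show ?thesis
    proof cases
      case 1
      then have "(\<Sum>j<m. lk (swap_wt i (Suc i) d) j) = (\<Sum>j<m. lk d j)"
        by (intro sum.cong refl) (simp add: lookup_swap_wt transpose_def)
      then show ?thesis using 1 by simp
    next
      case 2
      have "(\<Sum>j<i. lk (swap_wt i (Suc i) d) j) = (\<Sum>j<i. lk d j)"
        by (intro sum.cong refl) (simp add: lookup_swap_wt transpose_def)
      then show ?thesis using 2 i(2) by (simp add: lookup_swap_wt)
    next
      case 3
      then have "?s permutes {..<m}" by (intro permutes_swap_id) auto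
      then show ?thesis using sum.permute[of ?s "{..<m}" "lk d"] 3 by (simp add: lookup_swap_wt o_def)
    qed
  qed
  show "dom_le d (swap_wt i (Suc i) d)" by (simp add: dom_le_def sums)
  have "lk (swap_wt i (Suc i) d) j = 0" if "\<not> j < l" for j
    using that i weights_zero_outside[OF d] by (simp add: lookup_swap_wt transpose_def)
  then show "swap_wt i (Suc i) d \<in> weights l N"
    using d i(1) sums[of l] by (auto simp: weights_def in_keys_iff)
  have "lk (swap_wt i (Suc i) d) i \<noteq> lk d i" using i by (simp add: lookup_swap_wt)
  then show "swap_wt i (Suc i) d \<noteq> d" by auto
qed

text \<open>A dominant weight above the raised one with the Casimir value of the original would be
  equal to the original, which lies strictly below. So raising loses at least this value.\<close>

lemma raised_spec:
  assumes ab: "a < b" "b < l" and d: "d0 + sgl b 1 \<in> weights l N" "dominant l (d0 + sgl b 1)"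
  shows "spec l N (d0 + sgl a 1) \<subseteq> spec l N (d0 + sgl b 1) - {casimir_value l (d0 + sgl b 1)}"
proof -
  let ?d = "d0 + sgl b 1"
  have "casimir_value l ?d \<noteq> casimir_value l k" if k: "k \<in> weights l N" "dominant l k" "dom_le (d0 + sgl a 1) k" for k
  proof
    assume "casimir_value l ?d = casimir_value l k"
    moreover have "dom_le ?d k" using dom_le_raise[OF ab(1)] k(3) dom_le_trans by blast
    ultimately have "k = ?d" using casimir_value_inj_dominant[OF d k(1,2)] by simp
    then have "?d = d0 + sgl a 1" using dom_le_antisym k(3) dom_le_raise[OF ab(1)] by blast
    then show False using raise_neq ab(1) by (metis less_irrefl)
  qed
  then have "casimir_value l ?d \<notin> spec l N (d0 + sgl a 1)"
    unfolding spec_def image_iff Bex_def mem_Collect_eq by metis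
  then show ?thesis using spec_mono[OF dom_le_raise[OF ab(1)]] by blast
qed

text \<open>Weight spaces of a polynomial gl representation, with row indices unbounded; \<rat>[X]
  and the ideal are both instances. Weights are written as \<open>d + sgl b 1\<close> to avoid
  truncated subtraction, and \<open>tau\<close> supplies the action of the Weyl group.\<close>

locale gl_family = trace_space scale
  for scale :: "rat \<Rightarrow> 'v::ab_group_add \<Rightarrow> 'v" (infixr \<open>*s\<close> 75) +
  fixes E :: "nat \<Rightarrow> nat \<Rightarrow> 'v \<Rightarrow> 'v" and tau :: "nat \<Rightarrow> nat \<Rightarrow> 'v \<Rightarrow> 'v"
    and U :: "(nat \<Rightarrow>\<^sub>0 nat) \<Rightarrow> 'v set"
  assumes subspace_U: "subspace (U d)"
    and fin_U: "fin_spanned (U d)"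
    and E_hom: "module_hom scale scale (E a b)"
    and E_weight: "v \<in> U (d + sgl b 1) \<Longrightarrow> E a b v \<in> U (d + sgl a 1)"
    and E_zero: "v \<in> U d \<Longrightarrow> lk d b = 0 \<Longrightarrow> E a b v = 0"
    and E_diag: "v \<in> U d \<Longrightarrow> E a a v = of_nat (lk d a) *s v"
    and E_comm: "E a b (E c e v) = E c e (E a b v) + (if b = c then E a e v else 0) - (if a = e then E c b v else 0)"
    and tau_hom: "module_hom scale scale (tau p q)"
    and tau_weight: "v \<in> U d \<Longrightarrow> tau p q v \<in> U (swap_wt p q d)"
    and tau_tau: "tau p q (tau p q v) = v"
    and tau_E: "tau p q (E a b v) = E (Transposition.transpose p q a) (Transposition.transpose p q b) (tau p q v)"
begin

lemma E_add: "E a b (v + w) = E a b v + E a b w" using E_hom by (rule module_hom.add)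
lemma E_scale: "E a b (c *s v) = c *s E a b v" using E_hom by (rule module_hom.scale)
lemma E_diff: "E a b (v - w) = E a b v - E a b w" using E_hom by (rule module_hom.diff)
lemma E_0 [simp]: "E a b 0 = 0" using E_hom by (rule module_hom.zero)
lemma E_sum: "E a b (sum f I) = (\<Sum>i\<in>I. E a b (f i))" using E_hom by (rule module_hom.sum)
definition casimir :: "nat \<Rightarrow> 'v \<Rightarrow> 'v" where
  "casimir l v = (\<Sum>a<l. \<Sum>b<l. E a b (E b a v))"

lemma casimir_hom: "module_hom scale scale (casimir l)"
proof
  show "casimir l (v + w) = casimir l v + casimir l w" for v w by (simp add: casimir_def E_add sum.distrib)
  show "casimir l (c *s v) = c *s casimir l v" for c v by (simp add: casimir_def E_scale scale_sum_right)
qed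

lemma casimir_add: "casimir l (v + w) = casimir l v + casimir l w" using casimir_hom by (rule module_hom.add)
lemma casimir_scale: "casimir l (c *s v) = c *s casimir l v" using casimir_hom by (rule module_hom.scale)
lemma casimir_diff: "casimir l (v - w) = casimir l v - casimir l w" using casimir_hom by (rule module_hom.diff)
lemma casimir_0 [simp]: "casimir l 0 = 0" using casimir_hom by (rule module_hom.zero)

lemma E_E_E: "E a b (E b a (E c e v)) = E c e (E a b (E b a v)) + (if b = c then E a e (E b a v) else 0)
    - (if a = e then E c b (E b a v) else 0) + (if a = c then E a b (E b e v) else 0) - (if b = e then E a b (E c a v) else 0)"
proof -
  have "E b a (E c e v) = E c e (E b a v) + (if a = c then E b e v else 0) - (if b = e then E c a v else 0)"
    by (rule E_comm)
  moreover have "E a b (E c e (E b a v)) = E c e (E a b (E b a v)) + (if b = c then E a e (E b a v) else 0) - (if a = e then E c b (E b a v) else 0)"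
    by (rule E_comm)
  ultimately show ?thesis by (simp add: E_add E_diff)
qed

text \<open>The commutators produce four sums, which cancel in pairs: the first with the fourth, the
  second with the third.\<close>

lemma casimir_E:
  assumes "c < l" "e < l"
  shows "casimir l (E c e v) = E c e (casimir l v)"
proof -
  have 1: "(\<Sum>a<l. \<Sum>b<l. if b = c then E a e (E b a v) else 0) = (\<Sum>a<l. E a e (E c a v))"
    using assms by (intro sum.cong refl) simp
  have 2: "(\<Sum>a<l. \<Sum>b<l. if a = e then E c b (E b a v) else 0) = (\<Sum>b<l. E c b (E b e v))"
    by (subst sum.swap) (use assms in simp)
  have 3: "(\<Sum>a<l. \<Sum>b<l. if a = c then E a b (E b e v) else 0) = (\<Sum>b<l. E c b (E b e v))"
    by (subst sum.swap) (use assms in simp)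
  have 4: "(\<Sum>a<l. \<Sum>b<l. if b = e then E a b (E c a v) else 0) = (\<Sum>a<l. E a e (E c a v))"
    using assms by (intro sum.cong refl) simp
  show ?thesis
    unfolding casimir_def E_E_E sum.distrib sum_subtractf 1 2 3 4 by (simp add: E_sum)
qed

lemma tau_casimir:
  assumes "p < l" "q < l"
  shows "tau p q (casimir l v) = casimir l (tau p q v)"
proof -
  let ?s = "Transposition.transpose p q"
  have s: "?s permutes {..<l}" using assms by (intro permutes_swap_id) auto
  interpret tau: module_hom scale scale "tau p q" by (rule tau_hom)
  have "tau p q (casimir l v) = (\<Sum>a<l. \<Sum>b<l. E (?s a) (?s b) (E (?s b) (?s a) (tau p q v)))"
    by (simp add: casimir_def tau.sum tau_E)
  also have "\<dots> = (\<Sum>a<l. \<Sum>b<l. E (?s a) b (E b (?s a) (tau p q v)))"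
    using sum.permute[OF s, of "\<lambda>b. E (?s a) b (E b (?s a) (tau p q v))" for a] by (simp add: o_def)
  also have "\<dots> = casimir l (tau p q v)"
    using sum.permute[OF s, of "\<lambda>a. \<Sum>b<l. E a b (E b a (tau p q v))"] by (simp add: o_def casimir_def)
  finally show ?thesis .
qed

lemma E_back: "v \<in> U d \<Longrightarrow> E a b (E b a v) \<in> U d"
proof (cases "lk d a = 0")
  case False
  then obtain d0 where d0: "d = d0 + sgl a 1" using wt_split[OF False] by blast
  show "v \<in> U d \<Longrightarrow> E a b (E b a v) \<in> U d" unfolding d0 by (intro E_weight)
qed (simp add: E_zero subspace_0 subspace_U)

lemma casimir_U: "v \<in> U d \<Longrightarrow> casimir l v \<in> U d"
  unfolding casimir_def by (intro subspace_sum subspace_U E_back)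

text \<open>For \<open>a < b\<close> the commutator turns \<open>E a b (E b a v)\<close> into (d_a -
  d_b) v; for \<open>b < a\<close> the inner operator already kills \<open>v\<close>.\<close>

lemma casimir_highest:
  assumes v: "v \<in> U d" and hw: "\<And>a b. a < b \<Longrightarrow> b < l \<Longrightarrow> E a b v = 0"
  shows "casimir l v = of_int (casimir_value l d) *s v"
proof -
  have "E a b (E b a v) = of_int ((if a = b then int (lk d a)^2 else 0) + (if a < b then int (lk d a) - int (lk d b) else 0)) *s v"
    if "a < l" "b < l" for a b
  proof -
    consider "a = b" | "a < b" | "b < a" by linarith
    then show ?thesis
    proof cases
      case 1
      then show ?thesis by (simp add: E_diag[OF v] E_scale power2_eq_square)
    next
      case 2
      then show ?thesis using hw[OF 2 that(2)] E_comm[of a b b a v]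
        by (simp add: E_diag[OF v] scale_left_diff_distrib)
    next
      case 3
      then show ?thesis using hw[OF 3 that(1)] by simp
    qed
  qed
  then have "casimir l v = (\<Sum>a<l. \<Sum>b<l. of_int ((if a = b then int (lk d a)^2 else 0) + (if a < b then int (lk d a) - int (lk d b) else 0)) *s v)"
    by (simp add: casimir_def)
  also have "\<dots> = of_int (\<Sum>a<l. \<Sum>b<l. (if a = b then int (lk d a)^2 else 0) + (if a < b then int (lk d a) - int (lk d b) else 0)) *s v"
    by (simp only: scale_sum_left of_int_sum)
  also have "(\<Sum>a<l. \<Sum>b<l. (if a = b then int (lk d a)^2 else 0) + (if a < b then int (lk d a) - int (lk d b) else 0)) = casimir_value l d"
    unfolding sum.distrib sum_row_pairs_diff casimir_value_def by (intro arg_cong2[of _ _ _ _ plus] refl sum.cong) auto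
  finally show ?thesis .
qed

definition shiftop :: "nat \<Rightarrow> int \<Rightarrow> 'v \<Rightarrow> 'v" where
  "shiftop l c v = casimir l v - of_int c *s v"

lemma shiftop_comm: "comp_fun_commute (shiftop l)"
  by standard (simp add: fun_eq_iff shiftop_def casimir_diff casimir_scale algebra_simps scale_left_commute)

text \<open>The product of the operators \<open>shiftop l c\<close> over \<open>c\<close> in
  \<open>S\<close>. They commute, so the fold over a set is well defined and splits over disjoint
  unions.\<close>

definition annih :: "nat \<Rightarrow> int set \<Rightarrow> 'v \<Rightarrow> 'v" where
  "annih l S v = Finite_Set.fold (shiftop l) v S"

lemma annih_empty [simp]: "annih l {} v = v"
  by (simp add: annih_def)

lemma annih_insert: "finite S \<Longrightarrow> c \<notin> S \<Longrightarrow> annih l (insert c S) v = shiftop l c (annih l S v)"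
proof -
  interpret comp_fun_commute "shiftop l" by (rule shiftop_comm)
  show "finite S \<Longrightarrow> c \<notin> S \<Longrightarrow> annih l (insert c S) v = shiftop l c (annih l S v)"
    unfolding annih_def by simp
qed

lemma shiftop_0 [simp]: "shiftop l c 0 = 0" by (simp add: shiftop_def)
lemma shiftop_add: "shiftop l c (v + w) = shiftop l c v + shiftop l c w"
  by (simp add: shiftop_def casimir_add algebra_simps)
lemma shiftop_scale: "shiftop l c (k *s w) = k *s shiftop l c w"
  by (simp add: shiftop_def casimir_scale algebra_simps scale_left_commute)

lemma annih_add: "finite S \<Longrightarrow> annih l S (v + w) = annih l S v + annih l S w"
  by (induction S rule: finite_induct) (simp_all add: annih_insert shiftop_add)

lemma annih_scale: "finite S \<Longrightarrow> annih l S (k *s w) = k *s annih l S w"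
  by (induction S rule: finite_induct) (simp_all add: annih_insert shiftop_scale)

lemma annih_0 [simp]: "finite S \<Longrightarrow> annih l S 0 = 0"
  by (induction S rule: finite_induct) (simp_all add: annih_insert)

lemma annih_mono:
  assumes "finite S'" "S \<subseteq> S'" "annih l S v = 0"
  shows "annih l S' v = 0"
proof -
  interpret comp_fun_commute "shiftop l" by (rule shiftop_comm)
  have "finite S" using assms finite_subset by blast
  then have "annih l (S \<union> (S' - S)) v = annih l (S' - S) (annih l S v)"
    unfolding annih_def using assms(1) by (intro fold_set_union_disj) auto
  moreover have "S \<union> (S' - S) = S'" using assms(2) by blast
  ultimately show ?thesis using assms by simp
qed

lemma annih_U: "finite S \<Longrightarrow> v \<in> U d \<Longrightarrow> annih l S v \<in> U d"
  by (induction S rule: finite_induct)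
     (auto simp: annih_insert shiftop_def intro!: subspace_diff subspace_U casimir_U subspace_scale)

lemma annih_E: "finite S \<Longrightarrow> a < l \<Longrightarrow> b < l \<Longrightarrow> annih l S (E a b v) = E a b (annih l S v)"
  by (induction S rule: finite_induct) (simp_all add: annih_insert shiftop_def casimir_E E_diff E_scale)

lemma annih_tau: "finite S \<Longrightarrow> p < l \<Longrightarrow> q < l \<Longrightarrow> annih l S (tau p q v) = tau p q (annih l S v)"
proof (induction S rule: finite_induct)
  case (insert c S)
  interpret tau: module_hom scale scale "tau p q" by (rule tau_hom)
  show ?case using insert by (simp add: annih_insert shiftop_def tau_casimir tau.diff tau.scale)
qed simp

lemma annih_eigen:
  assumes "finite S" "casimir l v = of_int c *s v"
  shows "annih l S v = of_int (\<Prod>k\<in>S. c - k) *s v"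
  using assms(1)
proof (induction S rule: finite_induct)
  case (insert k S)
  then show ?case
    by (simp add: annih_insert shiftop_scale) (simp add: shiftop_def assms(2) scale_left_diff_distrib[symmetric] mult.commute)
qed simp

definition eig :: "nat \<Rightarrow> int \<Rightarrow> (nat \<Rightarrow>\<^sub>0 nat) \<Rightarrow> 'v set" where
  "eig l c d = {v \<in> U d. casimir l v = of_int c *s v}"

lemma eig_U: "eig l c d \<subseteq> U d" by (auto simp: eig_def)

lemma subspace_eig: "subspace (eig l c d)"
  using subspace_U[of d]
  by (auto simp: eig_def subspace_def casimir_add casimir_scale algebra_simps scale_left_commute)

lemma fin_eig: "fin_spanned (eig l c d)"
  using fin_U[of d] eig_U unfolding fin_spanned_def by (meson subset_trans)

text \<open>Lagrange interpolation: the product without the factor of \<open>c\<close> maps into the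
  eigenspace of \<open>c\<close>. Subtracting a rescaled image leaves a vector annihilated by the
  remaining factors.\<close>

lemma eig_decomp:
  assumes "finite S" "v \<in> U d" "annih l S v = 0"
  shows "\<exists>w. (\<forall>c\<in>S. w c \<in> eig l c d) \<and> v = (\<Sum>c\<in>S. w c)"
  using assms
proof (induction S arbitrary: v rule: finite_induct)
  case (insert c S)
  define u where "u = annih l S v"
  have u: "u \<in> eig l c d"
    using insert annih_U[OF insert(1) insert(4)] by (simp add: u_def eig_def annih_insert shiftop_def)
  \<comment> \<open>The number by which the product over \<open>S\<close> scales an eigenvector for
    \<open>c\<close>; it is nonzero since \<open>c\<close> is not in \<open>S\<close>.\<close>
  define k :: rat where "k = of_int (\<Prod>k\<in>S. c - k)"
  have k: "k \<noteq> 0" using insert(1,2) by (auto simp: k_def)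
  define y where "y = inverse k *s u"
  have y: "y \<in> eig l c d" unfolding y_def by (intro subspace_scale subspace_eig u)
  have "annih l S u = k *s u"
    using annih_eigen[OF insert(1), of l u c] u by (simp add: eig_def k_def)
  then have "annih l S y = u" using insert(1) k by (simp add: y_def annih_scale)
  then have "annih l S (v + (- 1) *s y) = 0"
    using insert(1) by (simp only: annih_add annih_scale) (simp add: u_def)
  moreover have "v + (- 1) *s y \<in> U d"
    using insert(4) y eig_U by (intro subspace_add subspace_scale subspace_U) auto
  ultimately obtain w where w: "\<forall>c\<in>S. w c \<in> eig l c d" "v + (- 1) *s y = (\<Sum>c\<in>S. w c)"
    using insert(3) by blast
  have "v = (\<Sum>c'\<in>insert c S. (w(c := y)) c')"
  proof -
    have "(\<Sum>c'\<in>S. (w(c := y)) c') = (\<Sum>c\<in>S. w c)" using insert(2) by (intro sum.cong) auto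
    then show ?thesis using insert(1,2) w(2) by (simp add: algebra_simps)
  qed
  moreover have "\<forall>c'\<in>insert c S. (w(c := y)) c' \<in> eig l c' d" using w(1) y by auto
  ultimately show ?case by blast
qed simp

text \<open>The product over \<open>S - {c}\<close> kills every summand but \<open>w c\<close>,
  which it scales by a nonzero number.\<close>

lemma eig_independent:
  assumes S: "finite S" and w: "\<And>c. c \<in> S \<Longrightarrow> w c \<in> eig l c d" and z: "(\<Sum>c\<in>S. w c) = 0" and c: "c \<in> S"
  shows "w c = 0"
proof -
  have fin: "finite (S - {c})" using S by simp
  have e: "annih l (S - {c}) (w c') = of_int (\<Prod>k\<in>S - {c}. c' - k) *s w c'" if "c' \<in> S" for c'
    using annih_eigen[OF fin] w[OF that] by (simp add: eig_def)
  have "annih l (S - {c}) (sum w T) = (\<Sum>c'\<in>T. annih l (S - {c}) (w c'))" for T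
    by (induction T rule: infinite_finite_induct) (simp_all add: annih_add S)
  then have "0 = (\<Sum>c'\<in>S. annih l (S - {c}) (w c'))" using z fin by (metis annih_0)
  also have "\<dots> = (\<Sum>c'\<in>S. if c' = c then of_int (\<Prod>k\<in>S - {c}. c - k) *s w c else 0)"
    using e S by (intro sum.cong refl) (auto intro!: prod_zero)
  finally have "of_int (\<Prod>k\<in>S - {c}. c - k) *s w c = 0" using S c by simp
  moreover have "(of_int (\<Prod>k\<in>S - {c}. c - k) :: rat) \<noteq> 0" using fin by (auto simp del: of_int_prod)
  ultimately show ?thesis by simp
qed

text \<open>Descending induction along dominance. A nondominant weight space is carried to a higher
  one by a row transposition. For a dominant weight, the product over the other candidates already
  yields a vector killed by all raising operators, because these lead to spaces whose candidates
  omit the value of \<open>d\<close>; the remaining factor kills it by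
  \<open>casimir_highest\<close>.\<close>

lemma annih_spec:
  "d \<in> weights l N \<Longrightarrow> v \<in> U d \<Longrightarrow> annih l (spec l N d) v = 0"
proof (induction "l * N - height l d" arbitrary: d v rule: less_induct)
  case (less d v)
  have up: "annih l (spec l N k) w = 0" if "dom_le d k" "k \<noteq> d" "k \<in> weights l N" "w \<in> U k" for k w
    using less.hyps[OF _ that(3,4)] height_strict[OF that(1) that(2)[symmetric] less.prems(1) that(3)] height_bound[OF that(3)]
    by simp
  show ?case
  proof (cases "dominant l d")
    case False
    then obtain i where i: "Suc i < l" "lk d i < lk d (Suc i)" by (auto simp: dominant_def not_le)
    let ?k = "swap_wt i (Suc i) d"
    note k = swap_wt_dom[OF less.prems(1) i]
    have "annih l (spec l N ?k) (tau i (Suc i) v) = 0"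
      by (rule up[OF k(1,3,2) tau_weight[OF less.prems(2)]])
    then have "annih l (spec l N d) (tau i (Suc i) v) = 0"
      by (rule annih_mono[OF finite_spec spec_mono[OF k(1)]])
    then have "tau i (Suc i) (annih l (spec l N d) v) = 0" using annih_tau[of "spec l N d"] i by simp
    then have "tau i (Suc i) (tau i (Suc i) (annih l (spec l N d) v)) = 0"
      using module_hom.zero[OF tau_hom] by simp
    then show ?thesis by (simp add: tau_tau)
  next
    case True
    define S where "S = spec l N d - {casimir_value l d}"
    have S: "spec l N d = insert (casimir_value l d) S" "finite S" "casimir_value l d \<notin> S"
      using less.prems(1) True dom_le_refl by (auto simp: S_def spec_def)
    let ?w = "annih l S v"
    have "E a b ?w = 0" if ab: "a < b" "b < l" for a b
    proof (cases "lk d b = 0")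
      case True
      then show ?thesis using E_zero annih_U[OF S(2) less.prems(2)] by blast
    next
      case False
      then obtain d0 where d0: "d = d0 + sgl b 1" using wt_split[OF False] by blast
      have w: "d0 + sgl a 1 \<in> weights l N" using weights_raise[of a l b d0 N] ab less.prems(1) d0 by simp
      have "E a b v \<in> U (d0 + sgl a 1)" using E_weight less.prems(2) d0 by blast
      then have "annih l (spec l N (d0 + sgl a 1)) (E a b v) = 0"
        using up[OF _ _ w] dom_le_raise[OF ab(1)] raise_neq[of b a d0] ab(1) d0 by auto
      then have "annih l S (E a b v) = 0"
        using annih_mono[OF S(2)] raised_spec[OF ab] less.prems(1) True d0 unfolding S_def by blast
      then show ?thesis using annih_E[OF S(2)] ab by simp
    qed
    then have "casimir l ?w = of_int (casimir_value l d) *s ?w" by (intro casimir_highest annih_U S(2) less.prems(2))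
    then show ?thesis using S by (simp add: annih_insert shiftop_def)
  qed
qed

lemma eig_in_spec:
  assumes "d \<in> weights l N" "v \<in> eig l c d" "v \<noteq> 0"
  shows "c \<in> spec l N d"
proof (rule ccontr)
  assume "c \<notin> spec l N d"
  then have "(of_int (\<Prod>k\<in>spec l N d. c - k) :: rat) \<noteq> 0" by (auto simp del: of_int_prod)
  moreover have "of_int (\<Prod>k\<in>spec l N d. c - k) *s v = 0"
    using annih_eigen[of "spec l N d" l v c] annih_spec[OF assms(1), of v] assms(2) by (simp add: eig_def)
  ultimately show False using assms(3) by simp
qed

lemma dim_eig_sum:
  assumes d: "d \<in> weights l N" and S: "finite S" "spec l N d \<subseteq> S"
  shows "dim (U d) = (\<Sum>c\<in>S. dim (eig l c d))"
proof (rule dim_direct_sum[OF S(1)])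
  show "\<exists>F. finite F \<and> eig l c d \<subseteq> span F" for c using fin_eig by (simp add: fin_spanned_def)
  show "\<exists>w. (\<forall>c\<in>S. w c \<in> eig l c d) \<and> v = (\<Sum>c\<in>S. w c)" if "v \<in> U d" for v
    using eig_decomp[OF S(1) that] annih_mono[OF S annih_spec[OF d that]] by blast
qed (use subspace_eig eig_U eig_independent[OF S(1)] in blast)+

text \<open>A raised eigenvector keeps its eigenvalue, but this value is no candidate in the higher
  weight space, so the raised vector is zero.\<close>

lemma eig_highest:
  assumes d: "d \<in> weights l N" "dominant l d"
  shows "eig l (casimir_value l d) d = {v \<in> U d. \<forall>a b. a < b \<longrightarrow> E a b v = 0}"
proof (rule equalityI; rule subsetI)
  fix v assume v: "v \<in> eig l (casimir_value l d) d"
  then have vU: "v \<in> U d" using eig_U by blast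
  have "E a b v = 0" if ab: "a < b" for a b
  proof (cases "lk d b = 0")
    case True
    then show ?thesis using E_zero vU by blast
  next
    case False
    then have bl: "b < l" using weights_zero_outside[OF d(1), of b] by force
    obtain d0 where d0: "d = d0 + sgl b 1" using wt_split[OF False] by blast
    have w: "d0 + sgl a 1 \<in> weights l N" using weights_raise[of a l b d0 N] ab bl d(1) d0 by simp
    have "E a b v \<in> eig l (casimir_value l d) (d0 + sgl a 1)"
      using v vU E_weight d0 ab bl by (auto simp: eig_def casimir_E E_scale)
    then show ?thesis
      using eig_in_spec[OF w] raised_spec[OF ab bl] d d0 by blast
  qed
  then show "v \<in> {v \<in> U d. \<forall>a b. a < b \<longrightarrow> E a b v = 0}" using vU by blast
next
  fix v assume "v \<in> {v \<in> U d. \<forall>a b. a < b \<longrightarrow> E a b v = 0}"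
  then show "v \<in> eig l (casimir_value l d) d" using casimir_highest[of v d l] by (auto simp: eig_def)
qed

end

section \<open>Characters and highest weight vectors\<close>

lemma sum_lessThan_card_le:
  fixes A :: "nat set"
  assumes "finite A"
  shows "\<Sum>{..<card A} \<le> \<Sum>A"
  using assms
proof (induction "card A" arbitrary: A)
  case (Suc n)
  then have ne: "A \<noteq> {}" by auto
  have fin: "finite A" by fact
  let ?B = "A - {Max A}"
  have cB: "card ?B = n" using Suc.hyps(2) fin ne by simp
  have "A \<subseteq> {..Max A}" using fin by auto
  then have "card A \<le> Suc (Max A)" using card_mono[of "{..Max A}" A] by simp
  then have "n \<le> Max A" using Suc.hyps(2) by simp
  moreover have "\<Sum>{..<n} \<le> \<Sum>?B" using Suc.hyps(1)[of ?B] cB fin by simp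
  moreover have "\<Sum>A = Max A + \<Sum>?B" using fin ne by (intro sum.remove) auto
  ultimately show ?case using Suc.hyps(2) by (simp flip: Suc.hyps(2))
qed simp

text \<open>Any \<open>m\<close> distinct indices add up to at least 0 + ... + (m - 1), and the
  staircase reflects the indices. So a permuted staircase is dominated by the staircase
  itself.\<close>

lemma sum_staircase_permuted:
  assumes p: "p permutes {..<l}" and m: "m \<le> l"
  shows "(\<Sum>i<m. staircase l (p i)) \<le> (\<Sum>i<m. staircase l i)"
proof -
  have inj: "inj_on p {..<m}" using permutes_inj[OF p] by (rule inj_on_subset) simp
  have "(\<Sum>i<m. i) \<le> (\<Sum>i<m. p i)"
    using sum_lessThan_card_le[of "p ` {..<m}"] inj by (simp add: card_image sum.reindex)
  moreover have "(\<Sum>i<m. staircase l (q i)) + (\<Sum>i<m. q i) = m * (l - 1)" if "\<And>i. i < l \<Longrightarrow> q i < l" for q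
  proof -
    have "(\<Sum>i<m. staircase l (q i)) + (\<Sum>i<m. q i) = (\<Sum>i<m. l - 1)"
      unfolding sum.distrib[symmetric]
    proof (intro sum.cong refl)
      fix i assume "i \<in> {..<m}"
      then have "q i < l" using that m by simp
      then show "staircase l (q i) + q i = l - 1" by (simp add: staircase_def)
    qed
    then show ?thesis by simp
  qed
  from this[of p] this[of id]
  have "(\<Sum>i<m. staircase l (p i)) + (\<Sum>i<m. p i) = (\<Sum>i<m. staircase l i) + (\<Sum>i<m. i)"
    using permutes_in_image[OF p] by simp
  ultimately show ?thesis by linarith
qed

definition weight_series :: "nat \<Rightarrow> nat \<Rightarrow> ((nat \<Rightarrow>\<^sub>0 nat) \<Rightarrow> 'a::comm_monoid_add) \<Rightarrow> 'a qpoly" where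
  "weight_series l N f = (\<Sum>d\<in>weights l N. sgl d (f d))"

lemma lookup_weight_series: "lk (weight_series l N f) d = (if d \<in> weights l N then f d else 0)"
  by (simp add: weight_series_def lookup_sum lookup_single when_def)

lemma lookup_const_times: "lk (sgl 0 (c :: 'a::comm_ring_1) * p) d = c * lk p (d :: 'v \<Rightarrow>\<^sub>0 nat)"
  using lookup_sgl_times_add[of 0 c p d] by simp

lemma lookup_of_int_times: "lk (of_int k * p) d = of_int k * lk (p :: _ \<Rightarrow>\<^sub>0 'a::comm_ring_1) (d :: 'v \<Rightarrow>\<^sub>0 nat)"
  using lookup_const_times[of "of_int k" p d] by simp

lemma lookup_pvar_times_add: "lk (pvar a * p) (d + sgl a 1) = lk (p :: 'a::comm_ring_1 qpoly) d"
  using lookup_sgl_times_add[of "sgl a 1" 1 p d] by (simp add: pvar_def add.commute)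

lemma lookup_pvar_times_0: "lk d a = 0 \<Longrightarrow> lk (pvar a * (p :: 'a::comm_ring_1 qpoly)) d = 0"
  unfolding pvar_def by (rule lookup_sgl_times_eq_0[where i = a]) simp

context gl_family
begin

definition eig_dim :: "nat \<Rightarrow> int \<Rightarrow> (nat \<Rightarrow>\<^sub>0 nat) \<Rightarrow> rat" where
  "eig_dim l c d = of_nat (dim (eig l c d))"

text \<open>The share of one ordered pair of rows in the trace of the Casimir operator on an
  eigenspace. Its generating function plays the role of \<open>T\<close> in
  \<open>laplace_vandermonde_mult\<close>.\<close>

definition ladder_trace :: "nat \<Rightarrow> int \<Rightarrow> nat \<Rightarrow> nat \<Rightarrow> (nat \<Rightarrow>\<^sub>0 nat) \<Rightarrow> rat" where
  "ladder_trace l c a b d = trace_on (eig l c d) (\<lambda>v. E a b (E b a v))"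

lemma E_eig:
  assumes "v \<in> eig l c (d + sgl b 1)" "a < l" "b < l"
  shows "E a b v \<in> eig l c (d + sgl a 1)"
  using assms E_weight by (auto simp: eig_def casimir_E E_scale)

lemma E_back_eig:
  assumes "v \<in> eig l c d" "a < l" "b < l"
  shows "E a b (E b a v) \<in> eig l c d"
  using assms E_back by (auto simp: eig_def casimir_E E_scale)

lemma ladder_trace_zero:
  assumes "lk d a = 0"
  shows "ladder_trace l c a b d = 0"
proof -
  have "E b a v = 0" if "v \<in> eig l c d" for v
    using E_zero[OF _ assms] that eig_U by blast
  then have "ladder_trace l c a b d = trace_on (eig l c d) (\<lambda>v. 0 *s v)"
    unfolding ladder_trace_def by (intro trace_on_cong) simp
  then show ?thesis by (simp only: trace_on_scale mult_zero_left)
qed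

text \<open>Cyclicity of the trace: both sides compose the same two maps between the weights
  \<open>d + sgl a 1\<close> and \<open>d + sgl b 1\<close>.\<close>

lemma ladder_trace_swap:
  assumes "a < l" "b < l"
  shows "ladder_trace l c a b (d + sgl a 1) = ladder_trace l c b a (d + sgl b 1)"
  unfolding ladder_trace_def
  by (rule trace_on_commute[OF fin_eig fin_eig E_hom _ E_hom]) (rule E_eig; use assms in simp)+

lemma ladder_trace_comm:
  assumes "a < l" "b < l" "a \<noteq> b"
  shows "ladder_trace l c b a d = ladder_trace l c a b d + (of_nat (lk d b) - of_nat (lk d a)) * eig_dim l c d"
proof -
  have "E b a (E a b v) = E a b (E b a v) + (of_nat (lk d b) - of_nat (lk d a)) *s v" if "v \<in> eig l c d" for v
  proof -
    have v: "v \<in> U d" using that eig_U by blast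
    show ?thesis using E_comm[of b a a b v] assms(3)
      by (simp add: E_diag[OF v] scale_left_diff_distrib)
  qed
  then have "ladder_trace l c b a d = trace_on (eig l c d) (\<lambda>v. E a b (E b a v) + (of_nat (lk d b) - of_nat (lk d a)) *s v)"
    unfolding ladder_trace_def by (rule trace_on_cong)
  also have "\<dots> = ladder_trace l c a b d + trace_on (eig l c d) (\<lambda>v. (of_nat (lk d b) - of_nat (lk d a)) *s v)"
    unfolding ladder_trace_def using E_back_eig[OF _ assms(1,2)] subspace_scale[OF subspace_eig]
    by (rule trace_on_add)
  finally show ?thesis by (simp add: trace_on_scale eig_dim_def)
qed

lemma ladder_trace_casimir:
  "(\<Sum>a<l. of_nat (lk d a) * (of_nat (lk d a) * eig_dim l c d)) + (\<Sum>a<l. \<Sum>b\<in>{..<l} - {a}. ladder_trace l c a b d) = of_int c * eig_dim l c d"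
proof -
  have "of_int c * eig_dim l c d = trace_on (eig l c d) (\<lambda>v. of_int c *s v)"
    by (simp add: trace_on_scale eig_dim_def)
  also have "\<dots> = trace_on (eig l c d) (\<lambda>v. \<Sum>a<l. \<Sum>b<l. E a b (E b a v))"
    by (intro trace_on_cong) (simp add: eig_def casimir_def)
  also have "\<dots> = (\<Sum>a<l. trace_on (eig l c d) (\<lambda>v. \<Sum>b<l. E a b (E b a v)))"
    by (rule trace_on_sum) (intro subspace_sum subspace_eig E_back_eig; simp)
  also have "\<dots> = (\<Sum>a<l. \<Sum>b<l. ladder_trace l c a b d)"
    unfolding ladder_trace_def by (intro sum.cong refl trace_on_sum E_back_eig) auto
  also have "\<dots> = (\<Sum>a<l. ladder_trace l c a a d + (\<Sum>b\<in>{..<l} - {a}. ladder_trace l c a b d))"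
    by (intro sum.cong refl sum.remove) auto
  also have "\<dots> = (\<Sum>a<l. of_nat (lk d a) * (of_nat (lk d a) * eig_dim l c d)) + (\<Sum>a<l. \<Sum>b\<in>{..<l} - {a}. ladder_trace l c a b d)"
  proof -
    have "ladder_trace l c a a d = of_nat (lk d a) * (of_nat (lk d a) * eig_dim l c d)" for a
    proof -
      have "ladder_trace l c a a d = trace_on (eig l c d) (\<lambda>v. (of_nat (lk d a) * of_nat (lk d a)) *s v)"
        unfolding ladder_trace_def using eig_U by (intro trace_on_cong) (auto simp: E_diag[where d = d] E_scale subset_iff)
      then show ?thesis by (simp add: trace_on_scale eig_dim_def)
    qed
    then show ?thesis by (simp add: sum.distrib)
  qed
  finally show ?thesis by simp
qed

text \<open>At the monomial \<open>d + sgl a 1\<close> the left side is the ladder trace at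
  \<open>d\<close> minus the one at the weight with a unit moved from \<open>b\<close> to
  \<open>a\<close>. By cyclicity the latter is the trace of the reversed product at
  \<open>d\<close>, and the commutator makes the difference (d_a - d_b) times the dimension.\<close>

lemma weight_series_ladder_trace:
  assumes ab: "a < l" "b < l" "a \<noteq> b"
  shows "(pvar a - pvar b) * weight_series l N (ladder_trace l c a b) =
    pvar a * (theta a (weight_series l N (eig_dim l c)) - theta b (weight_series l N (eig_dim l c)))"
proof (rule poly_mapping_eqI)
  fix m
  let ?T = "weight_series l N (ladder_trace l c a b)" and ?X = "weight_series l N (eig_dim l c)"
  show "lk ((pvar a - pvar b) * ?T) m = lk (pvar a * (theta a ?X - theta b ?X)) m"
  proof (cases "lk m a = 0")
    case True
    \<comment> \<open>Vectors of a weight without a unit in row \<open>a\<close> are killed by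
      \<open>E b a\<close>, so the ladder trace vanishes there.\<close>
    have "lk (pvar b * ?T) m = 0"
    proof (cases "lk m b = 0")
      case False
      then obtain d where m: "m = d + sgl b 1" using wt_split[OF False] by blast
      then have "lk d a = 0" using True by (simp add: lookup_add)
      then show ?thesis unfolding m lookup_pvar_times_add by (simp add: lookup_weight_series ladder_trace_zero)
    qed (rule lookup_pvar_times_0)
    then show ?thesis using True
      by (simp add: left_diff_distrib lookup_minus lookup_pvar_times_0)
  next
    case False
    then obtain d where m: "m = d + sgl a 1" using wt_split[OF False] by blast
    have R: "lk (pvar a * (theta a ?X - theta b ?X)) m = (of_nat (lk d a) - of_nat (lk d b)) * lk ?X d"
      unfolding m lookup_pvar_times_add by (simp add: lookup_minus lookup_theta left_diff_distrib)
    have L: "lk ((pvar a - pvar b) * ?T) m = lk ?T d - lk (pvar b * ?T) m"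
      unfolding left_diff_distrib lookup_minus unfolding m lookup_pvar_times_add ..
    show ?thesis
    proof (cases "lk d b = 0")
      case True
      then have "lk m b = 0" using ab by (simp add: m lookup_add lookup_single)
      then have "lk (pvar b * ?T) m = 0" by (rule lookup_pvar_times_0)
      moreover have "ladder_trace l c b a d = 0" using True by (rule ladder_trace_zero)
      ultimately show ?thesis using ladder_trace_comm[OF ab, of c d] True
        unfolding L R by (simp add: lookup_weight_series)
    next
      case False
      then obtain d0 where d0: "d = d0 + sgl b 1" using wt_split[OF False] by blast
      have "m = (d0 + sgl a 1) + sgl b 1" by (simp add: m d0 add_ac)
      then have "lk (pvar b * ?T) m = lk ?T (d0 + sgl a 1)" using lookup_pvar_times_add by metis
      moreover have "d0 + sgl a 1 \<in> weights l N \<longleftrightarrow> d \<in> weights l N"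
        using weights_raise ab d0 by blast
      moreover have "ladder_trace l c a b (d0 + sgl a 1) = ladder_trace l c b a d" using ladder_trace_swap[OF ab(1,2), of c d0] d0 by simp
      ultimately show ?thesis
        using ladder_trace_comm[OF ab, of c d] unfolding L R by (simp add: lookup_weight_series algebra_simps)
    qed
  qed
qed

lemma weight_series_casimir:
  "laplace l (weight_series l N (eig_dim l c)) + (\<Sum>a<l. \<Sum>b\<in>{..<l} - {a}. weight_series l N (ladder_trace l c a b)) = of_int c * weight_series l N (eig_dim l c)"
  by (rule poly_mapping_eqI)
     (simp add: lookup_add lookup_sum laplace_def lookup_theta lookup_weight_series lookup_of_int_times ladder_trace_casimir flip: ladder_trace_casimir)

lemma weight_series_degree: "(\<Sum>a<l. theta a (weight_series l N f)) = of_nat N * weight_series l N (f :: _ \<Rightarrow> rat)"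
  by (rule poly_mapping_eqI)
     (auto simp: lookup_sum lookup_theta lookup_weight_series lookup_of_int_times[of "int N", simplified]
        sum_distrib_right[symmetric] weights_def simp flip: of_nat_sum)

text \<open>The product is an eigenfunction of \<open>laplace\<close>, so all its exponents have the
  same sum of squares. At \<open>d\<close> plus the staircase this sum is the Casimir value of
  \<open>d\<close> plus a constant that depends only on \<open>l\<close> and
  \<open>N\<close>.\<close>

lemma eigen_support:
  assumes d: "d \<in> weights l N" and ne: "lk (vandermonde l * weight_series l N (eig_dim l c)) (d + weight_vec l (staircase l)) \<noteq> 0"
  shows "c = casimir_value l d"
proof -
  let ?F = "vandermonde l * weight_series l N (eig_dim l c)" and ?k = "d + weight_vec l (staircase l)"
  have "laplace l ?F = (of_int c + of_nat (l - 1) * of_nat N + of_nat (\<Sum>a<l. staircase l a ^ 2)) * ?F"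
    by (rule laplace_vandermonde_mult[OF weight_series_ladder_trace weight_series_casimir weight_series_degree])
  also have "(of_int c + of_nat (l - 1) * of_nat N + of_nat (\<Sum>a<l. staircase l a ^ 2) :: rat qpoly) =
      of_int (c + int ((l - 1) * N) + int (\<Sum>a<l. staircase l a ^ 2))"
    by simp
  finally have "lk (laplace l ?F) ?k = of_int (c + int ((l - 1) * N) + int (\<Sum>a<l. staircase l a ^ 2)) * lk ?F ?k"
    by (simp only: lookup_of_int_times)
  moreover have "lk (laplace l ?F) ?k = of_int (\<Sum>a<l. int (lk ?k a) ^ 2) * lk ?F ?k"
    by (simp add: laplace_def lookup_sum lookup_theta sum_distrib_right power2_eq_square mult.assoc)
  ultimately have "(of_int (\<Sum>a<l. int (lk ?k a) ^ 2) :: rat) = of_int (c + int ((l - 1) * N) + int (\<Sum>a<l. staircase l a ^ 2))"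
    using ne by simp
  then have "(\<Sum>a<l. int (lk ?k a) ^ 2) = c + int ((l - 1) * N) + int (\<Sum>a<l. staircase l a ^ 2)"
    by (simp only: of_int_eq_iff)
  moreover have "(\<Sum>a<l. int (lk ?k a) ^ 2) = casimir_value l d + int ((l - 1) * N) + int (\<Sum>a<l. staircase l a ^ 2)"
  proof -
    have N: "(\<Sum>a<l. lk d a) = N" using d by (simp add: weights_def)
    have "int ((l - 1) * N) = (\<Sum>a<l. int (l - 1) * int (lk d a))"
      by (simp only: N[symmetric] of_nat_mult of_nat_sum sum_distrib_left)
    \<comment> \<open>Twice the staircase at \<open>a\<close> is (l - 1 - 2a) + (l - 1): the first
      part is 2 rho, the second contributes the degree.\<close>
    moreover have "int (lk ?k a) ^ 2 = (int (lk d a) ^ 2 + (int l - 1 - 2 * int a) * int (lk d a)) + int (l - 1) * int (lk d a) + int (staircase l a ^ 2)"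
      if "a < l" for a
    proof -
      have l: "int l = int (staircase l a) + int a + 1" "int (l - 1) = int (staircase l a) + int a"
        using that by (auto simp: staircase_def)
      have "lk ?k a = lk d a + staircase l a" using that by (simp add: lookup_add lookup_weight_vec)
      then show ?thesis unfolding l by (simp add: power2_eq_square algebra_simps)
    qed
    ultimately show ?thesis by (simp add: casimir_value_def sum.distrib)
  qed
  ultimately show ?thesis by simp
qed

lemma eig_dim_nonzero_spec:
  assumes "d \<in> weights l N" "eig_dim l c d \<noteq> 0"
  shows "c \<in> spec l N d"
proof -
  have "\<exists>v\<in>eig l c d. v \<noteq> 0"
  proof (rule ccontr)
    assume "\<not> ?thesis"
    then have "eig l c d \<subseteq> {0}" by blast
    then have "eig l c d \<subseteq> span {}" by simp
    then have "dim (eig l c d) = 0" using dim_le_card[of "eig l c d" "{}"] by simp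
    then show False using assms(2) by (simp add: eig_dim_def)
  qed
  then show ?thesis using eig_in_spec[OF assms(1)] by blast
qed

text \<open>A permutation \<open>p\<close> picks out the dimension at the weight \<open>d\<close>
  plus the staircase minus the permuted staircase, which dominates \<open>d\<close>. The eigenvalue
  of \<open>d\<close> occurs there only if that weight is \<open>d\<close>, which forces
  \<open>p = id\<close>.\<close>

lemma eigen_leading:
  assumes d: "d \<in> weights l N" "dominant l d"
  shows "lk (vandermonde l * weight_series l N (eig_dim l (casimir_value l d))) (d + weight_vec l (staircase l)) = eig_dim l (casimir_value l d) d"
proof -
  let ?X = "weight_series l N (eig_dim l (casimir_value l d))" and ?k = "d + weight_vec l (staircase l)"
  have tm: "lk (sgl (weight_vec l (staircase l \<circ> p)) (of_int (sign p)) * ?X) ?k = (if p = id then eig_dim l (casimir_value l d) d else 0)"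
    if p: "p permutes {..<l}" for p
  proof (cases "p = id")
    case True
    have "lk (sgl (weight_vec l (staircase l)) 1 * ?X) (weight_vec l (staircase l) + d) = 1 * lk ?X d" by (rule lookup_sgl_times_add)
    then show ?thesis using True d by (simp add: add.commute lookup_weight_series)
  next
    case False
    let ?m = "weight_vec l (staircase l \<circ> p)"
    have "lk (sgl ?m (of_int (sign p)) * ?X) ?k = 0"
    proof (rule ccontr)
      assume ne: "lk (sgl ?m (of_int (sign p)) * ?X) ?k \<noteq> 0"
      then have le: "lk ?m i \<le> lk ?k i" for i using lookup_sgl_times_eq_0 not_le by metis
      define e where "e = ?k - ?m"
      have k: "?k = ?m + e" by (rule poly_mapping_eqI) (use le in \<open>simp add: e_def lookup_add lookup_minus\<close>)
      have "lk ?X e \<noteq> 0" using ne unfolding k lookup_sgl_times_add by auto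
      then have e: "e \<in> weights l N" "eig_dim l (casimir_value l d) e \<noteq> 0" by (auto simp: lookup_weight_series split: if_splits)
      have de: "dom_le d e"
        unfolding dom_le_def
      proof
        fix m
        show "(\<Sum>i<m. lk d i) \<le> (\<Sum>i<m. lk e i)"
        proof (cases "m \<le> l")
          case True
          have "(\<Sum>i<m. lk d i + staircase l i) = (\<Sum>i<m. staircase l (p i) + lk e i)"
          proof (intro sum.cong refl)
            fix i assume "i \<in> {..<m}"
            then have "i < l" using True by simp
            moreover have "lk ?k i = lk (?m + e) i" using k by simp
            ultimately show "lk d i + staircase l i = staircase l (p i) + lk e i" by (simp add: lookup_add lookup_weight_vec)
          qed
          then show ?thesis using sum_staircase_permuted[OF p True] by (simp add: sum.distrib)
        next
          case False
          then have "(\<Sum>i<m. lk e i) = (\<Sum>i<l. lk e i)" if "e \<in> weights l N" for e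
            using weights_zero_outside[OF that] by (intro sum.mono_neutral_right) auto
          then show ?thesis using d(1) e(1) by (simp add: weights_def)
        qed
      qed
      from eig_dim_nonzero_spec[OF e] obtain k where k': "k \<in> weights l N" "dominant l k" "dom_le e k" "casimir_value l k = casimir_value l d"
        by (auto simp: spec_def)
      have "k = d" by (rule casimir_value_inj_dominant[OF d k'(1,2) dom_le_trans[OF de k'(3)] k'(4)])
      then have "e = d" using de k'(3) dom_le_antisym by blast
      have "p i = i" for i
      proof (cases "i < l")
        case True
        have "lk ?k i = lk (?m + d) i" using k \<open>e = d\<close> by simp
        then have "staircase l (p i) = staircase l i" using True by (simp add: lookup_add lookup_weight_vec)
        then show ?thesis using True permutes_in_image[OF p, of i] by (auto simp: staircase_def)
      next
        case False
        then show ?thesis using permutes_not_in[OF p] by simp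
      qed
      then show False using False by (auto simp: fun_eq_iff)
    qed
    then show ?thesis using False by simp
  qed
  have "lk (vandermonde l * ?X) ?k = (\<Sum>p | p permutes {..<l}. lk (sgl (weight_vec l (staircase l \<circ> p)) (of_int (sign p)) * ?X) ?k)"
    unfolding alternant_staircase[symmetric] alternant_expand sum_distrib_right lookup_sum ..
  also have "\<dots> = (\<Sum>p | p permutes {..<l}. if p = id then eig_dim l (casimir_value l d) d else 0)"
    by (intro sum.cong refl) (simp only: tm mem_Collect_eq)
  also have "\<dots> = eig_dim l (casimir_value l d) d"
    by (subst sum.delta) (simp_all add: finite_permutations permutes_id)
  finally show ?thesis .
qed

text \<open>
  An eigenspace with eigenvalue \<open>c\<close> contributes only if \<open>c = casimir_value l d\<close>, and within that eigenspace no weight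
  strictly above \<open>d\<close> occurs, so that of the alternating sum only the term of \<open>d\<close> itself remains.
\<close>

theorem vandermonde_character_leading:
  assumes d: "d \<in> weights l N" "dominant l d"
  shows "lk (vandermonde l * weight_series l N (\<lambda>d. of_nat (dim (U d)))) (d + weight_vec l (staircase l)) =
    (of_nat (dim {v \<in> U d. \<forall>a b. a < b \<longrightarrow> E a b v = 0}) :: rat)"
proof -
  \<comment> \<open>One finite set of eigenvalues for all weights of degree \<open>N\<close>, so
    that the whole character splits along it.\<close>
  define S where "S = insert (casimir_value l d) (\<Union>d\<in>weights l N. spec l N d)"
  have S: "finite S" "casimir_value l d \<in> S" by (auto simp: S_def)
  have "weight_series l N (\<lambda>d. of_nat (dim (U d))) = (\<Sum>c\<in>S. weight_series l N (eig_dim l c))"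
  proof (rule poly_mapping_eqI)
    fix e
    show "lk (weight_series l N (\<lambda>d. of_nat (dim (U d)))) e = lk (\<Sum>c\<in>S. weight_series l N (eig_dim l c)) e"
    proof (cases "e \<in> weights l N")
      case True
      then have "spec l N e \<subseteq> S" by (auto simp: S_def)
      then show ?thesis using True dim_eig_sum[OF True S(1)] by (simp add: lookup_weight_series lookup_sum eig_dim_def)
    qed (simp add: lookup_weight_series lookup_sum)
  qed
  then have "lk (vandermonde l * weight_series l N (\<lambda>d. of_nat (dim (U d)))) (d + weight_vec l (staircase l)) =
      (\<Sum>c\<in>S. lk (vandermonde l * weight_series l N (eig_dim l c)) (d + weight_vec l (staircase l)))"
    by (simp add: sum_distrib_left lookup_sum)
  also have "\<dots> = (\<Sum>c\<in>S. if c = casimir_value l d then eig_dim l (casimir_value l d) d else 0)"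
    using eigen_leading[OF d] eigen_support[OF d(1)] by (intro sum.cong refl) auto
  also have "\<dots> = eig_dim l (casimir_value l d) d" using S by simp
  finally show ?thesis by (simp add: eig_dim_def eig_highest[OF d])
qed

end

section \<open>Polarization operators on polynomials\<close>

type_synonym expo = "(nat \<times> nat) \<Rightarrow>\<^sub>0 nat"

text \<open>For identities between operators that obey a product rule; they then have to be checked
  on constants and single variables only.\<close>

lemma poly_induct [case_names const add var]:
  fixes p :: "('v \<Rightarrow>\<^sub>0 nat) \<Rightarrow>\<^sub>0 'a::comm_ring_1"
  assumes const: "\<And>c. P (pconst c)" and add: "\<And>p q. P p \<Longrightarrow> P q \<Longrightarrow> P (p + q)"
    and var: "\<And>v p. P p \<Longrightarrow> P (pvar v * p)"
  shows "P p"
proof (induction p rule: pm_induct)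
  case (single m c)
  have "P q \<Longrightarrow> P (sgl m 1 * q)" for q
  proof (induction m arbitrary: q rule: pm_induct)
    case (single v k)
    have "P (pvar v ^ k * q)" using single by (induction k) (simp_all add: mult.assoc var)
    then show ?case by (simp add: pvar_power)
  next
    case (add m k)
    have "sgl (m + k) (1::'a) * q = sgl m 1 * (sgl k 1 * q)" by (simp add: mult_single flip: mult.assoc)
    then show ?case using add by simp
  qed
  from this[OF const[of c]] show ?case by (simp add: pconst_def mult_single)
qed (rule add)

definition qscale :: "rat \<Rightarrow> mpoly \<Rightarrow> mpoly" where "qscale c p = pconst c * p"

lemma pconst_add: "pconst (a + b) = pconst a + pconst b" by (simp add: pconst_def single_add)
lemma pconst_mult: "pconst (a * b) = pconst a * (pconst b :: ('v \<Rightarrow>\<^sub>0 nat) \<Rightarrow>\<^sub>0 'a::comm_ring_1)"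
  by (simp add: pconst_def mult_single)
lemma pconst_1 [simp]: "pconst 1 = 1" by (simp add: pconst_def)
lemma pconst_0 [simp]: "pconst 0 = 0" by (simp add: pconst_def)
lemma lookup_pconst_times: "lk (pconst c * p) m = c * lk (p :: mpoly) m"
  unfolding pconst_def by (rule lookup_const_times)

lemma vector_space_qscale: "vector_space qscale"
  by standard (simp_all add: qscale_def pconst_add pconst_mult algebra_simps)

interpretation Q: trace_space qscale
  by (rule trace_space.intro[OF vector_space_qscale])

text \<open>The subtraction of exponents is truncated, which does no harm: the coefficient is zero
  when the variable does not occur.\<close>

definition partial_deriv :: "'v \<Rightarrow> (('v \<Rightarrow>\<^sub>0 nat) \<Rightarrow>\<^sub>0 'a::comm_ring_1) \<Rightarrow> ('v \<Rightarrow>\<^sub>0 nat) \<Rightarrow>\<^sub>0 'a" where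
  "partial_deriv v p = (\<Sum>m\<in>Poly_Mapping.keys p. sgl (m - sgl v 1) (of_nat (lk m v) * lk p m))"

lemma partial_deriv_superset:
  assumes "finite M" "Poly_Mapping.keys p \<subseteq> M"
  shows "partial_deriv v p = (\<Sum>m\<in>M. sgl (m - sgl v 1) (of_nat (lk m v) * lk p m))"
  unfolding partial_deriv_def using assms by (intro sum.mono_neutral_left) (auto simp: in_keys_iff)

lemma partial_deriv_single: "partial_deriv v (sgl m c) = sgl (m - sgl v 1) (of_nat (lk m v) * c)"
  using partial_deriv_superset[of "{m}" "sgl m c" v] by simp

lemma partial_deriv_add: "partial_deriv v (p + q) = partial_deriv v p + partial_deriv v q"
proof -
  let ?M = "Poly_Mapping.keys p \<union> Poly_Mapping.keys q"
  have "Poly_Mapping.keys (p + q) \<subseteq> ?M" by (rule keys_add)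
  then show ?thesis
    using partial_deriv_superset[of ?M p v] partial_deriv_superset[of ?M q v] partial_deriv_superset[of ?M "p + q" v]
    by (simp add: lookup_add distrib_left single_add sum.distrib)
qed

lemma expo_diff_add: "lk m v \<noteq> 0 \<Longrightarrow> m - sgl v 1 + k = m + k - sgl v (1::nat)"
  by (rule poly_mapping_eqI) (auto simp: lookup_add lookup_minus lookup_single when_def)

lemma partial_deriv_mult: "partial_deriv v (p * q) = partial_deriv v p * q + p * partial_deriv v q"
proof (induction p rule: pm_induct)
  case (single m c)
  show ?case
  proof (induction q rule: pm_induct)
    case (single k e)
    have 1: "sgl (m - sgl v 1 + k) (of_nat (lk m v) * c * e) = sgl (m + k - sgl v 1) (of_nat (lk m v) * c * e)"
      using expo_diff_add[of m v k] by (cases "lk m v = 0") simp_all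
    have 2: "sgl (m + (k - sgl v 1)) (c * (of_nat (lk k v) * e)) = sgl (m + k - sgl v 1) (c * (of_nat (lk k v) * e))"
      using expo_diff_add[of k v m] by (cases "lk k v = 0") (simp_all add: add.commute)
    show ?case
      unfolding partial_deriv_single mult_single 1 2
      by (simp add: lookup_add single_add[symmetric] algebra_simps)
  qed (simp add: partial_deriv_add algebra_simps)
qed (simp add: partial_deriv_add algebra_simps)

lemma partial_deriv_pconst [simp]: "partial_deriv v (pconst c) = 0"
  by (simp add: pconst_def partial_deriv_single)

lemma partial_deriv_pvar: "partial_deriv v (pvar w) = (if v = w then 1 else 0)"
  by (simp add: pvar_def partial_deriv_single lookup_single when_def)

definition polarize :: "nat \<Rightarrow> nat \<Rightarrow> nat \<Rightarrow> mpoly \<Rightarrow> mpoly" where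
  "polarize n a b p = (\<Sum>j<n. pvar (a, j) * partial_deriv (b, j) p)"

lemma polarize_add: "polarize n a b (p + q) = polarize n a b p + polarize n a b q"
  by (simp add: polarize_def partial_deriv_add distrib_left sum.distrib)

lemma polarize_mult: "polarize n a b (p * q) = polarize n a b p * q + p * polarize n a b q"
  by (simp add: polarize_def partial_deriv_mult sum_distrib_left sum_distrib_right sum.distrib[symmetric] algebra_simps)

lemma polarize_pconst [simp]: "polarize n a b (pconst c) = 0"
  by (simp add: polarize_def)

lemma polarize_0 [simp]: "polarize n a b 0 = 0"
  using polarize_pconst[of n a b 0] by simp

lemma polarize_1 [simp]: "polarize n a b 1 = 0"
  using polarize_pconst[of n a b 1] by simp

lemma polarize_scale: "polarize n a b (qscale c p) = qscale c (polarize n a b p)"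
  by (simp add: qscale_def polarize_mult)

lemma polarize_hom: "module_hom qscale qscale (polarize n a b)"
  using vector_space_qscale by (intro module_hom.intro module_hom_axioms.intro)
    (simp_all add: polarize_add polarize_scale module_iff_vector_space)

lemma polarize_sum: "polarize n a b (sum f I) = (\<Sum>i\<in>I. polarize n a b (f i))"
  using polarize_hom by (rule module_hom.sum)

lemma polarize_pvar: "polarize n a b (pvar (i, j)) = (if i = b \<and> j < n then pvar (a, j) else 0)"
proof -
  have "polarize n a b (pvar (i, j)) = (\<Sum>k<n. if k = j then (if i = b then pvar (a, j) else 0) else 0)"
    unfolding polarize_def partial_deriv_pvar by (intro sum.cong) auto
  then show ?thesis by simp
qed

text \<open>Commutators of derivations are derivations, so both sides agree as soon as they agree on
  variables.\<close>

lemma polarize_comm: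
  "polarize n a b (polarize n c e p) = polarize n c e (polarize n a b p) + (if b = c then polarize n a e p else 0) - (if a = e then polarize n c b p else 0)"
proof (induction p rule: poly_induct)
  case (add p q)
  then show ?case by (simp add: polarize_add)
next
  case (var v p)
  obtain i j where v: "v = (i, j)" by (cases v)
  have x: "polarize n a b (polarize n c e (pvar v)) = polarize n c e (polarize n a b (pvar v)) +
     (if b = c then polarize n a e (pvar v) else 0) - (if a = e then polarize n c b (pvar v) else 0)"
    by (auto simp: v polarize_pvar)
  show ?case by (simp add: polarize_mult polarize_add x var algebra_simps)
qed simp

text \<open>Degrees are prescribed in all rows while columns are bounded by \<open>n\<close>. The
  number of rows enters only through the support of \<open>d\<close>, so the spaces built from this
  do not mention \<open>l\<close>.\<close>

definition has_wt :: "nat \<Rightarrow> (nat \<Rightarrow>\<^sub>0 nat) \<Rightarrow> expo \<Rightarrow> bool" where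
  "has_wt n d m \<longleftrightarrow> (\<forall>i j. n \<le> j \<longrightarrow> lk m (i, j) = 0) \<and> (\<forall>i. (\<Sum>j<n. lk m (i, j)) = lk d i)"

definition hpoly :: "nat \<Rightarrow> (nat \<Rightarrow>\<^sub>0 nat) \<Rightarrow> mpoly set" where
  "hpoly n d = {p. \<forall>m\<in>Poly_Mapping.keys p. has_wt n d m}"

lemma has_wt_add: "has_wt n d m \<Longrightarrow> has_wt n e k \<Longrightarrow> has_wt n (d + e) (m + k)"
  by (simp add: has_wt_def lookup_add sum.distrib)

lemma has_wt_single: "j < n \<Longrightarrow> has_wt n (sgl i c) (sgl (i, j) c)"
  by (auto simp: has_wt_def lookup_single when_def)

lemma has_wt_0: "has_wt n 0 0"
  by (simp add: has_wt_def)

lemma has_wt_unique: "has_wt n d m \<Longrightarrow> has_wt n e m \<Longrightarrow> d = e"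
  by (rule poly_mapping_eqI) (simp add: has_wt_def)

lemma hpoly_mult: "p \<in> hpoly n d \<Longrightarrow> q \<in> hpoly n e \<Longrightarrow> p * q \<in> hpoly n (d + e)"
  unfolding hpoly_def using keys_mult[of p q] has_wt_add by fastforce

lemma hpoly_single: "has_wt n d m \<Longrightarrow> sgl m c \<in> hpoly n d"
  by (simp add: hpoly_def)

lemma hpoly_0: "0 \<in> hpoly n d"
  by (simp add: hpoly_def)

lemma hpoly_add: "p \<in> hpoly n d \<Longrightarrow> q \<in> hpoly n d \<Longrightarrow> p + q \<in> hpoly n d"
  unfolding hpoly_def using keys_add[of p q] by blast

lemma hpoly_pconst: "pconst c \<in> hpoly n 0"
  unfolding pconst_def by (rule hpoly_single[OF has_wt_0])

lemma hpoly_scale: "p \<in> hpoly n d \<Longrightarrow> qscale c p \<in> hpoly n d"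
  using hpoly_mult[OF hpoly_pconst, of p n d c] by (simp add: qscale_def)

lemma subspace_hpoly: "Q.subspace (hpoly n d)"
  by (simp add: Q.subspace_def hpoly_0 hpoly_add hpoly_scale)

lemma hpoly_pvar: "j < n \<Longrightarrow> pvar (i, j) \<in> hpoly n (sgl i 1)"
  unfolding pvar_def by (intro hpoly_single has_wt_single)

lemma hpoly_partial_deriv: "p \<in> hpoly n (d + sgl b 1) \<Longrightarrow> j < n \<Longrightarrow> partial_deriv (b, j) p \<in> hpoly n d"
  unfolding partial_deriv_def
proof (intro Q.subspace_sum[OF subspace_hpoly])
  fix m assume p: "p \<in> hpoly n (d + sgl b 1)" and j: "j < n" and m: "m \<in> Poly_Mapping.keys p"
  show "sgl (m - sgl (b, j) 1) (of_nat (lk m (b, j)) * lk p m) \<in> hpoly n d"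
  proof (cases "lk m (b, j) = 0")
    case True
    then show ?thesis by (simp add: hpoly_0)
  next
    case False
    then obtain k where k: "m = k + sgl (b, j) 1"
    proof -
      have "m = (m - sgl (b, j) 1) + sgl (b, j) 1"
        using False by (intro poly_mapping_eqI) (auto simp: lookup_add lookup_minus lookup_single when_def)
      then show ?thesis using that by blast
    qed
    have "has_wt n (d + sgl b 1) m" using p m by (simp add: hpoly_def)
    then have "has_wt n d k"
      using has_wt_single[OF j, of b 1] by (simp add: has_wt_def k lookup_add sum.distrib)
    then show ?thesis by (intro hpoly_single) (simp add: k)
  qed
qed

lemma hpoly_polarize: "p \<in> hpoly n (d + sgl b 1) \<Longrightarrow> polarize n a b p \<in> hpoly n (d + sgl a 1)"
  unfolding polarize_def
  by (intro Q.subspace_sum[OF subspace_hpoly]) (metis hpoly_mult hpoly_pvar hpoly_partial_deriv add.commute lessThan_iff)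

lemma hpoly_polarize_zero:
  assumes "p \<in> hpoly n d" "lk d b = 0"
  shows "polarize n a b p = 0"
proof -
  have "partial_deriv (b, j) p = 0" if "j < n" for j
    unfolding partial_deriv_def
  proof (rule sum.neutral, rule ballI)
    fix m assume "m \<in> Poly_Mapping.keys p"
    then have "(\<Sum>j<n. lk m (b, j)) = 0" using assms by (simp add: hpoly_def has_wt_def)
    then show "sgl (m - sgl (b, j) 1) (of_nat (lk m (b, j)) * lk p m) = 0" using that by simp
  qed
  then show ?thesis by (simp add: polarize_def)
qed

lemma sum_sgl: "(\<Sum>a\<in>A. sgl d (f a)) = sgl d (\<Sum>a\<in>A. f a)"
  by (induction A rule: infinite_finite_induct) (simp_all add: single_add)

text \<open>Euler's identity for the variables of row \<open>a\<close>, checked on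
  monomials.\<close>

lemma hpoly_polarize_diag:
  assumes "p \<in> hpoly n d"
  shows "polarize n a a p = qscale (of_nat (lk d a)) p"
proof -
  have mon: "polarize n a a (sgl m c) = qscale (of_nat (lk d a)) (sgl m c)" if m: "has_wt n d m" for m c
  proof -
    have "pvar (a, j) * partial_deriv (a, j) (sgl m c) = sgl m (of_nat (lk m (a, j)) * c)" if "j < n" for j
    proof (cases "lk m (a, j) = 0")
      case False
      then have "sgl (a, j) 1 + (m - sgl (a, j) 1) = m"
        by (intro poly_mapping_eqI) (auto simp: lookup_add lookup_minus lookup_single when_def)
      then show ?thesis by (simp add: pvar_def partial_deriv_single mult_single)
    qed (simp add: partial_deriv_single)
    then have "polarize n a a (sgl m c) = sgl m (\<Sum>j<n. of_nat (lk m (a, j)) * c)"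
      by (simp add: polarize_def sum_sgl)
    also have "(\<Sum>j<n. of_nat (lk m (a, j)) * c) = of_nat (lk d a) * c"
      using m unfolding has_wt_def by (simp flip: sum_distrib_right of_nat_sum)
    finally show ?thesis by (simp add: qscale_def pconst_def mult_single del: single_of_nat)
  qed
  have "polarize n a a (\<Sum>m\<in>Poly_Mapping.keys p. sgl m (lk p m)) = (\<Sum>m\<in>Poly_Mapping.keys p. qscale (of_nat (lk d a)) (sgl m (lk p m)))"
    unfolding polarize_sum using assms by (intro sum.cong refl mon) (simp add: hpoly_def)
  also have "\<dots> = qscale (of_nat (lk d a)) (\<Sum>m\<in>Poly_Mapping.keys p. sgl m (lk p m))"
    by (simp add: Q.scale_sum_right)
  finally show ?thesis by (simp flip: pm_expand)
qed

lemma finite_has_wt: "finite {m. has_wt n d m}"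
proof -
  let ?D = "Poly_Mapping.keys d \<times> {..<n}" and ?N = "\<Sum>i\<in>Poly_Mapping.keys d. lk d i"
  have zero: "lk m (i, j) = 0" if "has_wt n d m" "(i, j) \<notin> ?D" for m i j
  proof (cases "j < n")
    case True
    then have "lk d i = 0" using that(2) by (simp add: in_keys_iff)
    then have "(\<Sum>j<n. lk m (i, j)) = 0" using that(1) by (simp add: has_wt_def)
    then show ?thesis using True by simp
  qed (use that(1) in \<open>simp add: has_wt_def\<close>)
  have inj: "inj_on (\<lambda>m. restrict (lk m) ?D) {m. has_wt n d m}"
  proof (rule inj_onI)
    fix m k assume mk: "m \<in> {m. has_wt n d m}" "k \<in> {m. has_wt n d m}" and eq: "restrict (lk m) ?D = restrict (lk k) ?D"
    show "m = k"
    proof (rule poly_mapping_eqI)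
      fix x show "lk m x = lk k x"
        using fun_cong[OF eq, of x] zero[of m "fst x" "snd x"] zero[of k "fst x" "snd x"] mk
        by (cases "x \<in> ?D") auto
    qed
  qed
  have bnd: "lk m (i, j) \<le> ?N" if "has_wt n d m" "(i, j) \<in> ?D" for m i j
  proof -
    have "lk m (i, j) \<le> (\<Sum>j<n. lk m (i, j))" using that by (intro member_le_sum) auto
    also have "\<dots> = lk d i" using that by (simp add: has_wt_def)
    also have "\<dots> \<le> ?N" using that by (intro member_le_sum) auto
    finally show ?thesis .
  qed
  have "(\<lambda>m. restrict (lk m) ?D) ` {m. has_wt n d m} \<subseteq> ?D \<rightarrow>\<^sub>E {..?N}"
  proof
    fix f assume "f \<in> (\<lambda>m. restrict (lk m) ?D) ` {m. has_wt n d m}"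
    then obtain m where f: "f = restrict (lk m) ?D" "has_wt n d m" by blast
    then show "f \<in> ?D \<rightarrow>\<^sub>E {..?N}" using bnd[OF f(2)] by (auto simp: restrict_PiE_iff)
  qed
  then show ?thesis using inj by (meson finite_PiE finite_SigmaI finite_atMost finite_keys finite_lessThan finite_subset inj_on_finite)
qed

lemma hpoly_in_span: "p \<in> hpoly n d \<Longrightarrow> p \<in> Q.span ((\<lambda>m. sgl m 1) ` {m. has_wt n d m})"
proof -
  assume p: "p \<in> hpoly n d"
  have "(\<Sum>m\<in>Poly_Mapping.keys p. qscale (lk p m) (sgl m 1)) \<in> Q.span ((\<lambda>m. sgl m 1) ` {m. has_wt n d m})"
    using p by (intro Q.span_sum Q.span_scale Q.span_base) (auto simp: hpoly_def)
  also have "(\<Sum>m\<in>Poly_Mapping.keys p. qscale (lk p m) (sgl m 1)) = p"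
    using pm_expand[of p] by (simp add: qscale_def pconst_def mult_single)
  finally show ?thesis .
qed

lemma fin_spanned_hpoly: "Q.fin_spanned (hpoly n d)"
  unfolding Q.fin_spanned_def using hpoly_in_span finite_has_wt by (meson finite_imageI subsetI)

section \<open>Exchange of two rows of variables\<close>

definition swap_rows :: "nat \<Rightarrow> nat \<Rightarrow> nat \<times> nat \<Rightarrow> nat \<times> nat" where
  "swap_rows p q = (\<lambda>(i, j). (Transposition.transpose p q i, j))"

lemma swap_rows_invol [simp]: "swap_rows p q (swap_rows p q x) = x"
  by (simp add: swap_rows_def case_prod_unfold)

lemma inj_swap_rows: "inj (swap_rows p q)"
  by (rule inj_on_inverseI[where g = "swap_rows p q"]) simp

definition tau_expo :: "nat \<Rightarrow> nat \<Rightarrow> expo \<Rightarrow> expo" where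
  "tau_expo p q m = Poly_Mapping.map_key (swap_rows p q) m"

lemma lookup_tau_expo: "lk (tau_expo p q m) x = lk m (swap_rows p q x)"
  by (simp add: tau_expo_def map_key.rep_eq inj_swap_rows)

lemma tau_expo_invol [simp]: "tau_expo p q (tau_expo p q m) = m"
  by (rule poly_mapping_eqI) (simp add: lookup_tau_expo)

lemma tau_expo_add: "tau_expo p q (m + k) = tau_expo p q m + tau_expo p q k"
  by (rule poly_mapping_eqI) (simp add: lookup_tau_expo lookup_add)

lemma inj_tau_expo: "inj (tau_expo p q)"
  by (rule inj_on_inverseI[where g = "tau_expo p q"]) simp

text \<open>The substitution that exchanges rows \<open>p\<close> and \<open>q\<close>. As the
  exchange is an involution, the coefficient function can be composed with it directly.\<close>

definition tau :: "nat \<Rightarrow> nat \<Rightarrow> mpoly \<Rightarrow> mpoly" where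
  "tau p q f = Poly_Mapping.map_key (tau_expo p q) f"

lemma lookup_tau: "lk (tau p q f) m = lk f (tau_expo p q m)"
  by (simp add: tau_def map_key.rep_eq inj_tau_expo)

lemma tau_single: "tau p q (sgl m c) = sgl (tau_expo p q m) c"
  by (rule poly_mapping_eqI) (auto simp: lookup_tau lookup_single when_def)

lemma tau_add: "tau p q (f + g) = tau p q f + tau p q g"
  by (rule poly_mapping_eqI) (simp add: lookup_tau lookup_add)

lemma tau_mult: "tau p q (f * g) = tau p q f * tau p q g"
proof (induction f rule: pm_induct)
  case (single m c)
  show ?case
    by (induction g rule: pm_induct)
       (simp_all add: mult_single tau_single tau_expo_add tau_add distrib_left)
qed (simp add: tau_add distrib_right)

lemma tau_expo_single: "tau_expo p q (sgl x c) = sgl (swap_rows p q x) c"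
proof (rule poly_mapping_eqI)
  fix y
  have "x = swap_rows p q y \<longleftrightarrow> swap_rows p q x = y" by (metis swap_rows_invol)
  then show "lk (tau_expo p q (sgl x c)) y = lk (sgl (swap_rows p q x) c) y"
    by (simp add: lookup_tau_expo lookup_single when_def)
qed

lemma tau_expo_0 [simp]: "tau_expo p q 0 = 0"
  by (rule poly_mapping_eqI) (simp add: lookup_tau_expo)

lemma tau_pconst [simp]: "tau p q (pconst c) = pconst c"
  by (simp add: pconst_def tau_single)

lemma tau_1 [simp]: "tau p q 1 = 1"
  using tau_pconst[of p q 1] by simp

lemma tau_0 [simp]: "tau p q 0 = 0"
  using tau_pconst[of p q 0] by simp

lemma tau_pvar: "tau p q (pvar x) = pvar (swap_rows p q x)"
  by (simp add: pvar_def tau_single tau_expo_single)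

lemma tau_hom: "module_hom qscale qscale (tau p q)"
  using vector_space_qscale by (intro module_hom.intro module_hom_axioms.intro)
    (simp_all add: tau_add qscale_def tau_mult module_iff_vector_space)

lemma tau_tau: "tau p q (tau p q f) = f"
  by (rule poly_mapping_eqI) (simp add: lookup_tau)

lemma has_wt_tau_expo: "has_wt n d (tau_expo p q m) \<Longrightarrow> has_wt n (swap_wt p q d) m"
  unfolding has_wt_def
proof (intro conjI allI impI)
  assume h: "(\<forall>i j. n \<le> j \<longrightarrow> lk (tau_expo p q m) (i, j) = 0) \<and> (\<forall>i. (\<Sum>j<n. lk (tau_expo p q m) (i, j)) = lk d i)"
  show "lk m (i, j) = 0" if "n \<le> j" for i j
    using h that spec[OF conjunct1[OF h], of "Transposition.transpose p q i"] by (simp add: lookup_tau_expo swap_rows_def)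
  show "(\<Sum>j<n. lk m (i, j)) = lk (swap_wt p q d) i" for i
    using spec[OF conjunct2[OF h], of "Transposition.transpose p q i"]
    by (simp add: lookup_tau_expo swap_rows_def lookup_swap_wt)
qed

lemma tau_hpoly: "f \<in> hpoly n d \<Longrightarrow> tau p q f \<in> hpoly n (swap_wt p q d)"
  by (auto simp: hpoly_def in_keys_iff lookup_tau intro: has_wt_tau_expo)

lemma tau_polarize:
  "tau p q (polarize n a b f) = polarize n (Transposition.transpose p q a) (Transposition.transpose p q b) (tau p q f)"
proof (induction f rule: poly_induct)
  case (add f g)
  then show ?case by (simp add: polarize_add tau_add)
next
  case (var v f)
  obtain i j where v: "v = (i, j)" by (cases v)
  have "tau p q (polarize n a b (pvar v)) = polarize n (Transposition.transpose p q a) (Transposition.transpose p q b) (tau p q (pvar v))"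
    by (auto simp: v polarize_pvar tau_pvar swap_rows_def dest: transpose_eq_imp_eq)
  then show ?case by (simp add: polarize_mult tau_add tau_mult var)
qed simp

interpretation hpoly: gl_family qscale "polarize n" tau "hpoly n" for n
  by (intro gl_family.intro gl_family_axioms.intro Q.trace_space_axioms subspace_hpoly fin_spanned_hpoly
      polarize_hom hpoly_polarize hpoly_polarize_zero hpoly_polarize_diag polarize_comm tau_hom tau_hpoly tau_tau tau_polarize)

section \<open>The ideal of quasi-invariants\<close>

text \<open>The sum of \<open>f\<^sub>1(j\<^sub>1) \<cdots> f\<^sub>k(j\<^sub>k)\<close> over \<open>p > j\<^sub>1 > \<cdots> > j\<^sub>k\<close>: columns are listed from right to left.\<close>

fun monomial_sum :: "nat \<Rightarrow> (nat \<Rightarrow> 'a::comm_ring_1) list \<Rightarrow> 'a" where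
  "monomial_sum p [] = 1"
| "monomial_sum 0 (f # fs) = 0"
| "monomial_sum (Suc p) (f # fs) = f p * monomial_sum p fs + monomial_sum p (f # fs)"

definition colexp :: "(nat \<Rightarrow>\<^sub>0 nat) \<Rightarrow> nat \<Rightarrow> expo" where
  "colexp \<alpha> j = (\<Sum>i\<in>Poly_Mapping.keys \<alpha>. sgl (i, j) (lk \<alpha> i))"

lemma lookup_colexp: "lk (colexp \<alpha> j) (i, j') = (if j' = j then lk \<alpha> i else 0)"
proof -
  have "lk (colexp \<alpha> j) (i, j') = (\<Sum>i'\<in>Poly_Mapping.keys \<alpha>. if i' = i then (if j' = j then lk \<alpha> i else 0) else 0)"
    unfolding colexp_def lookup_sum by (intro sum.cong refl) (auto simp: lookup_single when_def)
  then show ?thesis by (simp add: in_keys_iff)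
qed

lemma colexp_add: "colexp (\<alpha> + \<beta>) j = colexp \<alpha> j + colexp \<beta> j"
  by (rule poly_mapping_eqI) (auto simp: lookup_colexp lookup_add split_paired_all)

definition colmon :: "(nat \<Rightarrow>\<^sub>0 nat) \<Rightarrow> nat \<Rightarrow> mpoly" where
  "colmon \<alpha> j = sgl (colexp \<alpha> j) 1"

lemma colmon_add: "colmon (\<alpha> + \<beta>) j = colmon \<alpha> j * colmon \<beta> j"
  by (simp add: colmon_def colexp_add mult_single)

lemma colmon_0 [simp]: "colmon 0 j = 1"
  by (simp add: colmon_def colexp_def)

lemma has_wt_colexp: "j < n \<Longrightarrow> has_wt n \<alpha> (colexp \<alpha> j)"
  by (auto simp: has_wt_def lookup_colexp)

lemma colmon_hpoly: "j < n \<Longrightarrow> colmon \<alpha> j \<in> hpoly n \<alpha>"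
  unfolding colmon_def by (intro hpoly_single has_wt_colexp)

lemma monomial_sum_hpoly: "p \<le> n \<Longrightarrow> monomial_sum p (map colmon as) \<in> hpoly n (sum_list as)"
proof (induction p "map colmon as" arbitrary: as rule: monomial_sum.induct)
  case (1 p)
  then show ?case using hpoly_pconst[of 1 n] by simp
next
  case (2 f fs)
  then show ?case by (metis monomial_sum.simps(2) hpoly_0)
next
  case (3 p f fs)
  from 3(3) obtain \<alpha> as' where as: "as = \<alpha> # as'" "f = colmon \<alpha>" "fs = map colmon as'" by (cases as) auto
  have "monomial_sum p (map colmon as') \<in> hpoly n (sum_list as')" using 3(1)[OF as(3)] 3(4) by simp
  moreover have "monomial_sum p (map colmon as) \<in> hpoly n (sum_list as)" using 3(2)[OF 3(3)] 3(3,4) by simp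
  ultimately show ?case using hpoly_mult[OF colmon_hpoly[of p n \<alpha>]] 3(4) as by (simp add: hpoly_add)
qed

section \<open>Column sums and the homogeneous components of the ideal\<close>

definition total_degree :: "(nat \<Rightarrow>\<^sub>0 nat) \<Rightarrow> nat" where
  "total_degree \<alpha> = (\<Sum>i\<in>Poly_Mapping.keys \<alpha>. lk \<alpha> i)"

lemma total_degree_superset: "finite A \<Longrightarrow> Poly_Mapping.keys \<alpha> \<subseteq> A \<Longrightarrow> total_degree \<alpha> = (\<Sum>i\<in>A. lk \<alpha> i)"
  unfolding total_degree_def by (rule sum.mono_neutral_left) (auto simp: in_keys_iff)

lemma total_degree_add: "total_degree (\<alpha> + \<beta>) = total_degree \<alpha> + total_degree \<beta>"
proof -
  let ?A = "Poly_Mapping.keys \<alpha> \<union> Poly_Mapping.keys \<beta>"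
  have "Poly_Mapping.keys (\<alpha> + \<beta>) \<subseteq> ?A" by (rule keys_add)
  then show ?thesis using total_degree_superset[of ?A] by (simp add: lookup_add sum.distrib)
qed

lemma total_degree_single [simp]: "total_degree (sgl i c) = c"
  using total_degree_superset[of "{i}" "sgl i c"] by simp

lemma total_degree_0 [simp]: "total_degree 0 = 0"
  by (simp add: total_degree_def)

lemma total_degree_sum_list: "total_degree (sum_list as) = sum_list (map total_degree as)"
  by (induction as) (simp_all add: total_degree_add)

lemma swap_wt_add: "swap_wt p q (\<alpha> + \<beta>) = swap_wt p q \<alpha> + swap_wt p q \<beta>"
  by (rule poly_mapping_eqI) (simp add: lookup_swap_wt lookup_add)

lemma swap_wt_0 [simp]: "swap_wt p q 0 = 0"
  by (rule poly_mapping_eqI) (simp add: lookup_swap_wt)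

lemma swap_wt_sum_list: "swap_wt p q (sum_list as) = sum_list (map (swap_wt p q) as)"
  by (induction as) (simp_all add: swap_wt_add)

lemma swap_wt_single: "swap_wt p q (sgl i c) = sgl (Transposition.transpose p q i) c"
  by (rule poly_mapping_eqI) (auto simp: lookup_swap_wt lookup_single when_def transpose_eq_iff)

lemma total_degree_swap_wt: "total_degree (swap_wt p q \<alpha>) = total_degree \<alpha>"
  by (induction \<alpha> rule: pm_induct) (simp_all add: swap_wt_single swap_wt_add total_degree_add)

text \<open>The columns of an \<open>r\<close>-composition-matrix, without the bound
  \<open>n\<close> on their number: by \<open>monomial_sum_long\<close> longer lists give the zero
  polynomial.\<close>

definition good_columns :: "nat \<Rightarrow> (nat \<Rightarrow>\<^sub>0 nat) list \<Rightarrow> bool" where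
  "good_columns r as \<longleftrightarrow> as \<noteq> [] \<and> (\<forall>\<alpha>\<in>set as. total_degree \<alpha> \<noteq> 0 \<and> r dvd total_degree \<alpha>)"

text \<open>The degree \<open>d\<close> component of the ideal as a span of monomial multiples of
  generators, with no reference to \<open>l\<close>. The identification with \<open>J_W\<close> is
  \<open>J_W_hpoly\<close>.\<close>

definition hideal :: "nat \<Rightarrow> nat \<Rightarrow> (nat \<Rightarrow>\<^sub>0 nat) \<Rightarrow> mpoly set" where
  "hideal n r d = Q.span {sgl m 1 * monomial_sum n (map colmon as) | m as e. has_wt n e m \<and> good_columns r as \<and> e + sum_list as = d}"

lemma subspace_hideal: "Q.subspace (hideal n r d)"
  unfolding hideal_def by (rule Q.subspace_span)

lemma hideal_hpoly: "hideal n r d \<subseteq> hpoly n d"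
  unfolding hideal_def
proof (rule Q.span_minimal[OF _ subspace_hpoly], safe)
  fix m as e assume "has_wt n e m"
  then show "sgl m 1 * monomial_sum n (map colmon as) \<in> hpoly n (e + sum_list as)"
    by (intro hpoly_mult hpoly_single monomial_sum_hpoly) auto
qed

lemma hideal_mult:
  assumes p: "p \<in> hpoly n e" and "good_columns r as" "e + sum_list as = d"
  shows "p * monomial_sum n (map colmon as) \<in> hideal n r d"
proof -
  have "(\<Sum>m\<in>Poly_Mapping.keys p. qscale (lk p m) (sgl m 1 * monomial_sum n (map colmon as))) \<in> hideal n r d"
    unfolding hideal_def using assms by (intro Q.span_sum Q.span_scale Q.span_base) (auto simp: hpoly_def)
  also have "(\<Sum>m\<in>Poly_Mapping.keys p. qscale (lk p m) (sgl m 1 * monomial_sum n (map colmon as))) =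
      (\<Sum>m\<in>Poly_Mapping.keys p. sgl m (lk p m)) * monomial_sum n (map colmon as)"
    unfolding sum_distrib_right by (intro sum.cong refl) (simp add: qscale_def pconst_def mult_single flip: mult.assoc)
  also have "\<dots> = p * monomial_sum n (map colmon as)" by (simp flip: pm_expand)
  finally show ?thesis .
qed

lemma polarize_colmon: "j < n \<Longrightarrow> polarize n a b (colmon \<alpha> j) = of_nat (lk \<alpha> b) * colmon (\<alpha> - sgl b 1 + sgl a 1) j"
proof -
  assume j: "j < n"
  have "pvar (a, k) * partial_deriv (b, k) (colmon \<alpha> j) = (if k = j then of_nat (lk \<alpha> b) * colmon (\<alpha> - sgl b 1 + sgl a 1) j else 0)"
    for k
  proof (cases "k = j \<and> lk \<alpha> b \<noteq> 0")
    case True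
    have "sgl (a, j) 1 + (colexp \<alpha> j - sgl (b, j) 1) = colexp (\<alpha> - sgl b 1 + sgl a 1) j"
      by (rule poly_mapping_eqI)
        (auto simp: split_paired_all lookup_add lookup_minus lookup_colexp lookup_single when_def)
    then show ?thesis using True
      by (simp add: colmon_def pvar_def partial_deriv_single mult_single lookup_colexp of_nat_times_sgl)
  qed (auto simp: colmon_def partial_deriv_single lookup_colexp)
  then show ?thesis using j by (simp add: polarize_def)
qed


text \<open>A derivation acts on one factor at a time, and a polarized column monomial is a multiple
  of a monomial in the same column.\<close>

lemma polarize_monomial_sum:
  "p \<le> n \<Longrightarrow> polarize n a b (monomial_sum p (map colmon as)) =
    (\<Sum>k<length as. of_nat (lk (as ! k) b) * monomial_sum p (map colmon (as[k := as ! k - sgl b 1 + sgl a 1])))"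
proof (induction p "map colmon as" arbitrary: as rule: monomial_sum.induct)
  case (1 p)
  then show ?case by simp
next
  case (2 f fs)
  from 2(1) obtain \<alpha> as' where as: "as = \<alpha> # as'" by (cases as) auto
  have "monomial_sum 0 (map colmon (as[k := \<beta>])) = 0" for k \<beta> by (cases k) (simp_all add: as)
  then show ?case using 2 by (simp flip: 2(1))
next
  case (3 p f fs)
  from 3(3) obtain \<alpha> as' where as: "as = \<alpha> # as'" "f = colmon \<alpha>" "fs = map colmon as'" by (cases as) auto
  let ?u = "\<lambda>\<alpha>. \<alpha> - sgl b 1 + sgl a 1"
  have 1: "polarize n a b (monomial_sum p (map colmon as')) =
    (\<Sum>k<length as'. of_nat (lk (as' ! k) b) * monomial_sum p (map colmon (as'[k := ?u (as' ! k)])))"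
    using 3(1)[OF as(3)] 3(4) by simp
  have 2: "polarize n a b (monomial_sum p (map colmon as)) =
    (\<Sum>k<length as. of_nat (lk (as ! k) b) * monomial_sum p (map colmon (as[k := ?u (as ! k)])))"
    using 3(2)[OF 3(3)] 3(3,4) by simp
  have "polarize n a b (monomial_sum (Suc p) (map colmon as)) =
    of_nat (lk \<alpha> b) * colmon (?u \<alpha>) p * monomial_sum p (map colmon as') + colmon \<alpha> p * polarize n a b (monomial_sum p (map colmon as'))
     + polarize n a b (monomial_sum p (map colmon as))"
    using 3(4) by (simp add: as polarize_add polarize_mult polarize_colmon)
  then show ?case
    unfolding 1 2 by (simp add: as sum.lessThan_Suc_shift sum_distrib_left sum.distrib algebra_simps del: sum.lessThan_Suc)
qed

lemma sum_list_update_add: "k < length xs \<Longrightarrow> sum_list (xs[k := y]) + xs ! k = sum_list xs + (y :: 'a::comm_monoid_add)"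
  by (induction xs arbitrary: k) (auto simp: add_ac split: nat.split)

text \<open>Polarization moves a unit from row \<open>b\<close> to row \<open>a\<close> inside one
  column. Column sums are unchanged, so generators go to combinations of generators.\<close>

lemma hideal_polarize: "f \<in> hideal n r (d + sgl b 1) \<Longrightarrow> polarize n a b f \<in> hideal n r (d + sgl a 1)"
proof -
  let ?G = "{sgl m 1 * monomial_sum n (map colmon as) | m as e. has_wt n e m \<and> good_columns r as \<and> e + sum_list as = d + sgl b 1}"
  assume "f \<in> hideal n r (d + sgl b 1)"
  then have "f \<in> Q.span ?G" by (simp add: hideal_def)
  then show ?thesis
  proof (induction f rule: Q.span_induct_alt)
    case base
    then show ?case by (simp add: Q.subspace_0 subspace_hideal)
  next
    case (step c x y)
    then obtain m as e where x: "x = sgl m 1 * monomial_sum n (map colmon as)" and m: "has_wt n e m" and as: "good_columns r as"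
      and e: "e + sum_list as = d + sgl b 1" by blast
    have 1: "polarize n a b (sgl m 1) * monomial_sum n (map colmon as) \<in> hideal n r (d + sgl a 1)"
    proof (cases "lk e b = 0")
      case True
      then have "polarize n a b (sgl m 1) = 0" using hpoly_polarize_zero[OF hpoly_single[OF m]] by simp
      then show ?thesis by (simp add: Q.subspace_0 subspace_hideal)
    next
      case False
      then obtain e0 where e0: "e = e0 + sgl b 1" using wt_split[OF False] by blast
      have "polarize n a b (sgl m 1) \<in> hpoly n (e0 + sgl a 1)" using m e0 by (intro hpoly_polarize hpoly_single) simp
      moreover have "(e0 + sum_list as) + sgl b 1 = d + sgl b 1" using e e0 by (simp add: add_ac)
      then have "e0 + sum_list as = d" by (simp only: add_right_cancel)
      then have "e0 + sgl a 1 + sum_list as = d + sgl a 1" by (simp add: add_ac flip: \<open>e0 + sum_list as = d\<close>)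
      ultimately show ?thesis using as by (intro hideal_mult)
    qed
    have 2: "sgl m 1 * (of_nat (lk (as ! k) b) * monomial_sum n (map colmon (as[k := as ! k - sgl b 1 + sgl a 1]))) \<in> hideal n r (d + sgl a 1)"
      if k: "k < length as" for k
    proof (cases "lk (as ! k) b = 0")
      case True
      then show ?thesis by (simp add: Q.subspace_0 subspace_hideal)
    next
      case False
      then obtain \<alpha> where \<alpha>: "as ! k = \<alpha> + sgl b 1" using wt_split[OF False] by blast
      let ?as = "as[k := \<alpha> + sgl a 1]"
      have "good_columns r ?as"
        using as k nth_mem[OF k] set_update_subset_insert[of as k "\<alpha> + sgl a 1"] \<alpha> unfolding good_columns_def
        by (force simp: total_degree_add)
      moreover have "(e + sum_list ?as) + (\<alpha> + sgl b 1) = (d + sgl a 1) + (\<alpha> + sgl b 1)"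
        using sum_list_update_add[OF k, of "\<alpha> + sgl a 1"] e \<alpha>
        by (metis (no_types, lifting) add.assoc add.commute add.left_commute)
      then have "e + sum_list ?as = d + sgl a 1" by (simp only: add_right_cancel)
      ultimately have "sgl m (of_nat (lk (as ! k) b)) * monomial_sum n (map colmon ?as) \<in> hideal n r (d + sgl a 1)"
        using m by (intro hideal_mult hpoly_single)
      moreover have "sgl m (of_nat (lk (as ! k) b) :: rat) = sgl m 1 * of_nat (lk (as ! k) b)"
      proof -
        have "sgl m (1::rat) * of_nat (lk (as ! k) b) = of_nat (lk (as ! k) b) * sgl m 1" by (rule mult.commute)
        also have "\<dots> = sgl m (of_nat (lk (as ! k) b) * 1)" by (rule of_nat_times_sgl)
        finally show ?thesis by simp
      qed
      ultimately show ?thesis using \<alpha> by (simp add: mult.assoc)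
    qed
    have "polarize n a b x \<in> hideal n r (d + sgl a 1)"
      unfolding x polarize_mult polarize_monomial_sum[OF order_refl] sum_distrib_left
      using 1 2 by (intro Q.subspace_add Q.subspace_sum subspace_hideal) auto
    then show ?case using step(2)
      by (simp add: polarize_add polarize_scale Q.subspace_add Q.subspace_scale subspace_hideal)
  qed
qed

lemma tau_colmon: "tau p q (colmon \<alpha> j) = colmon (swap_wt p q \<alpha>) j"
proof -
  have "tau_expo p q (colexp \<alpha> j) = colexp (swap_wt p q \<alpha>) j"
    by (rule poly_mapping_eqI) (auto simp: split_paired_all lookup_tau_expo swap_rows_def lookup_colexp lookup_swap_wt)
  then show ?thesis by (simp add: colmon_def tau_single)
qed

lemma tau_monomial_sum: "tau p q (monomial_sum k (map colmon as)) = monomial_sum k (map colmon (map (swap_wt p q) as))"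
proof (induction k "map colmon as" arbitrary: as rule: monomial_sum.induct)
  case (1 p)
  then show ?case by simp
next
  case (2 f fs)
  then show ?case by (cases as) auto
next
  case (3 k f fs)
  from 3(3) obtain \<alpha> as' where as: "as = \<alpha> # as'" "f = colmon \<alpha>" "fs = map colmon as'" by (cases as) auto
  show ?case using 3(1)[OF as(3)] 3(2)[OF 3(3)] 3(3) by (simp add: as tau_add tau_mult tau_colmon)
qed

lemma hideal_tau: "f \<in> hideal n r d \<Longrightarrow> tau p q f \<in> hideal n r (swap_wt p q d)"
proof -
  let ?G = "{sgl m 1 * monomial_sum n (map colmon as) | m as e. has_wt n e m \<and> good_columns r as \<and> e + sum_list as = d}"
  assume "f \<in> hideal n r d"
  then have "f \<in> Q.span ?G" by (simp add: hideal_def)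
  then show ?thesis
  proof (induction f rule: Q.span_induct_alt)
    case base
    then show ?case by (simp add: Q.subspace_0 subspace_hideal)
  next
    case (step c x y)
    then obtain m as e where x: "x = sgl m 1 * monomial_sum n (map colmon as)" and m: "has_wt n e m" and as: "good_columns r as"
      and e: "e + sum_list as = d" by blast
    have "tau p q (sgl m 1) * monomial_sum n (map colmon (map (swap_wt p q) as)) \<in> hideal n r (swap_wt p q d)"
    proof (rule hideal_mult)
      show "tau p q (sgl m 1) \<in> hpoly n (swap_wt p q e)" by (intro tau_hpoly hpoly_single m)
      show "good_columns r (map (swap_wt p q) as)" using as by (simp add: good_columns_def total_degree_swap_wt)
      show "swap_wt p q e + sum_list (map (swap_wt p q) as) = swap_wt p q d"
        using e by (simp add: swap_wt_add swap_wt_sum_list flip: e)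
    qed
    then have "tau p q x \<in> hideal n r (swap_wt p q d)" by (simp add: x tau_mult tau_monomial_sum)
    then show ?case using step(2)
      using module_hom.scale[OF tau_hom, of p q c x]
      by (simp add: tau_add Q.subspace_add Q.subspace_scale subspace_hideal)
  qed
qed

interpretation hideal: gl_family qscale "polarize n" tau "hideal n r" for n r
proof (intro gl_family.intro gl_family_axioms.intro Q.trace_space_axioms subspace_hideal polarize_hom hideal_polarize polarize_comm
    tau_hom hideal_tau tau_tau tau_polarize)
  show "Q.fin_spanned (hideal n r d)" for d
    using fin_spanned_hpoly hideal_hpoly unfolding Q.fin_spanned_def by (meson subset_trans)
qed (use hideal_hpoly hpoly_polarize_zero hpoly_polarize_diag in blast)+

text \<open>Only the identity permutation produces the diagonal monomial, so its coefficient is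
  1.\<close>

lemma det_generic_nonzero: "det (mat n n (\<lambda>(i, j). pvar (i, j) :: mpoly)) \<noteq> 0"
proof
  let ?X = "mat n n (\<lambda>(i, j). pvar (i, j) :: mpoly)"
  let ?D = "\<lambda>p. \<Sum>i<n. sgl (i, p i) (1::nat)"
  assume z: "det ?X = 0"
  have tm: "of_int (sign p) * (\<Prod>i = 0..<n. ?X $$ (i, p i)) = sgl (?D p) (of_int (sign p))" if p: "p permutes {0..<n}" for p
  proof -
    have "(\<Prod>i = 0..<n. ?X $$ (i, p i)) = (\<Prod>i<n. pvar (i, p i))"
    proof (rule prod.cong)
      fix i assume "i \<in> {..<n}"
      then have "i < n" "p i < n" using permutes_in_image[OF p, of i] by simp_all
      then show "?X $$ (i, p i) = pvar (i, p i)" by simp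
    qed auto
    then show ?thesis by (simp add: pvar_def prod_sgl_one of_int_times_sgl)
  qed
  have "det ?X = (\<Sum>p | p permutes {0..<n}. of_int (sign p) * (\<Prod>i = 0..<n. ?X $$ (i, p i)))"
    by (simp add: det_def)
  also have "\<dots> = (\<Sum>p | p permutes {0..<n}. sgl (?D p) (of_int (sign p)))"
    by (intro sum.cong refl) (simp only: tm mem_Collect_eq)
  finally have "lk (det ?X) (?D id) = (\<Sum>p | p permutes {0..<n}. if ?D p = ?D id then of_int (sign p) else 0)"
    by (simp add: lookup_sum lookup_single when_def)
  also have "\<dots> = (\<Sum>p | p permutes {0..<n}. if p = id then 1 else 0)"
  proof (intro sum.cong refl)
    fix p assume "p \<in> {p. p permutes {0..<n}}"
    then have p: "p permutes {0..<n}" by simp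
    have "p = id" if eq: "?D p = ?D id"
    proof
      fix i
      show "p i = id i"
      proof (cases "i < n")
        case True
        have row: "lk (?D q) (i, i) = (if q i = i then 1 else 0)" for q
        proof -
          have "lk (?D q) (i, i) = (\<Sum>k<n. if k = i then (if q i = i then 1 else 0) else 0)"
            unfolding lookup_sum by (intro sum.cong refl) (auto simp: lookup_single when_def)
          then show ?thesis using True by simp
        qed
        have "lk (?D p) (i, i) = lk (?D id) (i, i)" by (simp only: eq)
        then show ?thesis unfolding row by (simp split: if_splits)
      next
        case False
        then show ?thesis using permutes_not_in[OF p, of i] by simp
      qed
    qed
    then show "(if ?D p = ?D id then of_int (sign p) else 0) = (if p = id then 1 else (0::rat))" by auto
  qed
  also have "\<dots> = 1" by (subst sum.delta) (simp_all add: finite_permutations permutes_id)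
  finally show False using z by simp
qed

text \<open>The hypotheses are a linear system for the derivatives by the variables of row \<open>n\<close>, and its
  matrix is the generic \<open>n \<times> n\<close> matrix.\<close>

lemma hpoly_highest_long:
  assumes p: "p \<in> hpoly n d" and ne: "lk d n \<noteq> 0" and hw: "\<And>a. a < n \<Longrightarrow> polarize n a n p = 0"
  shows "p = 0"
proof -
  define X where "X = mat n n (\<lambda>(i, j). pvar (i, j) :: mpoly)"
  define g where "g j = partial_deriv (n, j) p" for j
  have X: "X \<in> carrier_mat n n" by (simp add: X_def)
  have lin: "(\<Sum>j<n. X $$ (a, j) * g j) = 0" if "a < n" for a
    using hw[OF that] that by (simp add: polarize_def X_def g_def)
  have "g j = 0" if j: "j < n" for j
  proof -
    \<comment> \<open>Multiplying the system by the adjugate gives \<open>det X * g j = 0\<close>,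
      and the polynomial ring has no zero divisors.\<close>
    have adj: "(\<Sum>a<n. adj_mat X $$ (j, a) * X $$ (a, k)) = (if j = k then det X else 0)" if "k < n" for k
    proof -
      have "(adj_mat X * X) $$ (j, k) = (\<Sum>a<n. adj_mat X $$ (j, a) * X $$ (a, k))"
        using adj_mat(1)[OF X] X that j by (simp add: scalar_prod_def lessThan_atLeast0)
      then show ?thesis using adj_mat(3)[OF X] that j by (auto split: if_splits)
    qed
    have "0 = (\<Sum>a<n. adj_mat X $$ (j, a) * (\<Sum>k<n. X $$ (a, k) * g k))" using lin by simp
    also have "\<dots> = (\<Sum>a<n. \<Sum>k<n. adj_mat X $$ (j, a) * X $$ (a, k) * g k)"
      by (simp add: sum_distrib_left mult.assoc)
    also have "\<dots> = (\<Sum>k<n. (\<Sum>a<n. adj_mat X $$ (j, a) * X $$ (a, k)) * g k)"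
      by (subst sum.swap) (simp add: sum_distrib_right)
    also have "\<dots> = (\<Sum>k<n. if j = k then det X * g j else 0)"
      by (intro sum.cong refl) (simp add: adj)
    also have "\<dots> = det X * g j" using j by simp
    finally show ?thesis using det_generic_nonzero[of n] by (simp add: X_def)
  qed
  \<comment> \<open>All derivatives by variables of row \<open>n\<close> vanish, yet by Euler's
    identity this operator multiplies \<open>p\<close> by its degree in that row.\<close>
  then have "polarize n n n p = 0" by (simp add: polarize_def g_def)
  then have "qscale (of_nat (lk d n)) p = 0" using hpoly_polarize_diag[OF p, of n] by simp
  then show ?thesis using ne by simp
qed

section \<open>The degree bound\<close>

lemma hideal_times: "p \<in> hpoly n e \<Longrightarrow> f \<in> hideal n r d \<Longrightarrow> p * f \<in> hideal n r (e + d)"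
proof -
  let ?G = "{sgl m 1 * monomial_sum n (map colmon as) | m as e. has_wt n e m \<and> good_columns r as \<and> e + sum_list as = d}"
  assume p: "p \<in> hpoly n e" and "f \<in> hideal n r d"
  then have "f \<in> Q.span ?G" by (simp add: hideal_def)
  then show ?thesis
  proof (induction f rule: Q.span_induct_alt)
    case base
    then show ?case by (simp add: Q.subspace_0 subspace_hideal)
  next
    case (step c x y)
    then obtain m as e' where x: "x = sgl m 1 * monomial_sum n (map colmon as)" and m: "has_wt n e' m" and as: "good_columns r as"
      and e': "e' + sum_list as = d" by blast
    have "p * sgl m 1 * monomial_sum n (map colmon as) \<in> hideal n r (e + d)"
      by (rule hideal_mult[OF hpoly_mult[OF p hpoly_single[OF m]] as]) (simp add: add.assoc e')
    then have "p * x \<in> hideal n r (e + d)" by (simp add: x mult.assoc)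
    moreover have "p * (qscale c x + y) = qscale c (p * x) + p * y"
      by (simp add: qscale_def algebra_simps)
    ultimately show ?case using step(2) by (simp add: Q.subspace_add Q.subspace_scale subspace_hideal)
  qed
qed

section \<open>Supports of polynomials and degrees of columns\<close>

definition supported_on :: "('v \<Rightarrow> bool) \<Rightarrow> ('v \<Rightarrow>\<^sub>0 'a::zero) set" where
  "supported_on Q = {f. \<forall>m\<in>Poly_Mapping.keys f. Q m}"

lemma supported_on_0 [simp]: "0 \<in> supported_on Q" by (simp add: supported_on_def)
lemma supported_on_single: "Q m \<Longrightarrow> sgl m c \<in> supported_on Q" by (simp add: supported_on_def)
lemma supported_on_add: "f \<in> supported_on Q \<Longrightarrow> g \<in> supported_on Q \<Longrightarrow> f + g \<in> supported_on Q"
  unfolding supported_on_def using keys_add[of f g] by blast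
lemma supported_on_diff: "f \<in> supported_on Q \<Longrightarrow> g \<in> supported_on Q \<Longrightarrow> f - g \<in> supported_on (Q :: 'v \<Rightarrow> bool)"
  for f g :: "'v \<Rightarrow>\<^sub>0 'a::ab_group_add"
proof -
  assume fg: "f \<in> supported_on Q" "g \<in> supported_on Q"
  have "Poly_Mapping.keys (f - g) \<subseteq> Poly_Mapping.keys f \<union> Poly_Mapping.keys g"
    by (auto simp: in_keys_iff lookup_minus)
  then show ?thesis using fg unfolding supported_on_def by blast
qed
lemma supported_on_mult:
  assumes "f \<in> supported_on P" "g \<in> supported_on Q" "\<And>m k. P m \<Longrightarrow> Q k \<Longrightarrow> R (m + k)"
  shows "f * g \<in> supported_on R"
  using assms keys_mult[of f g] unfolding supported_on_def by fastforce
lemma supported_on_mono: "f \<in> supported_on P \<Longrightarrow> (\<And>m. P m \<Longrightarrow> Q m) \<Longrightarrow> f \<in> supported_on Q"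
  by (auto simp: supported_on_def)

lemma hpoly_supported_on: "hpoly n d = supported_on (has_wt n d)" by (simp add: hpoly_def supported_on_def)

definition colpart :: "expo \<Rightarrow> nat \<Rightarrow> nat \<Rightarrow>\<^sub>0 nat" where
  "colpart m j = Poly_Mapping.map_key (\<lambda>i. (i, j)) m"

lemma lookup_colpart: "lk (colpart m j) i = lk m (i, j)"
  by (simp add: colpart_def map_key.rep_eq inj_on_def)

definition coldeg :: "expo \<Rightarrow> nat \<Rightarrow> nat" where "coldeg m j = total_degree (colpart m j)"

lemma coldeg_add: "coldeg (m + k) j = coldeg m j + coldeg k j"
proof -
  have "colpart (m + k) j = colpart m j + colpart k j"
    by (rule poly_mapping_eqI) (simp add: lookup_colpart lookup_add)
  then show ?thesis by (simp add: coldeg_def total_degree_add)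
qed

lemma coldeg_colexp: "coldeg (colexp \<alpha> j) j' = (if j' = j then total_degree \<alpha> else 0)"
proof -
  have "colpart (colexp \<alpha> j) j' = (if j' = j then \<alpha> else 0)"
    by (rule poly_mapping_eqI) (simp add: lookup_colpart lookup_colexp)
  then show ?thesis by (simp add: coldeg_def)
qed

lemma coldeg_0 [simp]: "coldeg 0 j = 0"
  using coldeg_add[of 0 0 j] by simp

lemma coldeg_sum: "coldeg (\<Sum>i\<in>I. f i) j = (\<Sum>i\<in>I. coldeg (f i) j)"
  by (induction I rule: infinite_finite_induct) (simp_all add: coldeg_add)

lemma has_wt_sum: "(\<And>i. i \<in> I \<Longrightarrow> has_wt n (d i) (f i)) \<Longrightarrow> has_wt n (\<Sum>i\<in>I. d i) (\<Sum>i\<in>I. f i)"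
  by (induction I rule: infinite_finite_induct) (simp_all add: has_wt_add has_wt_0)

lemma expo_colparts: "has_wt n d m \<Longrightarrow> m = (\<Sum>j<n. colexp (colpart m j) j)"
proof (rule poly_mapping_eqI)
  fix x :: "nat \<times> nat" assume m: "has_wt n d m"
  obtain i j where x: "x = (i, j)" by (cases x)
  show "lk m x = lk (\<Sum>j<n. colexp (colpart m j) j) x"
    using m by (auto simp: x lookup_sum lookup_colexp lookup_colpart has_wt_def)
qed

lemma sum_coldeg: "has_wt n d m \<Longrightarrow> (\<Sum>j<n. coldeg m j) = total_degree d"
proof -
  assume m: "has_wt n d m"
  have "has_wt n (\<Sum>j<n. colpart m j) (\<Sum>j<n. colexp (colpart m j) j)"
    by (intro has_wt_sum has_wt_colexp) auto
  then have "d = (\<Sum>j<n. colpart m j)" using m expo_colparts[OF m] has_wt_unique by metis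
  moreover have "total_degree (\<Sum>j\<in>A. colpart m j) = (\<Sum>j\<in>A. coldeg m j)" for A
    by (induction A rule: infinite_finite_induct) (simp_all add: total_degree_add coldeg_def)
  ultimately show ?thesis by simp
qed

text \<open>
  The analogue of Gessel's fundamental quasisymmetric functions for words in column monomials:
  inside a block columns decrease weakly, between blocks they decrease strictly.
\<close>

fun fundamental_sum :: "nat \<Rightarrow> (nat \<Rightarrow>\<^sub>0 nat) list list \<Rightarrow> mpoly" where
  "fundamental_sum p [] = 1"
| "fundamental_sum 0 (a # v) = 0"
| "fundamental_sum (Suc p) ([] # v) = fundamental_sum p v"
| "fundamental_sum (Suc p) ((x # a) # v) = colmon x p * fundamental_sum (Suc p) (a # v) + fundamental_sum p ((x # a) # v)"

lemma fundamental_sum_singletons: "fundamental_sum p (map (\<lambda>x. [x]) as) = monomial_sum p (map colmon as)"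
proof (induction p arbitrary: as)
  case 0
  then show ?case by (cases as) auto
next
  case (Suc p)
  show ?case
  proof (cases as)
    case (Cons x as')
    have "fundamental_sum (Suc p) (map (\<lambda>x. [x]) as) = colmon x p * fundamental_sum p (map (\<lambda>x. [x]) as') + fundamental_sum p (map (\<lambda>x. [x]) as)"
      by (simp add: Cons)
    also have "\<dots> = monomial_sum (Suc p) (map colmon as)" unfolding Suc.IH by (simp add: Cons)
    finally show ?thesis .
  qed simp
qed

text \<open>If \<open>x\<close> and \<open>y\<close> are placed in different columns,
  \<open>x\<close> might as well be a block of its own; if they share a column, they act as the
  single letter \<open>x + y\<close>.\<close>

lemma fundamental_sum_merge:
  "fundamental_sum p (map (\<lambda>x. [x]) as @ (x # y # a) # v) =
    fundamental_sum p (map (\<lambda>x. [x]) as @ [x] # (y # a) # v) + fundamental_sum p (map (\<lambda>x. [x]) as @ ((x + y) # a) # v)"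
proof (induction p arbitrary: as)
  case 0
  show ?case by (cases as) auto
next
  case (Suc p)
  show ?case
  proof (cases as)
    case Nil
    show ?thesis using Suc[of "[]"] by (simp add: Nil colmon_add algebra_simps)
  next
    case (Cons z as')
    show ?thesis using Suc[of as] Suc[of as'] by (simp add: Cons algebra_simps)
  qed
qed

definition block_weight :: "(nat \<Rightarrow>\<^sub>0 nat) list list \<Rightarrow> nat \<Rightarrow>\<^sub>0 nat" where
  "block_weight v = sum_list (map sum_list v)"

lemma block_weight_simps [simp]: "block_weight [] = 0" "block_weight (a # v) = sum_list a + block_weight v"
  by (simp_all add: block_weight_def)

text \<open>Repeated merging ends with singleton blocks, that is with generators, because sums of
  letters again have nonzero degree divisible by \<open>r\<close>. Each step leaves one letter less
  in \<open>v\<close>.\<close>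

lemma fundamental_sum_hideal_aux:
  assumes "\<forall>x\<in>set as. total_degree x \<noteq> 0 \<and> r dvd total_degree x" "\<forall>a\<in>set v. a \<noteq> [] \<and> (\<forall>x\<in>set a. total_degree x \<noteq> 0 \<and> r dvd total_degree x)" "as \<noteq> [] \<or> v \<noteq> []"
  shows "fundamental_sum n (map (\<lambda>x. [x]) as @ v) \<in> hideal n r (sum_list as + block_weight v)"
  using assms
proof (induction "sum_list (map length v)" arbitrary: as v rule: less_induct)
  case less
  show ?case
  proof (cases v)
    case Nil
    then have "good_columns r as" using less.prems by (simp add: good_columns_def)
    then show ?thesis using hideal_mult[OF hpoly_pconst[of 1 n], of r as "sum_list as"] by (simp add: Nil fundamental_sum_singletons)
  next
    case (Cons b v')
    then obtain x a where b: "b = x # a" using less.prems(2) by (cases b) auto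
    show ?thesis
    proof (cases a)
      case Nil
      have "fundamental_sum n (map (\<lambda>x. [x]) (as @ [x]) @ v') \<in> hideal n r (sum_list (as @ [x]) + block_weight v')"
        by (rule less.hyps) (use less.prems in \<open>auto simp: Cons b\<close>)
      then show ?thesis by (simp add: Cons b Nil add.assoc)
    next
      case (Cons y a')
      have "fundamental_sum n (map (\<lambda>x. [x]) (as @ [x]) @ (y # a') # v') \<in> hideal n r (sum_list (as @ [x]) + block_weight ((y # a') # v'))"
        by (rule less.hyps) (use less.prems in \<open>auto simp: \<open>v = b # v'\<close> b Cons\<close>)
      moreover have "fundamental_sum n (map (\<lambda>x. [x]) as @ ((x + y) # a') # v') \<in> hideal n r (sum_list as + block_weight (((x + y) # a') # v'))"
        by (rule less.hyps) (use less.prems in \<open>auto simp: \<open>v = b # v'\<close> b Cons total_degree_add\<close>)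
      ultimately show ?thesis
        using Q.subspace_add[OF subspace_hideal] by (simp add: \<open>v = b # v'\<close> b Cons fundamental_sum_merge add.assoc)
    qed
  qed
qed

lemma fundamental_sum_hideal:
  assumes "r \<noteq> 0" "v \<noteq> []" "\<forall>a\<in>set v. a \<noteq> [] \<and> (\<forall>x\<in>set a. total_degree x = r)"
  shows "fundamental_sum n v \<in> hideal n r (block_weight v)"
  using fundamental_sum_hideal_aux[of "[]" r v n] assms by auto

lemma colmon_supported_on: "j < n \<Longrightarrow> colmon x j \<in> supported_on (\<lambda>m. has_wt n x m \<and> (\<forall>k. coldeg m k = (if k = j then total_degree x else 0)))"
  unfolding colmon_def by (intro supported_on_single) (simp add: has_wt_colexp coldeg_colexp)

lemma fundamental_sum_supported_on: "p \<le> n \<Longrightarrow> fundamental_sum p v \<in> supported_on (\<lambda>m. has_wt n (block_weight v) m \<and> (\<forall>j\<ge>p. coldeg m j = 0))"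
proof (induction p v rule: fundamental_sum.induct)
  case (1 p)
  have "(sgl 0 1 :: mpoly) \<in> supported_on (\<lambda>m. has_wt n 0 m \<and> (\<forall>j\<ge>p. coldeg m j = 0))"
    by (intro supported_on_single) (simp add: has_wt_0)
  then show ?case by simp
next
  case (3 p v)
  then show ?case by (auto intro: supported_on_mono)
next
  case (4 p x a v)
  have "colmon x p * fundamental_sum (Suc p) (a # v) \<in> supported_on (\<lambda>m. has_wt n (block_weight ((x # a) # v)) m \<and> (\<forall>j\<ge>Suc p. coldeg m j = 0))"
    by (rule supported_on_mult[OF colmon_supported_on[of p n x] 4(1)])
       (use 4 has_wt_add in \<open>auto simp: coldeg_add add.assoc\<close>)
  moreover have "fundamental_sum p ((x # a) # v) \<in> supported_on (\<lambda>m. has_wt n (block_weight ((x # a) # v)) m \<and> (\<forall>j\<ge>Suc p. coldeg m j = 0))"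
    by (rule supported_on_mono[OF 4(2)]) (use 4 in auto)
  ultimately show ?case by (simp add: supported_on_add)
qed simp

text \<open>When the whole first block goes into column \<open>p\<close>, the other blocks are
  confined to the columns before it. All remaining terms put fewer letters into column
  \<open>p\<close> and so have smaller degree there.\<close>

lemma fundamental_sum_leading:
  assumes p: "p < n" and a: "\<forall>x\<in>set a. total_degree x = r" and r: "r \<noteq> 0"
  shows "fundamental_sum (Suc p) (a # v) - colmon (sum_list a) p * fundamental_sum p v \<in>
    supported_on (\<lambda>m. has_wt n (block_weight (a # v)) m \<and> coldeg m p < r * length a \<and> (\<forall>j>p. coldeg m j = 0))"
  using a
proof (induction a)
  case Nil
  then show ?case by simp
next
  case (Cons x a)
  let ?Q = "\<lambda>m. has_wt n (block_weight ((x # a) # v)) m \<and> coldeg m p < r * length (x # a) \<and> (\<forall>j>p. coldeg m j = 0)"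
  let ?D = "fundamental_sum (Suc p) (a # v) - colmon (sum_list a) p * fundamental_sum p v"
  have "colmon x p * ?D \<in> supported_on ?Q"
    by (rule supported_on_mult[OF colmon_supported_on[OF p, of x] Cons.IH]) (use Cons.prems has_wt_add in \<open>auto simp: coldeg_add add.assoc\<close>)
  moreover have "fundamental_sum p ((x # a) # v) \<in> supported_on ?Q"
    by (rule supported_on_mono[OF fundamental_sum_supported_on[of p n]]) (use p r in auto)
  moreover have "fundamental_sum (Suc p) ((x # a) # v) - colmon (sum_list (x # a)) p * fundamental_sum p v = colmon x p * ?D + fundamental_sum p ((x # a) # v)"
    by (simp add: colmon_add algebra_simps)
  ultimately show ?case by (simp only: supported_on_add)
qed

section \<open>Words distributed over columns, and their reduction\<close>

definition word_expo :: "nat \<Rightarrow> nat \<Rightarrow> (nat \<Rightarrow> (nat \<Rightarrow>\<^sub>0 nat) list) \<Rightarrow> expo" where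
  "word_expo n p w = (\<Sum>j\<in>{p..<n}. colexp (sum_list (w j)) j)"

definition word_weight :: "nat \<Rightarrow> nat \<Rightarrow> (nat \<Rightarrow> (nat \<Rightarrow>\<^sub>0 nat) list) \<Rightarrow> nat \<Rightarrow>\<^sub>0 nat" where
  "word_weight n p w = (\<Sum>j\<in>{p..<n}. sum_list (w j))"

lemma word_expo_Suc: "p < n \<Longrightarrow> word_expo n p w = colexp (sum_list (w p)) p + word_expo n (Suc p) w"
  unfolding word_expo_def by (rule sum.atLeast_Suc_lessThan)

lemma word_weight_Suc: "p < n \<Longrightarrow> word_weight n p w = sum_list (w p) + word_weight n (Suc p) w"
  unfolding word_weight_def by (rule sum.atLeast_Suc_lessThan)

lemma has_wt_word_expo: "has_wt n (word_weight n p w) (word_expo n p w)"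
  unfolding word_expo_def word_weight_def by (intro has_wt_sum has_wt_colexp) auto

lemma total_degree_letters: "\<forall>x\<in>set a. total_degree x = r \<Longrightarrow> total_degree (sum_list a) = r * length a"
  by (induction a) (auto simp: total_degree_add)

lemma coldeg_word_expo: "\<forall>j. \<forall>x\<in>set (w j). total_degree x = r \<Longrightarrow> coldeg (word_expo n p w) j = (if p \<le> j \<and> j < n then r * length (w j) else 0)"
  unfolding word_expo_def coldeg_sum coldeg_colexp using total_degree_letters[of "w j" r] by simp

text \<open>Lexicographic comparison of column degrees with those of the word, over the columns from
  \<open>p\<close> on and with the rightmost column most significant. The distribution over rows is
  ignored.\<close>

definition low :: "nat \<Rightarrow> nat \<Rightarrow> nat \<Rightarrow> (nat \<Rightarrow> (nat \<Rightarrow>\<^sub>0 nat) list) \<Rightarrow> expo \<Rightarrow> bool" where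
  "low n r p w m \<longleftrightarrow> (\<exists>j. p \<le> j \<and> j < n \<and> coldeg m j < r * length (w j) \<and> (\<forall>k. j < k \<and> k < n \<longrightarrow> coldeg m k = r * length (w k)))"

lemma low_Suc: "low n r (Suc p) w m \<Longrightarrow> low n r p w m"
  unfolding low_def using Suc_leD by blast

lemma low_add_left: "low n r p w m \<Longrightarrow> (\<And>j. p \<le> j \<Longrightarrow> coldeg k j = 0) \<Longrightarrow> low n r p w (k + m)"
  unfolding low_def by (auto simp: coldeg_add intro: less_imp_le)

lemma low_Nil: "w p = [] \<Longrightarrow> low n r p w m \<Longrightarrow> low n r (Suc p) w m"
  unfolding low_def by (metis Suc_leI le_neq_implies_less list.size(3) mult_0_right not_less_zero)


text \<open>
  Induction from the right: the word \<open>w\<close> fills the columns from \<open>p\<close> on, while the blocks \<open>v\<close> are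
  still to be distributed over the columns before \<open>p\<close>. For \<open>p = n\<close> the sum lies in the ideal, for
  \<open>p = 0\<close> only the monomial of \<open>w\<close> is left. The degree hypothesis keeps the blocks from running out.
\<close>

lemma low_rewrite:
  assumes r: "r \<noteq> 0" and w: "\<forall>j. \<forall>x\<in>set (w j). total_degree x = r" and p: "p \<le> n"
    and v: "\<forall>a\<in>set v. a \<noteq> [] \<and> (\<forall>x\<in>set a. total_degree x = r)"
    and count: "n - p + length v \<le> (\<Sum>j\<in>{p..<n}. length (w j)) + sum_list (map length v)"
      "1 \<le> (\<Sum>j\<in>{p..<n}. length (w j)) + sum_list (map length v)"
  shows "\<exists>f\<in>hideal n r (word_weight n p w + block_weight v).
    f - sgl (word_expo n p w) 1 * fundamental_sum p v \<in> supported_on (\<lambda>m. has_wt n (word_weight n p w + block_weight v) m \<and> low n r p w m)"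
  using p v count
proof (induction "n - p" arbitrary: p v)
  case 0
  then have pn: "p = n" by simp
  \<comment> \<open>For \<open>p = n\<close> no column holds letters of the word, so the second
    counting hypothesis guarantees a block.\<close>
  then have "v \<noteq> []" using 0 by auto
  then have "fundamental_sum n v \<in> hideal n r (block_weight v)" using fundamental_sum_hideal[OF r] 0 by blast
  then show ?case by (intro bexI[of _ "fundamental_sum n v"]) (simp_all add: pn word_weight_def word_expo_def)
next
  case (Suc N)
  then have p: "p < n" and N: "N = n - Suc p" by auto
  note IH = Suc.hyps(1)[OF N]
  have cnt: "(\<Sum>j\<in>{p..<n}. length (w j)) = length (w p) + (\<Sum>j\<in>{Suc p..<n}. length (w j))"
    by (rule sum.atLeast_Suc_lessThan[OF p])
  let ?W = "\<lambda>p. sgl (word_expo n p w) (1::rat)"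
  show ?case
  proof (cases "w p = []")
    case False
    \<comment> \<open>The letters of column \<open>p\<close> are turned into a new first block; its
      leading term puts all of them back into column \<open>p\<close>.\<close>
    let ?v = "w p # v"
    have c1: "n - Suc p + length ?v \<le> (\<Sum>j\<in>{Suc p..<n}. length (w j)) + sum_list (map length ?v)"
      using Suc.prems(3) p unfolding cnt list.map sum_list.Cons list.size by linarith
    have c2: "1 \<le> (\<Sum>j\<in>{Suc p..<n}. length (w j)) + sum_list (map length ?v)"
      using Suc.prems(4) unfolding cnt list.map sum_list.Cons by linarith
    have "\<forall>a\<in>set ?v. a \<noteq> [] \<and> (\<forall>x\<in>set a. total_degree x = r)" using Suc.prems(2) False w by simp
    from IH[OF _ this c1 c2] p obtain f where f: "f \<in> hideal n r (word_weight n (Suc p) w + block_weight ?v)"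
      "f - ?W (Suc p) * fundamental_sum (Suc p) ?v \<in> supported_on (\<lambda>m. has_wt n (word_weight n (Suc p) w + block_weight ?v) m \<and> low n r (Suc p) w m)"
      by auto
    let ?D = "fundamental_sum (Suc p) ?v - colmon (sum_list (w p)) p * fundamental_sum p v"
    have wt: "word_weight n (Suc p) w + block_weight ?v = word_weight n p w + block_weight v"
      by (simp add: word_weight_Suc[OF p] add_ac)
    have "?W (Suc p) * ?D \<in> supported_on (\<lambda>m. has_wt n (word_weight n p w + block_weight v) m \<and> low n r p w m)"
    proof (rule supported_on_mult[OF _ fundamental_sum_leading[OF p _ r]])
      show "?W (Suc p) \<in> supported_on (\<lambda>m. m = word_expo n (Suc p) w)" by (rule supported_on_single) simp
      show "\<forall>x\<in>set (w p). total_degree x = r" using w by simp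
      fix m k assume m: "m = word_expo n (Suc p) w" and k: "has_wt n (block_weight ?v) k \<and> coldeg k p < r * length (w p) \<and> (\<forall>j>p. coldeg k j = 0)"
      have "has_wt n (word_weight n p w + block_weight v) (m + k)"
        using has_wt_add[OF has_wt_word_expo[of n "Suc p" w]] k m wt by metis
      moreover have "low n r p w (m + k)"
        unfolding low_def using p k by (intro exI[of _ p]) (auto simp: coldeg_add m coldeg_word_expo[OF w])
      ultimately show "has_wt n (word_weight n p w + block_weight v) (m + k) \<and> low n r p w (m + k)" ..
    qed
    moreover have "f - ?W (Suc p) * fundamental_sum (Suc p) ?v \<in> supported_on (\<lambda>m. has_wt n (word_weight n p w + block_weight v) m \<and> low n r p w m)"
      using f(2) unfolding wt by (rule supported_on_mono) (auto intro: low_Suc)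
    moreover have "f - ?W p * fundamental_sum p v = (f - ?W (Suc p) * fundamental_sum (Suc p) ?v) + ?W (Suc p) * ?D"
    proof -
      have "?W p = ?W (Suc p) * colmon (sum_list (w p)) p"
        by (simp add: word_expo_Suc[OF p] colmon_def mult_single add.commute)
      then show ?thesis by (simp add: algebra_simps)
    qed
    ultimately have "f - ?W p * fundamental_sum p v \<in> supported_on (\<lambda>m. has_wt n (word_weight n p w + block_weight v) m \<and> low n r p w m)"
      by (simp only: supported_on_add)
    then show ?thesis using f(1) unfolding wt by blast
  next
    case True
    have Weq: "word_expo n p w = word_expo n (Suc p) w" "word_weight n p w = word_weight n (Suc p) w"
      using True by (simp_all add: word_expo_Suc[OF p] word_weight_Suc[OF p] colexp_def)
    have cnt': "(\<Sum>j\<in>{p..<n}. length (w j)) = (\<Sum>j\<in>{Suc p..<n}. length (w j))"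
      using cnt True by simp
    let ?L = "\<lambda>d. supported_on (\<lambda>m. has_wt n d m \<and> low n r p w m)"
    \<comment> \<open>With no letters of the word in column \<open>p\<close>, a monomial cannot be
      lower there. The deciding column lies further right, so factors in column \<open>p\<close> do
      not disturb it.\<close>
    have raise: "colmon x p * g \<in> ?L (x + d)" if "g \<in> ?L d" for x g d
    proof (rule supported_on_mult[OF colmon_supported_on[OF p, of x] that])
      fix m k assume m: "has_wt n x m \<and> (\<forall>k. coldeg m k = (if k = p then total_degree x else 0))" and k: "has_wt n d k \<and> low n r p w k"
      then have "low n r (Suc p) w (m + k)" using low_Nil[of w p n r k] True by (intro low_add_left) auto
      then show "has_wt n (x + d) (m + k) \<and> low n r p w (m + k)" using m k by (auto intro: low_Suc has_wt_add)
    qed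
    have IH': "\<exists>f\<in>hideal n r (word_weight n p w + block_weight u). f - ?W p * fundamental_sum (Suc p) u \<in> ?L (word_weight n p w + block_weight u)"
      if u: "\<forall>a\<in>set u. a \<noteq> [] \<and> (\<forall>x\<in>set a. total_degree x = r)"
        "n - Suc p + length u \<le> (\<Sum>j\<in>{p..<n}. length (w j)) + sum_list (map length u)"
        "1 \<le> (\<Sum>j\<in>{p..<n}. length (w j)) + sum_list (map length u)" for u
    proof -
      have "Suc p \<le> n" using p by simp
      from IH[OF this u[unfolded cnt']] obtain f where f: "f \<in> hideal n r (word_weight n (Suc p) w + block_weight u)"
        "f - ?W (Suc p) * fundamental_sum (Suc p) u \<in> supported_on (\<lambda>m. has_wt n (word_weight n (Suc p) w + block_weight u) m \<and> low n r (Suc p) w m)"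
        by blast
      have "f - ?W p * fundamental_sum (Suc p) u \<in> ?L (word_weight n p w + block_weight u)"
        using f(2) unfolding Weq by (rule supported_on_mono) (auto intro: low_Suc)
      then show ?thesis using f(1) unfolding Weq by blast
    qed
    \<comment> \<open>The recursion of \<open>fundamental_sum\<close> is solved for the sum over the
      columns before \<open>p\<close>, giving two sums that include column \<open>p\<close>. The
      second has one letter less, but one column is dropped as well, so the counting hypothesis
      survives.\<close>
    show ?thesis
      using Suc.prems
    proof (induction v)
      case Nil
      then show ?case using IH'[of "[]"] p by simp
    next
      case (Cons b v)
      then obtain x a where b: "b = x # a" by (cases b) auto
      have "n - Suc p + length (b # v) \<le> (\<Sum>j\<in>{p..<n}. length (w j)) + sum_list (map length (b # v))"
        using Cons.prems(3) p by linarith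
      from IH'[OF Cons.prems(2) this Cons.prems(4)] obtain f1 where f1: "f1 \<in> hideal n r (word_weight n p w + block_weight (b # v))"
        "f1 - ?W p * fundamental_sum (Suc p) (b # v) \<in> ?L (word_weight n p w + block_weight (b # v))"
        by blast
      have count: "n - p + length v \<le> (\<Sum>j\<in>{p..<n}. length (w j)) + (length a + sum_list (map length v))"
        using Cons.prems(3) by (simp add: b)
      have "\<exists>f2\<in>hideal n r (word_weight n p w + block_weight (a # v)). f2 - ?W p * fundamental_sum (Suc p) (a # v) \<in> ?L (word_weight n p w + block_weight (a # v))"
      proof (cases "a = []")
        \<comment> \<open>An exhausted block closes column \<open>p\<close>: the second sum is then
          \<open>fundamental_sum p v\<close>, which the inner induction covers.\<close>
        case True
        then show ?thesis using Cons.IH Cons.prems(1,2) count p by simp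
      next
        case False
        show ?thesis
        proof (rule IH')
          show "n - Suc p + length (a # v) \<le> (\<Sum>j\<in>{p..<n}. length (w j)) + sum_list (map length (a # v))"
            "1 \<le> (\<Sum>j\<in>{p..<n}. length (w j)) + sum_list (map length (a # v))"
            using count p unfolding list.map sum_list.Cons list.size by linarith+
        qed (use Cons.prems(2) b False in simp)
      qed
      then obtain f2 where f2: "f2 \<in> hideal n r (word_weight n p w + block_weight (a # v))" "f2 - ?W p * fundamental_sum (Suc p) (a # v) \<in> ?L (word_weight n p w + block_weight (a # v))"
        by blast
      have wt: "x + (word_weight n p w + block_weight (a # v)) = word_weight n p w + block_weight (b # v)" by (simp add: b add_ac)
      define f where "f = f1 - colmon x p * f2"
      have "colmon x p * f2 \<in> hideal n r (word_weight n p w + block_weight (b # v))"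
        using hideal_times[OF colmon_hpoly[OF p] f2(1), of x] unfolding wt .
      then have "f \<in> hideal n r (word_weight n p w + block_weight (b # v))"
        unfolding f_def using f1(1) by (intro Q.subspace_diff subspace_hideal)
      moreover have "f - ?W p * fundamental_sum p (b # v) =
        (f1 - ?W p * fundamental_sum (Suc p) (b # v)) - colmon x p * (f2 - ?W p * fundamental_sum (Suc p) (a # v))"
        by (simp add: f_def b algebra_simps)
      then have "f - ?W p * fundamental_sum p (b # v) \<in> ?L (word_weight n p w + block_weight (b # v))"
        using supported_on_diff[OF f1(2) raise[OF f2(2), of x, unfolded wt]] by simp
      ultimately show ?case by blast
    qed
  qed
qed

lemma letter_decomposition:
  assumes "r * b \<le> total_degree \<alpha>"
  shows "\<exists>a \<beta>. length a = b \<and> (\<forall>x\<in>set a. total_degree x = r) \<and> \<alpha> = sum_list a + \<beta>"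
  using assms
proof (induction b arbitrary: \<alpha>)
  case 0
  then show ?case by simp
next
  case (Suc b)
  have sub: "\<exists>x \<beta>. total_degree x = k \<and> \<alpha> = x + \<beta>" if "k \<le> total_degree \<alpha>" for k
    using that
  proof (induction k)
    case 0
    show ?case by (rule exI[of _ 0], rule exI[of _ \<alpha>]) simp
  next
    case (Suc k)
    then obtain x \<beta> where x: "total_degree x = k" "\<alpha> = x + \<beta>" by auto
    then have "\<beta> \<noteq> 0" using Suc.prems by auto
    then obtain i where i: "lk \<beta> i \<noteq> 0" by (metis lookup_zero poly_mapping_eqI)
    obtain \<gamma> where "\<beta> = \<gamma> + sgl i 1" using wt_split[OF i] by blast
    then show ?case using x by (intro exI[of _ "x + sgl i 1"] exI[of _ \<gamma>]) (simp add: total_degree_add add_ac)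
  qed
  obtain x \<beta> where x: "total_degree x = r" "\<alpha> = x + \<beta>" using sub[of r] Suc.prems by auto
  then have "r * b \<le> total_degree \<beta>" using Suc.prems by (simp add: total_degree_add)
  from Suc.IH[OF this] obtain a \<gamma> where "length a = b" "\<forall>x\<in>set a. total_degree x = r" "\<beta> = sum_list a + \<gamma>" by blast
  then show ?case using x by (intro exI[of _ "x # a"] exI[of _ \<gamma>]) (simp add: add.assoc)
qed

text \<open>Column degrees are read as digits in base \<open>Suc N\<close>, with the rightmost
  column most significant. The lexicographic comparison thus becomes one of natural numbers, usable
  for induction.\<close>

lemma base_expansion_less:
  fixes c d :: "nat \<Rightarrow> nat"
  assumes j: "j < n" "c j < d j" and eq: "\<And>k. j < k \<Longrightarrow> k < n \<Longrightarrow> c k = d k" and bound: "\<And>k. k < n \<Longrightarrow> c k \<le> N"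
  shows "(\<Sum>k<n. c k * Suc N ^ k) < (\<Sum>k<n. d k * Suc N ^ k)"
proof -
  have split: "(\<Sum>k<n. g k) = (\<Sum>k<j. g k) + g j + (\<Sum>k\<in>{j<..<n}. g k)" for g :: "nat \<Rightarrow> nat"
  proof -
    have "{..<n} = insert j ({..<j} \<union> {j<..<n})" "{..<j} \<inter> {j<..<n} = {}" using j by auto
    then show ?thesis by (simp add: sum.union_disjoint)
  qed
  have "(\<Sum>k<m. N * Suc N ^ k) + 1 = Suc N ^ m" for m by (induction m) (simp_all add: algebra_simps)
  moreover have "(\<Sum>k<j. c k * Suc N ^ k) \<le> (\<Sum>k<j. N * Suc N ^ k)"
    using bound j by (intro sum_mono mult_right_mono) auto
  ultimately have "(\<Sum>k<j. c k * Suc N ^ k) + c j * Suc N ^ j < Suc N ^ j + c j * Suc N ^ j"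
    by (metis add_less_mono1 less_add_one le_less_trans)
  also have "\<dots> = Suc (c j) * Suc N ^ j" by simp
  also have "\<dots> \<le> d j * Suc N ^ j" using j by (intro mult_right_mono) auto
  finally have "(\<Sum>k<j. c k * Suc N ^ k) + c j * Suc N ^ j < d j * Suc N ^ j" .
  moreover have "(\<Sum>k\<in>{j<..<n}. c k * Suc N ^ k) = (\<Sum>k\<in>{j<..<n}. d k * Suc N ^ k)"
    using eq by (intro sum.cong) auto
  ultimately show ?thesis unfolding split[of "\<lambda>k. c k * Suc N ^ k"] split[of "\<lambda>k. d k * Suc N ^ k"] by linarith
qed

text \<open>Each column is cut into letters of degree \<open>r\<close> and a remainder. With at
  least \<open>n\<close> letters the word can be rewritten modulo the ideal; multiplied by the
  remainders, this makes the monomial congruent to a combination of lower ones, which lie in the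
  ideal by induction.\<close>

theorem hpoly_eq_hideal_large:
  assumes r: "r \<ge> 1" and n: "n \<ge> 1" and large: "total_degree d > 2 * r * n - r - n"
  shows "hpoly n d = hideal n r d"
proof -
  have mon: "sgl m 1 \<in> hideal n r d" if "has_wt n d m" for m
    using that
  proof (induction "\<Sum>k<n. coldeg m k * Suc (total_degree d) ^ k" arbitrary: m rule: less_induct)
    case less
    have "\<exists>a \<beta>. length a = coldeg m j div r \<and> (\<forall>x\<in>set a. total_degree x = r) \<and> colpart m j = sum_list a + \<beta>" for j
      by (rule letter_decomposition) (simp add: coldeg_def)
    then obtain w \<beta> where w: "\<And>j. length (w j) = coldeg m j div r" "\<forall>j. \<forall>x\<in>set (w j). total_degree x = r"
      "\<And>j. colpart m j = sum_list (w j) + \<beta> j" by metis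
    have cd: "coldeg m j = r * length (w j) + total_degree (\<beta> j)" for j
      using w(3)[of j] total_degree_letters[of "w j" r] w(2) by (simp add: coldeg_def total_degree_add)
    \<comment> \<open>At most \<open>n - 1\<close> letters and remainders of degree at most
      \<open>r - 1\<close> would bound the degree by r(n - 1) + n(r - 1) = 2rn - r - n.\<close>
    have "n \<le> (\<Sum>j<n. length (w j))"
    proof (rule ccontr)
      assume "\<not> ?thesis"
      then have s: "(\<Sum>j<n. length (w j)) \<le> n - 1" by simp
      have "coldeg m j \<le> r * length (w j) + (r - 1)" for j
        unfolding w(1) using mult_div_mod_eq[of r "coldeg m j"] mod_less_divisor[of r "coldeg m j"] r by linarith
      then have "total_degree d \<le> (\<Sum>j<n. r * length (w j) + (r - 1))"
        unfolding sum_coldeg[OF less.prems, symmetric] by (intro sum_mono)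
      also have "\<dots> = r * (\<Sum>j<n. length (w j)) + n * (r - 1)" by (simp add: sum.distrib sum_distrib_left)
      also have "\<dots> \<le> r * (n - 1) + n * (r - 1)" using s by (intro add_mono mult_left_mono) auto
      also have "\<dots> = 2 * r * n - r - n" using r n by (simp add: diff_mult_distrib2 algebra_simps)
      finally show False using large by simp
    qed
    \<comment> \<open>For \<open>p = 0\<close> and no blocks the counting hypothesis just says that
      the word has at least \<open>n\<close> letters.\<close>
    then have "\<exists>f\<in>hideal n r (word_weight n 0 w + block_weight []). f - sgl (word_expo n 0 w) 1 * fundamental_sum 0 [] \<in> supported_on (\<lambda>m. has_wt n (word_weight n 0 w + block_weight []) m \<and> low n r 0 w m)"
      using r n w(2) by (intro low_rewrite) (auto simp: atLeast0LessThan)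
    then obtain f where f: "f \<in> hideal n r (word_weight n 0 w)" "f - sgl (word_expo n 0 w) 1 \<in> supported_on (\<lambda>m. has_wt n (word_weight n 0 w) m \<and> low n r 0 w m)"
      by auto
    define \<rho> where "\<rho> = (\<Sum>j<n. colexp (\<beta> j) j)"
    have staircase: "has_wt n (\<Sum>j<n. \<beta> j) \<rho>" unfolding \<rho>_def by (intro has_wt_sum has_wt_colexp) auto
    have m: "m = \<rho> + word_expo n 0 w"
      using expo_colparts[OF less.prems] by (simp add: \<rho>_def word_expo_def w(3) colexp_add sum.distrib atLeast0LessThan add.commute)
    have d: "d = (\<Sum>j<n. \<beta> j) + word_weight n 0 w"
      using has_wt_unique[OF less.prems] has_wt_add[OF staircase has_wt_word_expo] m by metis
    have "sgl \<rho> 1 * f \<in> hideal n r d" unfolding d by (rule hideal_times[OF hpoly_single[OF staircase] f(1)])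
    moreover have "sgl \<rho> 1 * (f - sgl (word_expo n 0 w) 1) \<in> hideal n r d"
    proof -
      let ?g = "sgl \<rho> 1 * (f - sgl (word_expo n 0 w) 1)"
      have "?g \<in> supported_on (\<lambda>k. has_wt n d k \<and> (\<Sum>i<n. coldeg k i * Suc (total_degree d) ^ i) < (\<Sum>i<n. coldeg m i * Suc (total_degree d) ^ i))"
      proof (rule supported_on_mult[OF _ f(2)])
        show "sgl \<rho> 1 \<in> supported_on (\<lambda>k. k = \<rho>)" by (rule supported_on_single) simp
        fix k l assume k: "k = \<rho>" and l: "has_wt n (word_weight n 0 w) l \<and> low n r 0 w l"
        have wt: "has_wt n d (k + l)" unfolding d k using has_wt_add[OF staircase] l by blast
        obtain j where j: "j < n" "coldeg l j < r * length (w j)" "\<And>i. j < i \<Longrightarrow> i < n \<Longrightarrow> coldeg l i = r * length (w i)"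
          using l unfolding low_def by blast
        have cr: "coldeg \<rho> i = total_degree (\<beta> i)" if "i < n" for i
          using that by (simp add: \<rho>_def coldeg_sum coldeg_colexp)
        have "(\<Sum>i<n. coldeg (k + l) i * Suc (total_degree d) ^ i) < (\<Sum>i<n. coldeg m i * Suc (total_degree d) ^ i)"
        proof (rule base_expansion_less[OF j(1)])
          show "coldeg (k + l) j < coldeg m j" using j cr by (simp add: coldeg_add k cd)
          show "coldeg (k + l) i = coldeg m i" if "j < i" "i < n" for i
            using that j(3) cr by (simp add: coldeg_add k cd)
          show "coldeg (k + l) i \<le> total_degree d" if "i < n" for i
            using sum_coldeg[OF wt] member_le_sum[of i "{..<n}" "coldeg (k + l)"] that by simp
        qed
        with wt show "has_wt n d (k + l) \<and> (\<Sum>i<n. coldeg (k + l) i * Suc (total_degree d) ^ i) < (\<Sum>i<n. coldeg m i * Suc (total_degree d) ^ i)" ..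
      qed
      then have "sgl k 1 \<in> hideal n r d" if "k \<in> Poly_Mapping.keys ?g" for k
        using less.hyps that unfolding supported_on_def by blast
      then have "(\<Sum>k\<in>Poly_Mapping.keys ?g. qscale (lk ?g k) (sgl k 1)) \<in> hideal n r d"
        by (intro Q.subspace_sum Q.subspace_scale subspace_hideal)
      also have "(\<Sum>k\<in>Poly_Mapping.keys ?g. qscale (lk ?g k) (sgl k 1)) = (\<Sum>k\<in>Poly_Mapping.keys ?g. sgl k (lk ?g k))"
        by (simp add: qscale_def pconst_def mult_single)
      also have "\<dots> = ?g" by (rule pm_expand[symmetric])
      finally show ?thesis .
    qed
    ultimately have "sgl \<rho> 1 * f - sgl \<rho> 1 * (f - sgl (word_expo n 0 w) 1) \<in> hideal n r d"
      by (intro Q.subspace_diff subspace_hideal)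
    then show ?case by (simp add: m mult_single algebra_simps)
  qed
  have "hpoly n d \<subseteq> hideal n r d"
  proof
    fix p assume "p \<in> hpoly n d"
    then have "p \<in> Q.span ((\<lambda>m. sgl m 1) ` {m. has_wt n d m})" by (rule hpoly_in_span)
    also have "\<dots> \<subseteq> hideal n r d" using mon by (intro Q.span_minimal subspace_hideal) auto
    finally show "p \<in> hideal n r d" .
  qed
  then show ?thesis using hideal_hpoly by blast
qed

section \<open>The Hilbert series as a difference of dimensions\<close>

abbreviation poly_carrier :: "nat \<Rightarrow> nat \<Rightarrow> mpoly set" where "poly_carrier l n \<equiv> carrier (poly_ring l n)"

lemma poly_carrier_supported_on: "poly_carrier l n = supported_on (\<lambda>m. Poly_Mapping.keys m \<subseteq> {..<l} \<times> {..<n})"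
  by (simp add: poly_ring_def supported_on_def)

lemma poly_ring_simps [simp]:
  "p \<otimes>\<^bsub>poly_ring l n\<^esub> q = p * q" "p \<oplus>\<^bsub>poly_ring l n\<^esub> q = p + q"
  "\<one>\<^bsub>poly_ring l n\<^esub> = 1" "\<zero>\<^bsub>poly_ring l n\<^esub> = 0"
  by (simp_all add: poly_ring_def)

lemma poly_carrier_add: "p \<in> poly_carrier l n \<Longrightarrow> q \<in> poly_carrier l n \<Longrightarrow> p + q \<in> poly_carrier l n"
  unfolding poly_carrier_supported_on by (rule supported_on_add)

lemma poly_carrier_mult: "p \<in> poly_carrier l n \<Longrightarrow> q \<in> poly_carrier l n \<Longrightarrow> p * q \<in> poly_carrier l n"
  unfolding poly_carrier_supported_on
proof (erule supported_on_mult, assumption)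
  fix m k :: expo
  assume "Poly_Mapping.keys m \<subseteq> {..<l} \<times> {..<n}" "Poly_Mapping.keys k \<subseteq> {..<l} \<times> {..<n}"
  then show "Poly_Mapping.keys (m + k) \<subseteq> {..<l} \<times> {..<n}" using keys_add[of m k] by blast
qed

lemma poly_carrier_pconst: "pconst c \<in> poly_carrier l n"
  unfolding poly_carrier_supported_on pconst_def by (rule supported_on_single) simp

lemma poly_carrier_1: "1 \<in> poly_carrier l n" using poly_carrier_pconst[of 1] by simp
lemma poly_carrier_0: "0 \<in> poly_carrier l n" using poly_carrier_pconst[of 0] by simp

lemma poly_carrier_uminus: "p \<in> poly_carrier l n \<Longrightarrow> - p \<in> poly_carrier l n"
  using poly_carrier_mult[OF poly_carrier_pconst[of "-1"], of p] by (simp add: pconst_def single_uminus)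

lemma cring_poly_ring: "cring (poly_ring l n)"
proof (rule cringI)
  show "abelian_group (poly_ring l n)"
    by (rule abelian_groupI) (auto simp: poly_carrier_add poly_carrier_0 add_ac intro: bexI[of _ "- _"] poly_carrier_uminus)
  show "Group.comm_monoid (poly_ring l n)"
    by (rule comm_monoidI) (auto simp: poly_carrier_mult poly_carrier_1 mult_ac)
qed (simp add: distrib_right)

interpretation P: cring "poly_ring l n" for l n by (rule cring_poly_ring)

lemma P_a_inv: "p \<in> poly_carrier l n \<Longrightarrow> \<ominus>\<^bsub>poly_ring l n\<^esub> p = - p"
  by (rule P.minus_equality[symmetric, THEN sym]) (simp_all add: poly_carrier_uminus)

text \<open>Selections are split by whether their last column is the last one available. The list is
  reversed because \<open>monomial_sum\<close> reads columns from right to left.\<close>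

lemma msum_column_selections:
  fixes g :: "nat \<Rightarrow> nat \<Rightarrow> 'a::comm_ring_1"
  shows "(\<Sum>f\<in>column_selections n k. \<Prod>j<k. g j (f j)) = monomial_sum n (map g (rev [0..<k]))"
proof (induction n arbitrary: k)
  case 0
  show ?case
  proof (cases k)
    case 0
    have "column_selections 0 0 = {\<lambda>_. undefined}" by (auto simp: column_selections_def strict_mono_on_def)
    then show ?thesis using 0 by simp
  next
    case (Suc k')
    then have "column_selections 0 k = {}" by (auto simp: column_selections_def PiE_eq_empty_iff)
    then show ?thesis using Suc by simp
  qed
next
  case (Suc n)
  show ?case
  proof (cases k)
    case 0
    have "column_selections (Suc n) 0 = {\<lambda>_. undefined}" by (auto simp: column_selections_def strict_mono_on_def)
    then show ?thesis using 0 by simp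
  next
    case (Suc k')
    let ?up = "\<lambda>f :: nat \<Rightarrow> nat. f(k' := n)"
    have eq: "column_selections (Suc n) k = column_selections n k \<union> ?up ` column_selections n k'"
    proof (intro equalityI subsetI)
      fix f assume f: "f \<in> column_selections (Suc n) k"
      then have mono: "strict_mono_on {..<k} f" and fP: "f \<in> {..<k} \<rightarrow>\<^sub>E {..<Suc n}" by (auto simp: column_selections_def)
      have le: "f j \<le> n" if "j < k" for j using PiE_mem[OF fP, of j] that by simp
      have lt: "f j < f k'" if "j < k'" for j using mono that Suc by (auto simp: strict_mono_on_def)
      show "f \<in> column_selections n k \<union> ?up ` column_selections n k'"
      proof (cases "f k' = n")
        case True
        \<comment> \<open>Selections are extensional, so the last value has to be reset to the
          default outside the smaller domain.\<close>
        define h where "h = f(k' := undefined)"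
        have "h \<in> {..<k'} \<rightarrow>\<^sub>E {..<n}"
        proof (rule PiE_I)
          fix j assume "j \<in> {..<k'}"
          then show "h j \<in> {..<n}" using lt[of j] True by (simp add: h_def)
        next
          fix j assume "j \<notin> {..<k'}"
          then show "h j = undefined" using PiE_arb[OF fP, of j] Suc by (auto simp: h_def)
        qed
        moreover have "strict_mono_on {..<k'} h"
          using mono Suc by (auto simp: strict_mono_on_def h_def)
        moreover have "f = ?up h" using True by (auto simp: h_def)
        ultimately show ?thesis by (auto simp: column_selections_def)
      next
        case False
        have "f j < n" if "j < k" for j
        proof (cases "j = k'")
          case True
          then show ?thesis using False le[OF that] by simp
        next
          case False
          then have "f j < f k'" using lt that Suc by simp
          also have "f k' \<le> n" using le Suc by simp
          finally show ?thesis .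
        qed
        then have "f \<in> {..<k} \<rightarrow>\<^sub>E {..<n}" using fP by (auto simp: PiE_iff)
        then show ?thesis using mono by (simp add: column_selections_def)
      qed
    next
      fix f assume "f \<in> column_selections n k \<union> ?up ` column_selections n k'"
      then consider "f \<in> column_selections n k" | h where "h \<in> column_selections n k'" "f = ?up h" by blast
      then show "f \<in> column_selections (Suc n) k"
      proof cases
        case 1
        then show ?thesis by (auto simp: column_selections_def PiE_iff less_SucI)
      next
        case 2
        then have h: "strict_mono_on {..<k'} h" "h \<in> {..<k'} \<rightarrow>\<^sub>E {..<n}" by (auto simp: column_selections_def)
        have hn: "h j < n" if "j < k'" for j using PiE_mem[OF h(2), of j] that by simp
        have "f \<in> {..<k} \<rightarrow>\<^sub>E {..<Suc n}"
        proof (rule PiE_I)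
          fix j assume "j \<in> {..<k}"
          then show "f j \<in> {..<Suc n}" using hn[of j] by (auto simp: 2(2) Suc less_Suc_eq)
        next
          fix j assume "j \<notin> {..<k}"
          then show "f j = undefined" using PiE_arb[OF h(2), of j] Suc by (simp add: 2(2))
        qed
        moreover have "strict_mono_on {..<k} f"
          using h(1) hn by (auto simp: strict_mono_on_def 2(2) Suc less_Suc_eq)
        ultimately show ?thesis by (simp add: column_selections_def)
      qed
    qed
    have fin: "finite (column_selections n k)" for n k
      unfolding column_selections_def by (rule finite_subset[of _ "{..<k} \<rightarrow>\<^sub>E {..<n}"]) (auto intro: finite_PiE)
    have disj: "column_selections n k \<inter> ?up ` column_selections n k' = {}"
    proof (rule ccontr)
      assume "\<not> ?thesis"
      then obtain h where "?up h \<in> column_selections n k" by blast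
      then obtain f where "f \<in> column_selections n k" "f k' = n" using fun_upd_same[of h k' n] by blast
      then have "f k' < n" using Suc PiE_mem[of f "{..<k}" "\<lambda>_. {..<n}" k'] by (simp add: column_selections_def)
      with \<open>f k' = n\<close> show False by simp
    qed
    have inj: "inj_on ?up (column_selections n k')"
    proof (rule inj_onI)
      fix f h assume fh: "f \<in> column_selections n k'" "h \<in> column_selections n k'" and eq: "?up f = ?up h"
      show "f = h"
      proof
        fix j show "f j = h j"
        proof (cases "j = k'")
          case True
          then show ?thesis using fh by (auto simp: column_selections_def PiE_iff extensional_def)
        next
          case False
          then show ?thesis using fun_cong[OF eq, of j] by simp
        qed
      qed
    qed
    have "(\<Sum>f\<in>column_selections (Suc n) k. \<Prod>j<k. g j (f j)) =
      (\<Sum>f\<in>column_selections n k. \<Prod>j<k. g j (f j)) + (\<Sum>f\<in>column_selections n k'. \<Prod>j<k. g j (?up f j))"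
      unfolding eq by (subst sum.union_disjoint[OF fin _ disj]) (simp_all add: fin sum.reindex[OF inj])
    also have "(\<Sum>f\<in>column_selections n k'. \<Prod>j<k. g j (?up f j)) = (\<Sum>f\<in>column_selections n k'. \<Prod>j<k'. g j (f j)) * g k' n"
      unfolding Suc sum_distrib_right by (intro sum.cong refl) simp
    finally show ?thesis unfolding Suc.IH by (simp add: Suc mult.commute)
  qed
qed

lemma colexp_weight_vec: "(\<Sum>i<l. sgl (i, j) (f i)) = colexp (weight_vec l f) j"
proof (rule poly_mapping_eqI)
  fix x :: "nat \<times> nat"
  obtain i j' where x: "x = (i, j')" by (cases x)
  have "lk (\<Sum>i<l. sgl (i, j) (f i)) x = (\<Sum>i'<l. if i' = i then (if j' = j then f i else 0) else 0)"
    unfolding lookup_sum x by (intro sum.cong refl) (auto simp: lookup_single when_def)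
  then show "lk (\<Sum>i<l. sgl (i, j) (f i)) x = lk (colexp (weight_vec l f) j) x"
    by (simp add: x lookup_colexp lookup_weight_vec)
qed

lemma monomial_quasi_invariant_monomial_sum:
  "monomial_quasi_invariant n l k A = monomial_sum n (map colmon (map (\<lambda>j. weight_vec l (\<lambda>i. A i j)) (rev [0..<k])))"
proof -
  have "(\<Prod>i<l. \<Prod>j<k. pvar (i, f j) ^ A i j) = (\<Prod>j<k. colmon (weight_vec l (\<lambda>i. A i j)) (f j))" for f
    by (subst prod.swap) (simp add: pvar_power prod_sgl_one colexp_weight_vec colmon_def)
  then show ?thesis
    unfolding monomial_quasi_invariant_def
    using msum_column_selections[of "\<lambda>j. colmon (weight_vec l (\<lambda>i. A i j))" k n] by (simp add: o_def)
qed

lemma total_degree_weight_vec: "total_degree (weight_vec l f) = (\<Sum>i<l. f i)"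
proof -
  have "Poly_Mapping.keys (weight_vec l f) \<subseteq> {..<l}" by (auto simp: lookup_weight_vec in_keys_iff split: if_splits)
  then show ?thesis using total_degree_superset[of "{..<l}" "weight_vec l f"] by (simp add: lookup_weight_vec)
qed

lemma good_columns_composition:
  assumes "composition_matrix r n l k A"
  shows "good_columns r (map (\<lambda>j. weight_vec l (\<lambda>i. A i j)) (rev [0..<k]))"
  using assms by (simp add: good_columns_def composition_matrix_def total_degree_weight_vec del: sum_eq_0_iff)

lemma monomial_sum_long: "p < length fs \<Longrightarrow> monomial_sum p fs = 0"
  by (induction p fs rule: monomial_sum.induct) auto

text \<open>The reversed list supplies the columns of a composition matrix.\<close>

lemma monomial_sum_quasi_invariant:
  assumes good_columns: "good_columns r as" and rows: "\<forall>\<alpha>\<in>set as. Poly_Mapping.keys \<alpha> \<subseteq> {..<l}" and len: "length as \<le> n"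
  shows "monomial_sum n (map colmon as) \<in> monomial_quasi_invariants r n l"
proof -
  define A where "A i j = lk (rev as ! j) i" for i j
  have w: "weight_vec l (\<lambda>i. A i j) = rev as ! j" if "j < length as" for j
  proof (rule poly_mapping_eqI)
    fix i
    have "rev as ! j \<in> set as" using nth_mem[of j "rev as"] that by simp
    then have "Poly_Mapping.keys (rev as ! j) \<subseteq> {..<l}" using rows by blast
    then show "lk (weight_vec l (\<lambda>i. A i j)) i = lk (rev as ! j) i"
      by (auto simp: lookup_weight_vec A_def in_keys_iff subset_iff)
  qed
  have "map (\<lambda>j. weight_vec l (\<lambda>i. A i j)) [0..<length as] = rev as"
    by (rule nth_equalityI) (simp_all add: w)
  then have m: "map (\<lambda>j. weight_vec l (\<lambda>i. A i j)) (rev [0..<length as]) = as"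
    by (metis rev_map rev_rev_ident)
  have "composition_matrix r n l (length as) A"
    unfolding composition_matrix_def
  proof (intro conjI allI impI)
    show "1 \<le> length as" using good_columns by (cases as) (auto simp: good_columns_def)
    fix j assume j: "j < length as"
    then have "rev as ! j \<in> set as" using nth_mem[of j "rev as"] by simp
    moreover have "(\<Sum>i<l. A i j) = total_degree (rev as ! j)" using w[OF j] total_degree_weight_vec[of l "\<lambda>i. A i j"] by simp
    ultimately show "(\<Sum>i<l. A i j) \<noteq> 0" "r dvd (\<Sum>i<l. A i j)" using good_columns by (auto simp: good_columns_def)
  qed (rule len)
  then show ?thesis unfolding monomial_quasi_invariants_def using monomial_quasi_invariant_monomial_sum[of n l "length as" A, unfolded m]
    by (auto intro!: exI[of _ "length as"] exI[of _ A])
qed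

section \<open>Homogeneous components and comparison with \<open>J_W\<close>\<close>

definition homogeneous_part :: "nat \<Rightarrow> (nat \<Rightarrow>\<^sub>0 nat) \<Rightarrow> mpoly \<Rightarrow> mpoly" where
  "homogeneous_part n d f = Poly_Mapping.mapp (\<lambda>m c. if has_wt n d m then c else 0) f"

lemma lookup_homogeneous_part: "lk (homogeneous_part n d f) m = (if has_wt n d m then lk f m else 0)"
  by (simp add: homogeneous_part_def lookup_mapp when_def in_keys_iff)

lemma homogeneous_part_add: "homogeneous_part n d (f + g) = homogeneous_part n d f + homogeneous_part n d g"
  by (rule poly_mapping_eqI) (simp add: lookup_homogeneous_part lookup_add)

lemma homogeneous_part_scale: "homogeneous_part n d (qscale c f) = qscale c (homogeneous_part n d f)"
  by (rule poly_mapping_eqI) (simp add: lookup_homogeneous_part qscale_def lookup_pconst_times)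

lemma homogeneous_part_hpoly: "f \<in> hpoly n e \<Longrightarrow> homogeneous_part n d f = (if d = e then f else 0)"
  by (rule poly_mapping_eqI) (auto simp: lookup_homogeneous_part hpoly_def in_keys_iff dest: has_wt_unique)

text \<open>Projection to degree \<open>d\<close> fixes the component of degree \<open>d\<close> and
  kills the others.\<close>

lemma homogeneous_part_hideal: "f \<in> Q.span (\<Union>e. hideal n r e) \<Longrightarrow> homogeneous_part n d f \<in> hideal n r d"
proof (induction f rule: Q.span_induct_alt)
  case base
  have "homogeneous_part n d 0 = 0" using homogeneous_part_hpoly[OF hpoly_0] by simp
  then show ?case by (simp add: Q.subspace_0 subspace_hideal)
next
  case (step c x y)
  then obtain e where "x \<in> hideal n r e" by blast
  then have "homogeneous_part n d x = (if d = e then x else 0)" using homogeneous_part_hpoly hideal_hpoly by blast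
  then have "homogeneous_part n d x \<in> hideal n r d"
    using \<open>x \<in> hideal n r e\<close> Q.subspace_0[OF subspace_hideal] by simp
  then show ?case using step by (simp add: homogeneous_part_add homogeneous_part_scale Q.subspace_add Q.subspace_scale subspace_hideal)
qed

lemma homogeneous_part_id: "f \<in> hpoly n d \<Longrightarrow> homogeneous_part n d f = f"
  by (simp add: homogeneous_part_hpoly)

definition wt :: "nat \<Rightarrow> expo \<Rightarrow> nat \<Rightarrow>\<^sub>0 nat" where "wt n m = (\<Sum>j<n. colpart m j)"

lemma has_wt_wt: "(\<And>i j. n \<le> j \<Longrightarrow> lk m (i, j) = 0) \<Longrightarrow> has_wt n (wt n m) m"
  by (simp add: has_wt_def wt_def lookup_sum lookup_colpart)

lemma span_hideal_times:
  assumes a: "a \<in> poly_carrier l n" and f: "f \<in> Q.span (\<Union>e. hideal n r e)"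
  shows "a * f \<in> Q.span (\<Union>e. hideal n r e)"
  using f
proof (induction f rule: Q.span_induct_alt)
  case base
  then show ?case by (simp add: Q.span_zero)
next
  case (step c x y)
  then obtain e where x: "x \<in> hideal n r e" by blast
  have "sgl m (lk a m) * x \<in> Q.span (\<Union>e. hideal n r e)" if m: "m \<in> Poly_Mapping.keys a" for m
  proof -
    have "has_wt n (wt n m) m"
      using a m by (intro has_wt_wt) (fastforce simp: poly_carrier_supported_on supported_on_def in_keys_iff)
    then show ?thesis using hideal_times[OF hpoly_single x] by (intro Q.span_base) blast
  qed
  then have "(\<Sum>m\<in>Poly_Mapping.keys a. sgl m (lk a m) * x) \<in> Q.span (\<Union>e. hideal n r e)" by (rule Q.span_sum)
  then have "a * x \<in> Q.span (\<Union>e. hideal n r e)" by (simp flip: sum_distrib_right pm_expand)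
  moreover have "a * (qscale c x + y) = qscale c (a * x) + a * y" by (simp add: qscale_def algebra_simps)
  ultimately show ?case using step by (simp add: Q.span_add Q.span_scale)
qed

lemma poly_carrier_qscale: "p \<in> poly_carrier l n \<Longrightarrow> qscale c p \<in> poly_carrier l n"
  unfolding qscale_def by (intro poly_carrier_mult poly_carrier_pconst)

lemma poly_carrier_sum: "(\<And>i. i \<in> I \<Longrightarrow> f i \<in> poly_carrier l n) \<Longrightarrow> sum f I \<in> poly_carrier l n"
  by (induction I rule: infinite_finite_induct) (auto simp: poly_carrier_0 poly_carrier_add)

lemma monomial_quasi_invariants_poly_carrier:
  "p \<in> monomial_quasi_invariants r n l \<Longrightarrow> p \<in> poly_carrier l n"
proof -
  assume "p \<in> monomial_quasi_invariants r n l"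
  then obtain k A where p: "p = monomial_quasi_invariant n l k A" by (auto simp: monomial_quasi_invariants_def)
  have prod: "(\<And>i. i \<in> I \<Longrightarrow> f i \<in> poly_carrier l n) \<Longrightarrow> prod f I \<in> poly_carrier l n" for I :: "nat set" and f
    by (induction I rule: infinite_finite_induct) (auto simp: poly_carrier_1 poly_carrier_mult)
  have pow: "q \<in> poly_carrier l n \<Longrightarrow> q ^ a \<in> poly_carrier l n" for q a
    by (induction a) (auto simp: poly_carrier_1 poly_carrier_mult)
  have "(pvar (i, f j) :: mpoly) \<in> poly_carrier l n" if "i < l" "f \<in> column_selections n k" "j < k" for i j f
    unfolding poly_carrier_supported_on pvar_def
    using that PiE_mem[of f "{..<k}" "\<lambda>_. {..<n}" j] by (intro supported_on_single) (auto simp: column_selections_def)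
  then show ?thesis unfolding p monomial_quasi_invariant_def
    by (intro poly_carrier_sum prod pow) auto
qed

lemma monomial_quasi_invariants_hideal:
  "p \<in> monomial_quasi_invariants r n l \<Longrightarrow> p \<in> Q.span (\<Union>e. hideal n r e)"
proof -
  assume "p \<in> monomial_quasi_invariants r n l"
  then obtain k A where p: "p = monomial_quasi_invariant n l k A" "composition_matrix r n l k A"
    by (auto simp: monomial_quasi_invariants_def)
  let ?as = "map (\<lambda>j. weight_vec l (\<lambda>i. A i j)) (rev [0..<k])"
  have "1 * monomial_sum n (map colmon ?as) \<in> hideal n r (sum_list ?as)"
    by (rule hideal_mult[OF _ good_columns_composition[OF p(2)]]) (use hpoly_pconst[of 1 n] in simp_all)
  then show ?thesis using p(1) by (intro Q.span_base) (auto simp: monomial_quasi_invariant_monomial_sum)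
qed

lemma quasi_invariants_span: "quasi_invariants r n l \<subseteq> poly_carrier l n \<inter> Q.span (\<Union>e. hideal n r e)"
proof
  fix q assume "q \<in> quasi_invariants r n l"
  then obtain F a where F: "F \<subseteq> monomial_quasi_invariants r n l" "q = (\<Sum>p\<in>F. qscale (a p) p)"
    by (auto simp: quasi_invariants_def qscale_def)
  show "q \<in> poly_carrier l n \<inter> Q.span (\<Union>e. hideal n r e)"
    unfolding F(2) using F(1) monomial_quasi_invariants_poly_carrier monomial_quasi_invariants_hideal
    by (intro IntI poly_carrier_sum poly_carrier_qscale Q.span_sum Q.span_scale) blast+
qed

lemma monomial_quasi_invariants_sub: "monomial_quasi_invariants r n l \<subseteq> quasi_invariants r n l"
proof
  fix p assume "p \<in> monomial_quasi_invariants r n l"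
  then show "p \<in> quasi_invariants r n l"
    unfolding quasi_invariants_def
    by (intro CollectI exI[of _ "{p}"] exI[of _ "\<lambda>_. 1"]) simp
qed

lemma J_W_ideal: "ideal (J_W r n l) (poly_ring l n)"
  unfolding J_W_def using quasi_invariants_span by (intro P.genideal_ideal) blast

text \<open>The right side is an ideal containing the generators. It exhibits the elements of
  \<open>J_W\<close> as sums of homogeneous ones, whose parts can then be projected out.\<close>

lemma J_W_sub: "J_W r n l \<subseteq> poly_carrier l n \<inter> Q.span (\<Union>e. hideal n r e)"
  unfolding J_W_def
proof (rule P.genideal_minimal[OF _ quasi_invariants_span])
  let ?K = "poly_carrier l n \<inter> Q.span (\<Union>e. hideal n r e)"
  show "ideal ?K (poly_ring l n)"
  proof (rule idealI)
    show "subgroup ?K (add_monoid (poly_ring l n))"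
    proof (rule P.add.subgroupI)
      fix a assume a: "a \<in> ?K"
      then have "- a \<in> ?K" using poly_carrier_uminus Q.span_neg by blast
      then show "\<ominus>\<^bsub>poly_ring l n\<^esub> a \<in> ?K" using P_a_inv a by simp
    next
      show "?K \<noteq> {}" using poly_carrier_0 Q.span_zero by blast
    qed (auto simp: poly_carrier_add Q.span_add)
  next
    fix a x assume ax: "a \<in> ?K" "x \<in> poly_carrier l n"
    then have "x * a \<in> ?K" using span_hideal_times[of x l n a r] poly_carrier_mult by blast
    then show "x \<otimes>\<^bsub>poly_ring l n\<^esub> a \<in> ?K" "a \<otimes>\<^bsub>poly_ring l n\<^esub> x \<in> ?K"
      by (simp_all add: mult.commute)
  qed (rule P.ring_axioms)
qed

lemma J_W_mult: "p \<in> J_W r n l \<Longrightarrow> a \<in> poly_carrier l n \<Longrightarrow> a * p \<in> J_W r n l"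
  using ideal.I_l_closed[OF J_W_ideal] by simp

lemma J_W_add: "p \<in> J_W r n l \<Longrightarrow> q \<in> J_W r n l \<Longrightarrow> p + q \<in> J_W r n l"
  using additive_subgroup.a_closed[OF ideal.axioms(1)[OF J_W_ideal]] by simp

lemma J_W_0: "0 \<in> J_W r n l"
  using additive_subgroup.zero_closed[OF ideal.axioms(1)[OF J_W_ideal]] by simp

lemma subspace_J_W: "Q.subspace (J_W r n l)"
  by (simp add: Q.subspace_def J_W_0 J_W_add qscale_def J_W_mult poly_carrier_pconst)

lemma homogeneous_hpoly:
  assumes "Poly_Mapping.keys d \<subseteq> {..<l}"
  shows "homogeneous_polys n l d = hpoly n d"
proof -
  have "Poly_Mapping.keys m \<subseteq> {..<l} \<times> {..<n} \<and> (\<forall>i. (\<Sum>j<n. lk m (i, j)) = lk d i) \<longleftrightarrow> has_wt n d m" for m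
  proof
    assume h: "Poly_Mapping.keys m \<subseteq> {..<l} \<times> {..<n} \<and> (\<forall>i. (\<Sum>j<n. lk m (i, j)) = lk d i)"
    then have "lk m (i, j) = 0" if "n \<le> j" for i j
      using that by (force simp: in_keys_iff)
    then show "has_wt n d m" using h by (simp add: has_wt_def)
  next
    assume h: "has_wt n d m"
    have "i < l \<and> j < n" if "lk m (i, j) \<noteq> 0" for i j
    proof
      show j: "j < n" using h that by (meson has_wt_def not_le)
      have "(\<Sum>j<n. lk m (i, j)) \<noteq> 0" using that j by (auto intro!: bexI[of _ j])
      moreover have "(\<Sum>j<n. lk m (i, j)) = lk d i" using h by (simp add: has_wt_def)
      ultimately have "i \<in> Poly_Mapping.keys d" by (simp add: in_keys_iff)
      then show "i < l" using assms by auto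
    qed
    then show "Poly_Mapping.keys m \<subseteq> {..<l} \<times> {..<n} \<and> (\<forall>i. (\<Sum>j<n. lk m (i, j)) = lk d i)"
      using h by (auto simp: has_wt_def in_keys_iff)
  qed
  then show ?thesis unfolding homogeneous_polys_def hpoly_supported_on poly_carrier_supported_on supported_on_def by blast
qed

lemma hpoly_poly_carrier: "Poly_Mapping.keys d \<subseteq> {..<l} \<Longrightarrow> hpoly n d \<subseteq> poly_carrier l n"
  unfolding homogeneous_hpoly[symmetric] homogeneous_polys_def by blast

lemma keys_add_nat: "Poly_Mapping.keys (d + e) = Poly_Mapping.keys d \<union> Poly_Mapping.keys (e :: _ \<Rightarrow>\<^sub>0 nat)"
  by (auto simp: in_keys_iff lookup_add)

text \<open>One inclusion is projection to degree \<open>d\<close>. For the other, weights add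
  without cancellation, so a spanning element of weight \<open>d\<close> involves only rows below
  \<open>l\<close> and its list consists of columns of an admissible matrix or is too long and gives
  zero.\<close>

lemma J_W_hpoly:
  assumes d: "Poly_Mapping.keys d \<subseteq> {..<l}"
  shows "J_W r n l \<inter> hpoly n d = hideal n r d"
proof (intro equalityI subsetI)
  fix f assume "f \<in> J_W r n l \<inter> hpoly n d"
  then have f: "f \<in> J_W r n l" "f \<in> hpoly n d" by auto
  then have "f \<in> Q.span (\<Union>e. hideal n r e)" using J_W_sub by blast
  then have "homogeneous_part n d f \<in> hideal n r d" by (rule homogeneous_part_hideal)
  moreover have "homogeneous_part n d f = f" using f(2) by (rule homogeneous_part_id)
  ultimately show "f \<in> hideal n r d" by simp
next
  fix f assume f: "f \<in> hideal n r d"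
  have "hideal n r d \<subseteq> J_W r n l"
    unfolding hideal_def
  proof (rule Q.span_minimal[OF _ subspace_J_W], safe)
    fix m as e assume m: "has_wt n e m" and g: "good_columns r as" and de: "d = e + sum_list as"
    have rows: "Poly_Mapping.keys e \<subseteq> {..<l}" "Poly_Mapping.keys (sum_list as) \<subseteq> {..<l}"
      using d by (auto simp: de keys_add_nat)
    have "Poly_Mapping.keys \<alpha> \<subseteq> Poly_Mapping.keys (sum_list as)" if "\<alpha> \<in> set as" for \<alpha>
      using that by (induction as) (auto simp: keys_add_nat)
    then have r2: "\<forall>\<alpha>\<in>set as. Poly_Mapping.keys \<alpha> \<subseteq> {..<l}" using rows(2) by blast
    have "monomial_sum n (map colmon as) \<in> J_W r n l"
    proof (cases "length as \<le> n")
      case True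
      have "quasi_invariants r n l \<subseteq> J_W r n l"
        unfolding J_W_def using quasi_invariants_span by (intro P.genideal_self) blast
      then show ?thesis using monomial_sum_quasi_invariant[OF g r2 True] monomial_quasi_invariants_sub by blast
    qed (simp add: monomial_sum_long J_W_0)
    then show "sgl m 1 * monomial_sum n (map colmon as) \<in> J_W r n l"
      using hpoly_poly_carrier[OF rows(1)] hpoly_single[OF m] by (intro J_W_mult) auto
  qed
  then show "f \<in> J_W r n l \<inter> hpoly n d" using f hideal_hpoly by blast
qed

lemma hideal_0: "hideal n r 0 = {0}"
proof -
  have "{sgl m 1 * monomial_sum n (map colmon as) | m as e. has_wt n e m \<and> good_columns r as \<and> e + sum_list as = 0} = {}"
  proof (rule ccontr)
    assume "\<not> ?thesis"
    then obtain as e where as: "good_columns r as" "e + sum_list as = 0" by blast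
    then have "total_degree (sum_list as) = 0" using total_degree_add[of e "sum_list as"] by simp
    then have "\<forall>\<alpha>\<in>set as. total_degree \<alpha> = 0" by (simp add: total_degree_sum_list)
    then show False using as(1) by (cases as) (auto simp: good_columns_def)
  qed
  then show ?thesis by (simp only: hideal_def Q.span_empty)
qed

text \<open>Makes the quotient nonzero, so that the image of the constants is a field and dimensions
  over it make sense.\<close>

lemma one_notin_J_W: "1 \<notin> J_W r n l"
proof
  assume "1 \<in> J_W r n l"
  then have "1 \<in> J_W r n l \<inter> hpoly n 0" using hpoly_pconst[of 1 n] by simp
  then show False using J_W_hpoly[of 0 l] by (simp add: hideal_0)
qed

section \<open>Dimensions in the ring and in the vector space\<close>

lemma subfield_pconst: "subfield (range pconst) (poly_ring l n)"
proof (rule P.subfieldI)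
  have "subring (range pconst) (poly_ring l n)"
  proof (rule P.subringI)
    show "range pconst \<subseteq> poly_carrier l n" using poly_carrier_pconst by blast
    show "\<one>\<^bsub>poly_ring l n\<^esub> \<in> range pconst" by (simp add: range_eqI[of _ _ 1])
    fix h1 h2 :: mpoly assume "h1 \<in> range pconst" "h2 \<in> range pconst"
    then obtain a b where ab: "h1 = pconst a" "h2 = pconst b" by blast
    show "h1 \<otimes>\<^bsub>poly_ring l n\<^esub> h2 \<in> range pconst" "h1 \<oplus>\<^bsub>poly_ring l n\<^esub> h2 \<in> range pconst"
      using rangeI[of pconst "a * b"] rangeI[of pconst "a + b"] by (simp_all add: ab pconst_add pconst_mult)
    show "\<ominus>\<^bsub>poly_ring l n\<^esub> h1 \<in> range pconst"
      using rangeI[of pconst "- a"] poly_carrier_pconst by (simp add: ab P_a_inv pconst_def single_uminus)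
  qed
  then show "subcring (range pconst) (poly_ring l n)" by (rule P.subcringI')
  show "Units (poly_ring l n\<lparr>carrier := range pconst\<rparr>) = range pconst - {\<zero>\<^bsub>poly_ring l n\<^esub>}"
  proof (intro equalityI subsetI)
    fix u :: mpoly assume "u \<in> range pconst - {\<zero>\<^bsub>poly_ring l n\<^esub>}"
    then obtain a where a: "u = pconst a" "a \<noteq> 0" by force
    have "pconst (inverse a) * u = 1" "u * pconst (inverse a) = 1"
      using a by (simp_all flip: pconst_mult)
    then show "u \<in> Units (poly_ring l n\<lparr>carrier := range pconst\<rparr>)"
      using a by (auto simp: Units_def)
  qed (auto simp: Units_def)
qed

text \<open>The two notions of dimension agree because a line extension is the span of one more
  vector.\<close>

lemma dimension_span:
  assumes "finite B" "Q.independent B" "B \<subseteq> poly_carrier l n"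
  shows "ring.dimension (poly_ring l n) (card B) (range pconst) (Q.span B)"
  using assms
proof (induction B rule: finite_induct)
  case empty
  then show ?case using P.zero_dim[of l n "range pconst"] by simp
next
  case (insert b B)
  have b: "b \<notin> Q.span B" "Q.independent B"
    using insert(2,4) by (auto simp: Q.independent_insert)
  have "ring.dimension (poly_ring l n) (Suc (card B)) (range pconst) (P.line_extension l n (range pconst) b (Q.span B))"
    using insert b by (intro P.Suc_dim) auto
  moreover have "P.line_extension l n (range pconst) b (Q.span B) = Q.span (insert b B)"
  proof (intro equalityI subsetI)
    fix x assume "x \<in> P.line_extension l n (range pconst) b (Q.span B)"
    then obtain c u where x: "x = pconst c * b + u" "u \<in> Q.span B"
      unfolding P.line_extension_def set_add_def' r_coset_def by auto
    have "u \<in> Q.span (insert b B)" using x(2) Q.span_mono[of B "insert b B"] by blast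
    then have "qscale c b + u \<in> Q.span (insert b B)"
      by (intro Q.span_add Q.span_scale) (auto intro: Q.span_base)
    then show "x \<in> Q.span (insert b B)" by (simp add: x qscale_def)
  next
    fix x assume "x \<in> Q.span (insert b B)"
    then obtain c where "x - qscale c b \<in> Q.span B" using Q.span_breakdown_eq by blast
    then show "x \<in> P.line_extension l n (range pconst) b (Q.span B)"
      unfolding P.line_extension_def set_add_def' r_coset_def
      by (auto simp: qscale_def intro!: bexI[of _ "x - qscale c b"] exI[of _ c])
  qed
  ultimately show ?case using insert by simp
qed

lemma dimension_subspace:
  assumes "Q.subspace V" "Q.fin_spanned V" "V \<subseteq> poly_carrier l n"
  shows "ring.dimension (poly_ring l n) (Q.dim V) (range pconst) V"
proof -
  have "Q.span (Q.some_basis V) = V"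
    using Q.some_basis(1,3)[of V] Q.span_minimal[OF Q.some_basis(1) assms(1)] by blast
  then show ?thesis
    using dimension_span[OF Q.finite_some_basis[OF assms(2)] Q.some_basis(2), of l n] Q.some_basis(1)[of V] Q.some_basis(4)[of V] assms(3)
    by auto
qed

text \<open>Rank-nullity for the quotient map on a homogeneous component, where its kernel is
  \<open>hideal n r d\<close>. A degree that involves further rows admits only the zero
  polynomial.\<close>

theorem hilbert_series_dims:
  "hilbert_series r n l d =
    (if Poly_Mapping.keys d \<subseteq> {..<l} then int (Q.dim (hpoly n d)) - int (Q.dim (hideal n r d)) else 0)"
proof -
  let ?R = "poly_ring l n" and ?J = "J_W r n l"
  let ?S = "co_quasi_invariants r n l"
  let ?h = "\<lambda>p. ?J +>\<^bsub>?R\<^esub> p"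
  have S: "?S = ?R Quot ?J" by (simp add: co_quasi_invariants_def)
  interpret J: ideal ?J ?R by (rule J_W_ideal)
  interpret h: ring_hom_ring ?R ?S ?h unfolding S by (rule J.rcos_ring_hom_ring)
  have zero: "\<zero>\<^bsub>?S\<^esub> = ?J" by (simp add: S FactRing_def)
  have ker: "?h p = ?J \<longleftrightarrow> p \<in> ?J" if "p \<in> poly_carrier l n" for p
    using P.a_coset_join1[OF _ that J.a_subgroup] P.a_coset_join2[OF that J.a_subgroup] by blast
  have one: "\<one>\<^bsub>?S\<^esub> \<noteq> \<zero>\<^bsub>?S\<^esub>"
    using ker[OF poly_carrier_1] one_notin_J_W unfolding zero by (simp add: S FactRing_def)
  have sub: "subfield (?h ` range pconst) ?S"
    by (rule h.img_is_subfield(2)[OF subfield_pconst one])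
  have hs: "hilbert_series r n l d = int (ring.dim ?S (?h ` range pconst) (?h ` homogeneous_polys n l d))"
    by (simp add: hilbert_series_def proj_image_def)
  show ?thesis
  proof (cases "Poly_Mapping.keys d \<subseteq> {..<l}")
    case True
    note hom = homogeneous_hpoly[OF True, of n]
    have "a_kernel (?R\<lparr>carrier := hpoly n d\<rparr>) ?S ?h = hideal n r d"
    proof -
      have "a_kernel (?R\<lparr>carrier := hpoly n d\<rparr>) ?S ?h = {x \<in> hpoly n d. ?h x = ?J}"
        unfolding a_kernel_def' zero by (simp only: poly_ring_def partial_object.update_convs partial_object.simps)
      also have "\<dots> = ?J \<inter> hpoly n d" using ker[OF subsetD[OF hpoly_poly_carrier[OF True]]] by auto
      finally show ?thesis using J_W_hpoly[OF True] by simp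
    qed
    moreover have "ring.dimension ?R (Q.dim (hpoly n d)) (range pconst) (hpoly n d)"
      by (rule dimension_subspace[OF subspace_hpoly fin_spanned_hpoly hpoly_poly_carrier[OF True]])
    moreover have "ring.dimension ?R (Q.dim (hideal n r d)) (range pconst) (hideal n r d)"
      by (rule dimension_subspace[OF subspace_hideal hideal.fin_U]) (use hpoly_poly_carrier[OF True] hideal_hpoly in blast)
    ultimately have "ring.dimension ?S (Q.dim (hpoly n d) - Q.dim (hideal n r d)) (?h ` range pconst) (?h ` hpoly n d)"
      by (intro h.rank_nullity_theorem[OF subfield_pconst one]) simp_all
    then have "ring.dim ?S (?h ` range pconst) (?h ` hpoly n d) = Q.dim (hpoly n d) - Q.dim (hideal n r d)"
      using h.S.dimI[OF sub] by (simp add: over_def)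
    moreover have "Q.dim (hideal n r d) \<le> Q.dim (hpoly n d)"
      by (rule Q.dim_mono_fin[OF hideal_hpoly fin_spanned_hpoly])
    ultimately show ?thesis using True hom hs by simp
  next
    case False
    then obtain i where i: "lk d i \<noteq> 0" "\<not> i < l" by (auto simp: in_keys_iff)
    have "homogeneous_polys n l d = {0}"
    proof (intro equalityI subsetI)
      fix p assume p: "p \<in> homogeneous_polys n l d"
      have "Poly_Mapping.keys p = {}"
      proof (rule ccontr)
        assume "Poly_Mapping.keys p \<noteq> {}"
        then obtain m where m: "m \<in> Poly_Mapping.keys p" by blast
        then have "lk m (i, j) = 0" for j
          using p i(2) by (fastforce simp: homogeneous_polys_def poly_carrier_supported_on supported_on_def in_keys_iff)
        then have "(\<Sum>j<n. lk m (i, j)) = 0" by simp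
        moreover have "(\<Sum>j<n. lk m (i, j)) = lk d i" using p m by (simp add: homogeneous_polys_def)
        ultimately show False using i(1) by simp
      qed
      then show "p \<in> {0}" by simp
    qed (simp add: homogeneous_polys_def poly_carrier_0)
    then have "?h ` homogeneous_polys n l d = {\<zero>\<^bsub>?S\<^esub>}" using ker[OF poly_carrier_0] J_W_0 zero by simp
    then have "ring.dimension ?S 0 (?h ` range pconst) (?h ` homogeneous_polys n l d)" by simp
    then have "ring.dim ?S (?h ` range pconst) (?h ` homogeneous_polys n l d) = 0"
      using h.S.dimI[OF sub] by (simp add: over_def)
    then show ?thesis using False hs by simp
  qed
qed

section \<open>Schur expansion of the Hilbert series\<close>

definition swap_vars :: "nat \<Rightarrow> nat \<Rightarrow> 'a::comm_ring_1 qpoly \<Rightarrow> 'a qpoly" where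
  "swap_vars p q f = Poly_Mapping.map_key (swap_wt p q) f"

lemma swap_wt_invol [simp]: "swap_wt p q (swap_wt p q d) = d"
  by (rule poly_mapping_eqI) (simp add: lookup_swap_wt)

lemma inj_swap_wt: "inj (swap_wt p q)"
  by (rule inj_on_inverseI[where g = "swap_wt p q"]) simp

lemma lookup_swap_vars: "lk (swap_vars p q f) d = lk f (swap_wt p q d)"
  by (simp add: swap_vars_def map_key.rep_eq inj_swap_wt)

lemma swap_vars_single: "swap_vars p q (sgl d c) = sgl (swap_wt p q d) c"
proof (rule poly_mapping_eqI)
  fix e
  have "d = swap_wt p q e \<longleftrightarrow> swap_wt p q d = e" by (metis swap_wt_invol)
  then show "lk (swap_vars p q (sgl d c)) e = lk (sgl (swap_wt p q d) c) e"
    by (simp add: lookup_swap_vars lookup_single when_def)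
qed

lemma swap_vars_add: "swap_vars p q (f + g) = swap_vars p q f + swap_vars p q g"
  by (rule poly_mapping_eqI) (simp add: lookup_swap_vars lookup_add)

lemma swap_vars_sum: "swap_vars p q (sum f A) = (\<Sum>x\<in>A. swap_vars p q (f x))"
  by (rule poly_mapping_eqI) (simp add: lookup_swap_vars lookup_sum)

lemma swap_vars_mult: "swap_vars p q (f * g) = swap_vars p q f * swap_vars p q g"
proof (induction f rule: pm_induct)
  case (single m c)
  show ?case
    by (induction g rule: pm_induct) (simp_all add: mult_single swap_vars_single swap_wt_add swap_vars_add distrib_left)
qed (simp add: swap_vars_add distrib_right)

text \<open>Reindexing the permutations by composition with the transposition flips every
  sign.\<close>

lemma swap_vars_alternant:
  assumes "a < l" "b < l" "a \<noteq> b"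
  shows "swap_vars a b (alternant l k) = - (alternant l k :: 'a::comm_ring_1 qpoly)"
proof -
  let ?s = "Transposition.transpose a b"
  have s: "?s permutes {..<l}" using assms by (intro permutes_swap_id) auto
  have w: "swap_wt a b (weight_vec l f) = weight_vec l (f \<circ> ?s)" for f
    using assms by (intro poly_mapping_eqI) (auto simp: lookup_swap_wt lookup_weight_vec transpose_def)
  have sg: "sign (p \<circ> ?s) = - sign p" if "p permutes {..<l}" for p
  proof -
    have "sign (p \<circ> ?s) = sign p * sign ?s"
      using permutes_imp_permutation[OF _ that] permutes_imp_permutation[OF _ s] by (intro sign_compose) auto
    then show ?thesis using assms(3) by (simp add: sign_swap_id)
  qed
  have "swap_vars a b (alternant l k) = (\<Sum>p | p permutes {..<l}. sgl (weight_vec l (k \<circ> p \<circ> ?s)) (of_int (sign p) :: 'a))"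
    unfolding alternant_expand swap_vars_sum swap_vars_single w ..
  also have "\<dots> = (\<Sum>p | p permutes {..<l}. sgl (weight_vec l (k \<circ> (p \<circ> ?s) \<circ> ?s)) (of_int (sign (p \<circ> ?s)) :: 'a))"
    by (rule sum.reindex_bij_witness[where i = "\<lambda>p. p \<circ> ?s" and j = "\<lambda>p. p \<circ> ?s"])
       (simp_all add: o_assoc[symmetric] permutes_compose[OF s])
  also have "\<dots> = (\<Sum>p | p permutes {..<l}. - sgl (weight_vec l (k \<circ> p)) (of_int (sign p) :: 'a))"
    by (intro sum.cong refl) (simp add: o_assoc[symmetric] sg single_uminus)
  finally show ?thesis by (simp add: alternant_expand sum_negf)
qed

lemma strictly_decreasing_split:
  assumes keys: "Poly_Mapping.keys d \<subseteq> {..<l}" and dec: "\<And>i. Suc i < l \<Longrightarrow> lk d (Suc i) < lk d i"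
  shows "\<exists>e N. e \<in> weights l N \<and> dominant l e \<and> d = e + weight_vec l (staircase l)"
proof -
  have ge: "staircase l i \<le> lk d i" if "i < l" for i
    using that
  proof (induction "l - i" arbitrary: i)
    case (Suc m)
    show ?case
    proof (cases "Suc i < l")
      case True
      then have "staircase l (Suc i) \<le> lk d (Suc i)" using Suc.hyps(1)[of "Suc i"] Suc.hyps(2) by simp
      then show ?thesis using dec[OF True] True by (simp add: staircase_def)
    qed (use Suc in \<open>simp add: staircase_def\<close>)
  qed simp
  define e where "e = d - weight_vec l (staircase l)"
  have d: "d = e + weight_vec l (staircase l)"
    by (rule poly_mapping_eqI) (use ge in \<open>auto simp: e_def lookup_add lookup_minus lookup_weight_vec\<close>)
  have "Poly_Mapping.keys e \<subseteq> {..<l}" using keys by (auto simp: d keys_add_nat)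
  then have "e \<in> weights l (\<Sum>i<l. lk e i)" by (simp add: weights_def)
  moreover have "dominant l e"
    unfolding dominant_def
  proof (intro allI impI)
    fix i assume i: "Suc i < l"
    have "staircase l i = Suc (staircase l (Suc i))" using i by (simp add: staircase_def)
    moreover have "lk d i = lk e i + staircase l i" "lk d (Suc i) = lk e (Suc i) + staircase l (Suc i)"
      using i by (simp_all add: d lookup_add lookup_weight_vec)
    ultimately show "lk e (Suc i) \<le> lk e i" using dec[OF i] by simp
  qed
  ultimately show ?thesis using d by blast
qed

text \<open>Exchanging an ascent leads to a higher weight and negates the coefficient, and equal
  neighbours make a coefficient its own negative. There remain the strictly decreasing exponents,
  each a dominant weight plus the staircase.\<close>

lemma antisymmetric_zero:
  fixes f :: "int qpoly"
  assumes anti: "\<And>a b. a < l \<Longrightarrow> b < l \<Longrightarrow> a \<noteq> b \<Longrightarrow> swap_vars a b f = - f"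
    and keys: "\<And>d. lk f d \<noteq> 0 \<Longrightarrow> Poly_Mapping.keys d \<subseteq> {..<l}"
    and lead: "\<And>e N. e \<in> weights l N \<Longrightarrow> dominant l e \<Longrightarrow> lk f (e + weight_vec l (staircase l)) = 0"
  shows "f = 0"
proof (rule poly_mapping_eqI)
  fix d
  have "lk f d = 0" if "d \<in> weights l N" for N d
    using that
  proof (induction "l * N - height l d" arbitrary: d rule: less_induct)
    case less
    show ?case
    proof (cases "\<forall>i. Suc i < l \<longrightarrow> lk d (Suc i) < lk d i")
      case True
      then show ?thesis using strictly_decreasing_split[of d l] lead less.prems by (auto simp: weights_def)
    next
      case False
      then obtain i where i: "Suc i < l" "lk d i \<le> lk d (Suc i)" by (auto simp: not_less)
      have sw: "lk f (swap_wt i (Suc i) d) = - lk f d"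
        using anti[of i "Suc i"] i by (metis Suc_lessD lookup_swap_vars lookup_uminus n_not_Suc_n)
      show ?thesis
      proof (cases "lk d i = lk d (Suc i)")
        case True
        then have "swap_wt i (Suc i) d = d" by (intro poly_mapping_eqI) (auto simp: lookup_swap_wt transpose_def)
        then show ?thesis using sw by simp
      next
        case False
        then have lt: "lk d i < lk d (Suc i)" using i by simp
        note k = swap_wt_dom[OF less.prems i(1) lt]
        have "lk f (swap_wt i (Suc i) d) = 0"
          using less.hyps[OF _ k(2)] height_strict[OF k(1) k(3)[symmetric] less.prems k(2)] height_bound[OF k(2)] by simp
        then show ?thesis using sw by simp
      qed
    qed
  qed
  then have "lk f d = 0" if "Poly_Mapping.keys d \<subseteq> {..<l}" using that by (auto simp: weights_def)
  then show "lk f d = lk 0 d" using keys by force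
qed

text \<open>Among the permuted exponents of the alternant only the unpermuted one is strictly
  decreasing.\<close>

lemma alternant_leading:
  assumes m: "\<And>i. Suc i < l \<Longrightarrow> m (Suc i) \<le> m i" and e: "e \<in> weights l N" "dominant l e"
  shows "lk (alternant l (\<lambda>j. m j + staircase l j) :: 'a::comm_ring_1 qpoly) (e + weight_vec l (staircase l)) = (if \<forall>i<l. m i = lk e i then 1 else 0)"
proof -
  let ?k = "\<lambda>j. m j + staircase l j" and ?d = "e + weight_vec l (staircase l)"
  have dec: "f j + staircase l j < f i + staircase l i" if "\<And>i. Suc i < l \<Longrightarrow> f (Suc i) \<le> f i" "i < j" "j < l" for f i j
    using that(2,3)
  proof (induction rule: strict_inc_induct)
    case (base i)
    then have "staircase l i = Suc (staircase l j)" by (auto simp: staircase_def)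
    then show ?case using that(1)[of i] base by simp
  next
    case (step i)
    then have "f (Suc i) + staircase l (Suc i) < f i + staircase l i" using that(1)[of i] by (simp add: staircase_def)
    then show ?case using step by simp
  qed
  have tm: "weight_vec l (?k \<circ> p) = ?d \<longleftrightarrow> p = id \<and> (\<forall>i<l. m i = lk e i)" if p: "p permutes {..<l}" for p
  proof
    assume eq: "weight_vec l (?k \<circ> p) = ?d"
    have eq': "?k (p i) = lk e i + staircase l i" if "i < l" for i
      using arg_cong[OF eq, of "\<lambda>d. lk d i"] that by (simp add: lookup_weight_vec lookup_add)
    have pl: "p i < l" if "i < l" for i using permutes_in_image[OF p, of i] that by simp
    have mono: "p i < p j" if "i < j" "j < l" for i j
    proof (rule ccontr)
      assume "\<not> p i < p j"
      then have "?k (p i) \<le> ?k (p j)"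
        using dec[of m "p j" "p i"] m pl that by (cases "p i = p j") force+
      moreover have "lk e j + staircase l j < lk e i + staircase l i"
        using dec[of "lk e"] e(2) that by (auto simp: dominant_def)
      ultimately show False using eq'[of i] eq'[of j] that by simp
    qed
    have ge: "i \<le> p i" if "i < l" for i
      using that
    proof (induction i)
      case (Suc i)
      then show ?case using mono[of i "Suc i"] by simp
    qed simp
    \<comment> \<open>A permutation with \<open>i \<le> p i\<close> throughout is the identity,
      since both sides have the same sum.\<close>
    have "(\<Sum>i<l. i) = (\<Sum>i<l. p i)" using sum.permute[OF p, of id] by (simp add: o_def)
    then have "i = p i" if "i < l" for i using sum_mono_inv[of "\<lambda>i. i" "{..<l}" p i] ge that by simp
    then have "p = id" using permutes_not_in[OF p] by (intro ext) (metis id_apply lessThan_iff)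
    then show "p = id \<and> (\<forall>i<l. m i = lk e i)" using eq' by simp
  next
    assume h: "p = id \<and> (\<forall>i<l. m i = lk e i)"
    show "weight_vec l (?k \<circ> p) = ?d"
      using h weights_zero_outside[OF e(1)] by (intro poly_mapping_eqI) (auto simp: lookup_weight_vec lookup_add)
  qed
  have "lk (alternant l ?k :: 'a qpoly) ?d = (\<Sum>p | p permutes {..<l}. if p = id then (if \<forall>i<l. m i = lk e i then 1 else 0) else 0)"
    unfolding alternant_expand lookup_sum by (intro sum.cong refl) (auto simp: lookup_single when_def tm)
  then show ?thesis by (simp add: finite_permutations permutes_id)
qed

lemma lookup_sgl_times:
  fixes m :: "'v \<Rightarrow>\<^sub>0 nat"
  shows "lk (sgl m c * X) d = (if \<forall>i. lk m i \<le> lk d i then c * lk (X :: _ \<Rightarrow>\<^sub>0 'a::comm_ring_1) (d - m) else 0)"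
proof (cases "\<forall>i. lk m i \<le> lk d i")
  case True
  then have "d = m + (d - m)" by (intro poly_mapping_eqI) (simp add: lookup_add lookup_minus)
  then show ?thesis using lookup_sgl_times_add[of m c X "d - m"] True by simp
next
  case False
  then obtain i where "lk d i < lk m i" by (auto simp: not_le)
  then show ?thesis unfolding if_not_P[OF False] by (rule lookup_sgl_times_eq_0)
qed

lemma lookup_vandermonde_times:
  "lk (vandermonde l * X) d = (\<Sum>p | p permutes {..<l}. of_int (sign p) *
     (if \<forall>i. lk (weight_vec l (staircase l \<circ> p)) i \<le> lk d i then lk X (d - weight_vec l (staircase l \<circ> p)) else (0::'a::comm_ring_1)))"
  unfolding alternant_staircase[symmetric] alternant_expand sum_distrib_right lookup_sum lookup_sgl_times
  by (intro sum.cong refl) auto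

text \<open>Carries the character identities, which come from traces over the rationals, back to
  integer coefficients.\<close>

lemma lookup_vandermonde_times_of_int:
  "(\<And>d. of_int (lk X d) = lk Y d) \<Longrightarrow> (of_int (lk (vandermonde l * X) d) :: 'a::comm_ring_1) = lk (vandermonde l * Y) d"
  unfolding lookup_vandermonde_times of_int_sum by (intro sum.cong refl) simp

text \<open>A permuted staircase has the same total degree, so each homogeneous part of the
  character contributes in its own degree only.\<close>

lemma vandermonde_weight_series_degree:
  assumes "lk (vandermonde l * weight_series l N f) (e + weight_vec l (staircase l)) \<noteq> (0::'a::comm_ring_1)" "e \<in> weights l M"
  shows "M = N"
proof -
  let ?d = "e + weight_vec l (staircase l)"
  obtain p where p: "p permutes {..<l}" "\<forall>i. lk (weight_vec l (staircase l \<circ> p)) i \<le> lk ?d i"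
    "lk (weight_series l N f) (?d - weight_vec l (staircase l \<circ> p)) \<noteq> 0"
  proof -
    from sum.not_neutral_contains_not_neutral[OF assms(1)[unfolded lookup_vandermonde_times]] obtain p where
      p: "p permutes {..<l}" and ne: "of_int (sign p) * (if \<forall>i. lk (weight_vec l (staircase l \<circ> p)) i \<le> lk ?d i
        then lk (weight_series l N f) (?d - weight_vec l (staircase l \<circ> p)) else 0) \<noteq> 0" by blast
    from ne have "(if \<forall>i. lk (weight_vec l (staircase l \<circ> p)) i \<le> lk ?d i
        then lk (weight_series l N f) (?d - weight_vec l (staircase l \<circ> p)) else 0) \<noteq> 0"
      by (rule contrapos_nn) (erule ssubst, rule mult_zero_right)
    then show ?thesis using that p by (simp split: if_splits)
  qed
  then have "?d - weight_vec l (staircase l \<circ> p) \<in> weights l N" by (auto simp: lookup_weight_series split: if_splits)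
  then have "N = (\<Sum>i<l. lk (?d - weight_vec l (staircase l \<circ> p)) i)" by (simp add: weights_def)
  then have "N + (\<Sum>i<l. staircase l (p i)) = (\<Sum>i<l. lk (?d - weight_vec l (staircase l \<circ> p)) i + staircase l (p i))" by (simp add: sum.distrib)
  also have "\<dots> = (\<Sum>i<l. lk ?d i)"
  proof (intro sum.cong refl)
    fix i assume "i \<in> {..<l}"
    then show "lk (?d - weight_vec l (staircase l \<circ> p)) i + staircase l (p i) = lk ?d i"
      using spec[OF p(2), of i] by (simp add: lookup_minus lookup_weight_vec)
  qed
  also have "\<dots> = (\<Sum>i<l. lk e i) + (\<Sum>i<l. staircase l i)"
    by (simp add: lookup_add lookup_weight_vec sum.distrib)
  also have "(\<Sum>i<l. staircase l i) = (\<Sum>i<l. staircase l (p i))" using sum.permute[OF p(1), of "staircase l"] by (simp add: o_def)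
  finally show ?thesis using assms(2) by (simp add: weights_def)
qed

context gl_family
begin

text \<open>A row transposition maps one space onto the other; the opposite inequality is the same
  one at the exchanged weight.\<close>

lemma dim_swap: "dim (U (swap_wt p q d)) = dim (U d)"
proof -
  have le: "dim (U (swap_wt p q d)) \<le> dim (U d)" for d
  proof -
    let ?B = "some_basis (U d)"
    interpret tau: module_hom scale scale "tau p q" by (rule tau_hom)
    have "U (swap_wt p q d) \<subseteq> tau p q ` U d"
    proof
      fix v assume "v \<in> U (swap_wt p q d)"
      then have "tau p q v \<in> U (swap_wt p q (swap_wt p q d))" by (rule tau_weight)
      then show "v \<in> tau p q ` U d" using tau_tau[of p q v] by (intro image_eqI[of _ _ "tau p q v"]) simp_all
    qed
    also have "\<dots> \<subseteq> span (tau p q ` ?B)" by (rule tau.spans_image[OF some_basis(3)])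
    finally have "dim (U (swap_wt p q d)) \<le> card (tau p q ` ?B)"
      by (rule dim_le_card) (simp add: finite_some_basis fin_U)
    also have "\<dots> \<le> card ?B" by (rule card_image_le) (simp add: finite_some_basis fin_U)
    finally show ?thesis by (simp add: some_basis(4))
  qed
  from le[of d] le[of "swap_wt p q d"] show ?thesis by simp
qed

end

section \<open>Partitions as dominant weights\<close>

definition part_wt :: "nat list \<Rightarrow> nat \<Rightarrow>\<^sub>0 nat" where
  "part_wt \<mu> = weight_vec (length \<mu>) (nth \<mu>)"

lemma lookup_part_wt: "lk (part_wt \<mu>) i = (if i < length \<mu> then \<mu> ! i else 0)"
  by (simp add: part_wt_def lookup_weight_vec)

lemma part_wt_mono: "is_partition \<mu> \<Longrightarrow> lk (part_wt \<mu>) (Suc i) \<le> lk (part_wt \<mu>) i"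
  by (auto simp: lookup_part_wt is_partition_def sorted_wrt_iff_nth_less)

lemma partition_pos: "is_partition \<mu> \<Longrightarrow> i < length \<mu> \<Longrightarrow> \<mu> ! i \<noteq> 0"
  unfolding is_partition_def by (metis nth_mem)

lemma part_wt_inj:
  assumes "is_partition \<mu>" "is_partition \<nu>" "part_wt \<mu> = part_wt \<nu>"
  shows "\<mu> = \<nu>"
proof -
  have len: "lk (part_wt \<mu>) i \<noteq> 0 \<longleftrightarrow> i < length \<mu>" if "is_partition \<mu>" for \<mu> i
    using partition_pos[OF that] by (simp add: lookup_part_wt)
  have "i < length \<mu> \<longleftrightarrow> i < length \<nu>" for i using len[OF assms(1), of i] len[OF assms(2), of i] assms(3) by simp
  then have l: "length \<mu> = length \<nu>" by (metis linorder_neqE_nat less_irrefl)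
  show ?thesis
  proof (rule nth_equalityI[OF l])
    fix i assume "i < length \<mu>"
    then show "\<mu> ! i = \<nu> ! i" using arg_cong[OF assms(3), of "\<lambda>d. lk d i"] l by (simp add: lookup_part_wt)
  qed
qed

lemma part_wt_surj:
  assumes e: "e \<in> weights l N" "dominant l e"
  shows "\<exists>\<mu>. is_partition \<mu> \<and> part_wt \<mu> = e \<and> sum_list \<mu> = N \<and> length \<mu> \<le> l"
proof -
  have step: "lk e (Suc i) \<le> lk e i" for i
    using e(2) weights_zero_outside[OF e(1), of "Suc i"] by (cases "Suc i < l") (auto simp: dominant_def)
  have anti: "lk e j \<le> lk e i" if "i \<le> j" for i j
    using that by (induction j rule: dec_induct) (auto intro: le_trans[OF step])
  define k where "k = (LEAST i. lk e i = 0)"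
  have zl: "lk e l = 0" using weights_zero_outside[OF e(1)] by simp
  have kz: "lk e k = 0" unfolding k_def by (rule LeastI[of "\<lambda>i. lk e i = 0", OF zl])
  have kl: "k \<le> l" unfolding k_def by (rule Least_le[of "\<lambda>i. lk e i = 0", OF zl])
  have pos: "lk e i \<noteq> 0" if "i < k" for i using not_less_Least that unfolding k_def by blast
  have zero: "lk e i = 0" if "k \<le> i" for i using anti[OF that] kz by simp
  let ?\<mu> = "map (lk e) [0..<k]"
  have "is_partition ?\<mu>"
    unfolding is_partition_def
  proof
    show "sorted_wrt (\<ge>) ?\<mu>" using anti by (simp add: sorted_wrt_iff_nth_less)
    show "0 \<notin> set ?\<mu>" using pos by force
  qed
  moreover have "part_wt ?\<mu> = e" by (rule poly_mapping_eqI) (simp add: lookup_part_wt zero)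
  moreover have "sum_list ?\<mu> = N"
  proof -
    have "sum_list ?\<mu> = (\<Sum>i<k. lk e i)" by (simp add: sum_list_distinct_conv_sum_set atLeast0LessThan)
    also have "\<dots> = (\<Sum>i<l. lk e i)" using kl zero by (intro sum.mono_neutral_left) auto
    finally show ?thesis using e(1) by (simp add: weights_def)
  qed
  ultimately show ?thesis using kl by auto
qed

lemma schur_schurf:
  assumes "length \<mu> \<le> l"
  shows "schur l \<mu> = schurf l (lk (part_wt \<mu>))"
proof -
  have "young_diagram \<mu> = diagram (lk (part_wt \<mu>)) l"
    using assms by (auto simp: young_diagram_def diagram_def lookup_part_wt split: if_splits)
  then show ?thesis by (simp add: schur_def schurf_def semistandard_tableaux_def ssyt_def)
qed

text \<open>The first column would have to hold more than \<open>l\<close> strictly increasing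
  entries below \<open>l\<close>.\<close>

lemma schur_long:
  assumes "is_partition \<mu>" "l < length \<mu>"
  shows "schur l \<mu> = 0"
proof -
  have mem: "(a, 0) \<in> young_diagram \<mu>" if "a < length \<mu>" for a
    using that partition_pos[OF assms(1) that] by (simp add: young_diagram_def)
  have "semistandard_tableaux l \<mu> = {}"
  proof (rule ccontr)
    assume "\<not> ?thesis"
    then obtain T where T: "T \<in> semistandard_tableaux l \<mu>" by blast
    have "a \<le> T (a, 0)" if "a < length \<mu>" for a
      using that
    proof (induction a)
      case (Suc a)
      then have "T (a, 0) < T (Suc a, 0)" using T mem[of "Suc a"] by (auto simp: semistandard_tableaux_def)
      then show ?case using Suc by simp
    qed simp
    from this[OF assms(2)] have "l \<le> T (l, 0)" .
    moreover have "T (l, 0) < l" using T mem[OF assms(2)] by (auto simp: semistandard_tableaux_def)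
    ultimately show False by simp
  qed
  then show ?thesis by (simp add: schur_def)
qed

lemma supported_on_iff: "f \<in> supported_on Q \<longleftrightarrow> (\<forall>m. lk f m \<noteq> 0 \<longrightarrow> Q m)"
  by (simp add: supported_on_def in_keys_iff Ball_def)

lemma finite_partitions: "finite {\<mu>. is_partition \<mu> \<and> length \<mu> \<le> n \<and> sum_list \<mu> \<le> D}"
proof (rule finite_subset)
  show "{\<mu>. is_partition \<mu> \<and> length \<mu> \<le> n \<and> sum_list \<mu> \<le> D} \<subseteq> {xs. set xs \<subseteq> {..D} \<and> length xs \<le> n}"
    using member_le_sum_list by fastforce
qed (rule finite_lists_length_le, simp)

lemma vandermonde_nonzero: "(vandermonde l :: int qpoly) \<noteq> 0"
proof -
  have "pvar i \<noteq> (pvar j :: int qpoly)" if "i < j" for i j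
  proof
    assume "pvar i = (pvar j :: int qpoly)"
    then have "lk (pvar i :: int qpoly) (sgl i 1) = lk (pvar j) (sgl i 1)" by simp
    moreover have "sgl j (1::nat) \<noteq> sgl i 1"
    proof
      assume "sgl j (1::nat) = sgl i 1"
      then have "lk (sgl j (1::nat)) i = lk (sgl i 1) i" by simp
      then show False using that by (simp add: lookup_single)
    qed
    ultimately show False by (simp add: pvar_def lookup_single)
  qed
  then show ?thesis unfolding vandermonde_def by (auto simp: prod_zero_iff)
qed

section \<open>Multiplicities and the final comparison\<close>

definition highest :: "nat \<Rightarrow> mpoly set \<Rightarrow> mpoly set" where
  "highest n V = {v \<in> V. \<forall>a b. a < b \<longrightarrow> polarize n a b v = 0}"

text \<open>The coefficients of the expansion. The truncated subtraction is exact by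
  \<open>highest_dim_le\<close>, and \<open>l\<close> is absent because highest weight vectors are
  defined with all rows.\<close>

definition mult_coeff :: "nat \<Rightarrow> nat \<Rightarrow> nat list \<Rightarrow> nat" where
  "mult_coeff r n \<mu> = Q.dim (highest n (hpoly n (part_wt \<mu>))) - Q.dim (highest n (hideal n r (part_wt \<mu>)))"

definition dim_diff :: "nat \<Rightarrow> nat \<Rightarrow> (nat \<Rightarrow>\<^sub>0 nat) \<Rightarrow> int" where
  "dim_diff r n d = int (Q.dim (hpoly n d)) - int (Q.dim (hideal n r d))"

lemma highest_dim_le: "Q.dim (highest n (hideal n r d)) \<le> Q.dim (highest n (hpoly n d))"
proof (rule Q.dim_mono_fin)
  show "highest n (hideal n r d) \<subseteq> highest n (hpoly n d)" using hideal_hpoly by (auto simp: highest_def)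
  show "Q.fin_spanned (highest n (hpoly n d))"
    using fin_spanned_hpoly[of n d] unfolding Q.fin_spanned_def highest_def by blast
qed

lemma vandermonde_dim_diff_leading:
  assumes e: "e \<in> weights l N" "dominant l e"
  shows "lk (vandermonde l * weight_series l N (dim_diff r n)) (e + weight_vec l (staircase l)) =
    int (Q.dim (highest n (hpoly n e))) - int (Q.dim (highest n (hideal n r e)))"
proof -
  let ?d = "e + weight_vec l (staircase l)"
  let ?A = "weight_series l N (\<lambda>d. of_nat (Q.dim (hpoly n d))) :: rat qpoly" and ?B = "weight_series l N (\<lambda>d. of_nat (Q.dim (hideal n r d))) :: rat qpoly"
  have "(of_int (lk (vandermonde l * weight_series l N (dim_diff r n)) ?d) :: rat) = lk (vandermonde l * (?A - ?B)) ?d"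
    by (rule lookup_vandermonde_times_of_int) (simp add: lookup_weight_series dim_diff_def lookup_minus)
  also have "\<dots> = lk (vandermonde l * ?A) ?d - lk (vandermonde l * ?B) ?d" by (simp add: right_diff_distrib lookup_minus)
  also have "\<dots> = of_int (int (Q.dim (highest n (hpoly n e))) - int (Q.dim (highest n (hideal n r e))))"
    using hpoly.vandermonde_character_leading[OF e, of n] hideal.vandermonde_character_leading[OF e, of n r] by (simp add: highest_def)
  finally show ?thesis by (simp only: of_int_eq_iff)
qed

text \<open>A weight with more than \<open>n\<close> parts has no nonzero highest weight vectors,
  and above the degree bound the ideal is everything, so both exclusions only drop zeros.\<close>

lemma vandermonde_dim_diff_coeff:
  assumes r: "r \<ge> 1" and n: "n \<ge> 1" and \<mu>: "is_partition \<mu>" "part_wt \<mu> \<in> weights l N"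
  shows "lk (vandermonde l * weight_series l N (dim_diff r n)) (part_wt \<mu> + weight_vec l (staircase l)) =
    (if length \<mu> \<le> n \<and> N \<le> 2 * r * n - r - n then int (mult_coeff r n \<mu>) else 0)"
proof -
  let ?e = "part_wt \<mu>"
  have dom: "dominant l ?e" using part_wt_mono[OF \<mu>(1)] by (simp add: dominant_def)
  have eq: "lk (vandermonde l * weight_series l N (dim_diff r n)) (?e + weight_vec l (staircase l)) = int (mult_coeff r n \<mu>)"
    unfolding vandermonde_dim_diff_leading[OF \<mu>(2) dom] mult_coeff_def using highest_dim_le[of n r ?e] by simp
  have "mult_coeff r n \<mu> = 0" if "\<not> length \<mu> \<le> n"
  proof -
    have "lk ?e n \<noteq> 0" using that partition_pos[OF \<mu>(1), of n] by (simp add: lookup_part_wt)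
    then have "highest n (hpoly n ?e) \<subseteq> Q.span {}"
      using hpoly_highest_long[of _ n ?e] by (auto simp: highest_def)
    then show ?thesis using Q.dim_le_card[of "highest n (hpoly n ?e)" "{}"] by (simp add: mult_coeff_def)
  qed
  moreover have "mult_coeff r n \<mu> = 0" if "\<not> N \<le> 2 * r * n - r - n"
  proof -
    have "total_degree ?e = N"
      using \<mu>(2) total_degree_superset[of "{..<l}" ?e] by (simp add: weights_def)
    then have "hpoly n ?e = hideal n r ?e" using hpoly_eq_hideal_large[OF r n] that by simp
    then show ?thesis by (simp add: mult_coeff_def)
  qed
  ultimately show ?thesis unfolding eq by auto
qed

theorem theorem3p1:
  fixes r n :: nat
  assumes "r \<ge> 1" and "n \<ge> 1"
  shows "\<exists>c :: nat list \<Rightarrow> nat. \<forall>l\<ge>1.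
    hilbert_series r n l =
    Poly_Mapping.lookup
      (\<Sum>\<mu> | is_partition \<mu> \<and> length \<mu> \<le> n \<and> sum_list \<mu> \<le> 2 * r * n - r - n.
        of_nat (c \<mu>) * schur l \<mu>)"
proof (intro exI[of _ "mult_coeff r n"] allI impI)
  fix l :: nat
  define D where "D = 2 * r * n - r - n"
  define S where "S = {\<mu>. is_partition \<mu> \<and> length \<mu> \<le> n \<and> sum_list \<mu> \<le> D}"
  \<comment> \<open>Only partitions with at most \<open>l\<close> parts fit the alternant of size
    \<open>l\<close>; the Schur polynomials of the others are zero.\<close>
  define S' where "S' = {\<mu>\<in>S. length \<mu> \<le> l}"
  \<comment> \<open>The Hilbert series cut off above degree \<open>D\<close>; that nothing is lost
    follows at the end from the degree bound.\<close>
  define H where "H = (\<Sum>N\<le>D. weight_series l N (dim_diff r n))"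
  define G where "G = (\<Sum>\<mu>\<in>S'. of_nat (mult_coeff r n \<mu>) * (alternant l (\<lambda>j. lk (part_wt \<mu>) j + staircase l j) :: int qpoly))"
  have "finite S" unfolding S_def by (rule finite_partitions)
  then have finS: "finite S" "finite S'" by (simp_all add: S'_def)
  have "G = vandermonde l * (\<Sum>\<mu>\<in>S'. of_nat (mult_coeff r n \<mu>) * schur l \<mu>)"
  proof -
    have "alternant l (\<lambda>j. lk (part_wt \<mu>) j + staircase l j) = vandermonde l * schur l \<mu>" if "\<mu> \<in> S'" for \<mu>
      using that alternant_eq_vandermonde_schurf[of l "lk (part_wt \<mu>)"] part_wt_mono[of \<mu>] schur_schurf[of \<mu> l]
      by (simp add: S'_def S_def)
    then show ?thesis unfolding G_def sum_distrib_left by (intro sum.cong refl) (simp add: mult_ac)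
  qed
  also have "(\<Sum>\<mu>\<in>S'. of_nat (mult_coeff r n \<mu>) * schur l \<mu>) = (\<Sum>\<mu>\<in>S. of_nat (mult_coeff r n \<mu>) * schur l \<mu>)"
  proof (rule sum.mono_neutral_left[OF finS(1)])
    show "S' \<subseteq> S" by (auto simp: S'_def)
    show "\<forall>\<mu>\<in>S - S'. of_nat (mult_coeff r n \<mu>) * schur l \<mu> = 0"
    proof
      fix \<mu> assume "\<mu> \<in> S - S'"
      then have "is_partition \<mu>" "l < length \<mu>" by (auto simp: S'_def S_def)
      then show "of_nat (mult_coeff r n \<mu>) * schur l \<mu> = 0" by (simp add: schur_long)
    qed
  qed
  finally have G: "G = vandermonde l * (\<Sum>\<mu>\<in>S. of_nat (mult_coeff r n \<mu>) * schur l \<mu>)" .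
  \<comment> \<open>The Vandermonde product is antisymmetric and \<open>H\<close> symmetric, so it
    suffices to compare coefficients at dominant weights plus the staircase: multiplicities on one
    side, single alternants on the other.\<close>
  have "vandermonde l * H - G = 0"
  proof (rule antisymmetric_zero[of l])
    fix a b assume ab: "a < l" "b < l" "a \<noteq> b"
    have "swap_vars a b (weight_series l N (dim_diff r n)) = weight_series l N (dim_diff r n)" for N
    proof (rule poly_mapping_eqI)
      fix d
      have "swap_wt a b d \<in> weights l N \<longleftrightarrow> d \<in> weights l N" for d
      proof -
        have s: "Transposition.transpose a b permutes {..<l}" using ab by (intro permutes_swap_id) auto
        have "swap_wt a b d \<in> weights l N" if d: "d \<in> weights l N" for d
        proof -
          have "(\<Sum>i<l. lk (swap_wt a b d) i) = (\<Sum>i<l. lk d i)"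
            using sum.permute[OF s, of "lk d"] by (simp add: lookup_swap_wt o_def)
          moreover have "lk (swap_wt a b d) i = 0" if "\<not> i < l" for i
            using that ab weights_zero_outside[OF d, of i] by (auto simp: lookup_swap_wt transpose_def)
          ultimately show ?thesis using d by (auto simp: weights_def in_keys_iff)
        qed
        then show ?thesis by (metis swap_wt_invol)
      qed
      then show "lk (swap_vars a b (weight_series l N (dim_diff r n))) d = lk (weight_series l N (dim_diff r n)) d"
        by (simp add: lookup_swap_vars lookup_weight_series dim_diff_def hpoly.dim_swap hideal.dim_swap)
    qed
    then have H: "swap_vars a b H = H" by (simp add: H_def swap_vars_sum)
    have vandermonde: "swap_vars a b (vandermonde l :: int qpoly) = - vandermonde l" using swap_vars_alternant[OF ab] by (simp flip: alternant_staircase)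
    have nat: "swap_vars a b (of_nat k * f) = of_nat k * swap_vars a b f" for k and f :: "int qpoly"
      by (rule poly_mapping_eqI) (simp add: lookup_swap_vars lookup_of_int_times[of "int k", simplified])
    have "swap_vars a b G = - G" unfolding G_def swap_vars_sum nat swap_vars_alternant[OF ab] by (simp add: sum_negf)
    moreover have "swap_vars a b (f - g) = swap_vars a b f - swap_vars a b g" for f g :: "int qpoly"
      by (rule poly_mapping_eqI) (simp add: lookup_swap_vars lookup_minus)
    ultimately show "swap_vars a b (vandermonde l * H - G) = - (vandermonde l * H - G)"
      by (simp add: swap_vars_mult H vandermonde)
  next
    fix d assume ne: "lk (vandermonde l * H - G) d \<noteq> 0"
    have alt: "lk (alternant l k :: int qpoly) d \<noteq> 0 \<Longrightarrow> Poly_Mapping.keys d \<subseteq> {..<l}" for k d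
      unfolding alternant_expand lookup_sum
      by (auto elim!: sum.not_neutral_contains_not_neutral simp: lookup_single when_def in_keys_iff lookup_weight_vec split: if_splits)
    have "Poly_Mapping.keys d \<subseteq> {..<l}" if "lk (vandermonde l * H) d \<noteq> 0"
    proof -
      have "(vandermonde l :: int qpoly) \<in> supported_on (\<lambda>d. Poly_Mapping.keys d \<subseteq> {..<l})"
        unfolding alternant_staircase[symmetric] supported_on_iff using alt by blast
      moreover have "H \<in> supported_on (\<lambda>d. Poly_Mapping.keys d \<subseteq> {..<l})"
      proof -
        have "lk H d = 0" if "\<not> Poly_Mapping.keys d \<subseteq> {..<l}" for d
          using that by (auto simp: H_def lookup_sum lookup_weight_series weights_def intro!: sum.neutral)
        then show ?thesis unfolding supported_on_iff by blast
      qed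
      ultimately have "vandermonde l * H \<in> supported_on (\<lambda>d. Poly_Mapping.keys d \<subseteq> {..<l})"
        by (rule supported_on_mult) (auto simp: keys_add_nat)
      then show ?thesis using that unfolding supported_on_iff by blast
    qed
    moreover have "Poly_Mapping.keys d \<subseteq> {..<l}" if "lk G d \<noteq> 0"
    proof -
      from sum.not_neutral_contains_not_neutral[OF that[unfolded G_def lookup_sum]] obtain \<mu> where
        "lk (of_nat (mult_coeff r n \<mu>) * (alternant l (\<lambda>j. lk (part_wt \<mu>) j + staircase l j) :: int qpoly)) d \<noteq> 0"
        by blast
      then have "lk (alternant l (\<lambda>j. lk (part_wt \<mu>) j + staircase l j) :: int qpoly) d \<noteq> 0"
        by (simp add: lookup_of_int_times[of "int _", simplified])
      then show ?thesis by (rule alt)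
    qed
    moreover have "lk (vandermonde l * H) d \<noteq> 0 \<or> lk G d \<noteq> 0" using ne by (auto simp: lookup_minus)
    ultimately show "Poly_Mapping.keys d \<subseteq> {..<l}" by blast
  next
    fix e N assume e: "e \<in> weights l N" "dominant l e"
    let ?d = "e + weight_vec l (staircase l)"
    obtain \<mu> where \<mu>: "is_partition \<mu>" "part_wt \<mu> = e" "sum_list \<mu> = N" "length \<mu> \<le> l"
      using part_wt_surj[OF e] by blast
    have "lk (vandermonde l * H) ?d = (\<Sum>M\<le>D. lk (vandermonde l * weight_series l M (dim_diff r n)) ?d)"
      by (simp add: H_def sum_distrib_left lookup_sum)
    also have "\<dots> = (\<Sum>M\<le>D. if M = N then lk (vandermonde l * weight_series l N (dim_diff r n)) ?d else 0)"
      using vandermonde_weight_series_degree[OF _ e(1)] by (intro sum.cong refl) auto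
    also have "\<dots> = (if \<mu> \<in> S' then int (mult_coeff r n \<mu>) else 0)"
      using vandermonde_dim_diff_coeff[OF assms \<mu>(1), of l N] \<mu> e(1) by (simp add: S'_def S_def D_def)
    also have "\<dots> = (\<Sum>\<nu>\<in>S'. if \<nu> = \<mu> then int (mult_coeff r n \<mu>) else 0)"
      using finS by simp
    also have "\<dots> = lk G ?d"
    proof -
      have "lk (of_nat (mult_coeff r n \<nu>) * (alternant l (\<lambda>j. lk (part_wt \<nu>) j + staircase l j) :: int qpoly)) ?d =
        (if \<nu> = \<mu> then int (mult_coeff r n \<mu>) else 0)" if \<nu>: "\<nu> \<in> S'" for \<nu>
      proof -
        have part: "is_partition \<nu>" "length \<nu> \<le> l" using \<nu> by (auto simp: S'_def S_def)
        have "(\<forall>i<l. lk (part_wt \<nu>) i = lk e i) \<longleftrightarrow> \<nu> = \<mu>"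
        proof
          assume h: "\<forall>i<l. lk (part_wt \<nu>) i = lk e i"
          have "part_wt \<nu> = part_wt \<mu>"
          proof (rule poly_mapping_eqI)
            fix i show "lk (part_wt \<nu>) i = lk (part_wt \<mu>) i"
              using h \<mu>(2) weights_zero_outside[OF e(1), of i] part(2) by (cases "i < l") (auto simp: lookup_part_wt)
          qed
          then show "\<nu> = \<mu>" using part_wt_inj part(1) \<mu>(1) by blast
        qed (use \<mu>(2) in simp)
        then show ?thesis
          using alternant_leading[of l "lk (part_wt \<nu>)", OF part_wt_mono[OF part(1)] e, where 'a = int]
          by (simp add: lookup_of_int_times[of "int _", simplified])
      qed
      then show ?thesis unfolding G_def lookup_sum by (intro sum.cong refl) simp
    qed
    finally show "lk (vandermonde l * H - G) ?d = 0" by (simp add: lookup_minus)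
  qed
  then have "vandermonde l * H = vandermonde l * (\<Sum>\<mu>\<in>S. of_nat (mult_coeff r n \<mu>) * schur l \<mu>)" using G by simp
  then have H: "H = (\<Sum>\<mu>\<in>S. of_nat (mult_coeff r n \<mu>) * schur l \<mu>)"
    using vandermonde_nonzero[of l] by simp
  have "hilbert_series r n l = lk H"
  proof
    fix d
    show "hilbert_series r n l d = lk H d"
    proof (cases "Poly_Mapping.keys d \<subseteq> {..<l}")
      case True
      have "(\<Sum>i<l. lk d i) = total_degree d" using total_degree_superset[of "{..<l}" d] True by simp
      then have "lk H d = (\<Sum>N\<le>D. if N = total_degree d then dim_diff r n d else 0)"
        using True unfolding H_def lookup_sum lookup_weight_series by (intro sum.cong refl) (auto simp: weights_def)
      \<comment> \<open>For total degree above \<open>D\<close> both dimensions coincide, so the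
        missing summand is zero.\<close>
      also have "\<dots> = dim_diff r n d"
        using hpoly_eq_hideal_large[OF assms, of d] by (auto simp: D_def dim_diff_def not_le)
      finally show ?thesis using True by (simp add: hilbert_series_dims dim_diff_def)
    next
      case False
      then have "lk H d = 0" by (auto simp: H_def lookup_sum lookup_weight_series weights_def intro!: sum.neutral)
      then show ?thesis using False by (simp add: hilbert_series_dims)
    qed
  qed
  then show "hilbert_series r n l = Poly_Mapping.lookup
      (\<Sum>\<mu> | is_partition \<mu> \<and> length \<mu> \<le> n \<and> sum_list \<mu> \<le> 2 * r * n - r - n.
        of_nat (mult_coeff r n \<mu>) * schur l \<mu>)"
    by (simp only: H S_def D_def)
qed

end
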